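(* Let $(A,\cdot_A,a_A)$ be a left-symmetric algebroid. (1) If $(H,\mathfrak B)$ is a $\mathrm{KV\Omega}$-structure on $A$, then $(H,N)$ with $N=H^\sharp\circ\mathfrak B^\natural$ is a Koszul-Vinberg-Nijenhuis structure on $A$. (2) Conversely, if $(H,N)$ is a Koszul-Vinberg-Nijenhuis structure on $A$ and $H$ is nondegenerate, then $(H,\mathfrak B)$ is a $\mathrm{KV\Omega}$-structure on $A$, where $\mathfrak B$ is given by $\mathfrak B^\natural=(H^\sharp)^{-1}\circ N$.
   Context: Left-symmetric algebroids. A left-symmetric algebroid $(A,\cdot_A,a_A)$ is a smooth real vector bundle $A\to M$ with an $\mathbb R$-bilinear operation $\cdot_A$ on $\Gamma(A)$ such that $x\cdot_A(y\cdot_A z)-(x\cdot_A y)\cdot_A z$ is symmetric in $x,y$, and a bundle map $a_A:A\to TM$ such that $x\cdot_A(fy)=f(x\cdot_A y)+a_A(x)(f)\,y$ and $(fx)\cdot_A y=f(x\cdot_A y)$ for $x,y\in\Gamma(A)$, $f\in C^\infty(M)$. Put $[x,y]_A=x\cdot_A y-y\cdot_A x$; $(A,[-,-]_A,a_A)$ is a Lie algebroid. Nijenhuis operators. A bundle map $N:A\to A$ (over the identity) is a Nijenhuis operator on $A$ if $N(x)\cdot_A N(y)=N\big(x\cdot_A N(y)+N(x)\cdot_A y-N(x\cdot_A y)\big)$ for all $x,y\in\Gamma(A)$. Then $x\cdot_N y=N(x)\cdot_A y+x\cdot_A N(y)-N(x\cdot_A y)$ and $a_N=a_A\circ N$ make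 $(A,\cdot_N,a_N)$ a left-symmetric algebroid; $[x,y]_N=x\cdot_N y-y\cdot_N x$. $N^*:A^*\to A^*$ is the dual map. Koszul-Vinberg structures. $\mathrm{Sym}^2(A)$ is the set of symmetric sections $H$ of $A\otimes A$; $H^\sharp:A^*\to A$ is $\langle H^\sharp(\alpha),\beta\rangle=H(\alpha,\beta)$; $H$ is nondegenerate if $H^\sharp$ is invertible. For $\alpha_i\in\Gamma(A^* )$, $$\begin{aligned}[\![ H,H]\!]_A(\alpha_1,\alpha_2,\alpha_3)=\ &a_A(H^\sharp(\alpha_1))\langle H^\sharp(\alpha_2),\alpha_3\rangle-a_A(H^\sharp(\alpha_2))\langle H^\sharp(\alpha_1),\alpha_3\rangle+\langle\alpha_1,H^\sharp(\alpha_2)\cdot_A H^\sharp(\alpha_3)\rangle\\&-\langle\alpha_2,H^\sharp(\alpha_1)\cdot_A H^\sharp(\alpha_3)\rangle-\langle\alpha_3,[H^\sharp(\alpha_1),H^\sharp(\alpha_2)]_A\rangle.\end{aligned}$$ $H$ is a Koszul-Vinberg structure if $[\![ H,H]\!]_A=0$. Products on $\Gamma(A^* )$. $\langle\mathcal L_x\alpha,y\rangle=a_A(x)\langle\alpha,y\rangle-\langle\alpha,[x,y]_A\rangle$, $\langle R_x\alpha,y\rangle=-\langle\alpha,y\cdot_A x\rangle$, $\langle d_Af,x\rangle=a_A(x)(f)$. Set $\alpha\cdot^{H^\sharp}\beta=\mathcal L_{H^\sharp(\alpha)}\beta-R_{H^\sharp(\beta)}\alpha-d_A(H(\alpha,\beta))$.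 Let $\mathcal L^N,R^N,d_A^N$ be given by the same formulas with $(\cdot_A,[-,-]_A,a_A)$ replaced by $(\cdot_N,[-,-]_N,a_N)$, and set $\alpha\star^{H^\sharp}\beta=\mathcal L^N_{H^\sharp(\alpha)}\beta-R^N_{H^\sharp(\beta)}\alpha-d^N_A(H(\alpha,\beta))$ and $\alpha\cdot^{H^\sharp}_{N^*}\beta=N^*(\alpha)\cdot^{H^\sharp}\beta+\alpha\cdot^{H^\sharp}N^*(\beta)-N^*(\alpha\cdot^{H^\sharp}\beta)$. Koszul-Vinberg-Nijenhuis (KVN) structure: a pair $(H,N)$ with $H$ a Koszul-Vinberg structure and $N$ a Nijenhuis operator on $A$ such that $N\circ H^\sharp=H^\sharp\circ N^*$ and $\alpha\star^{H^\sharp}\beta=\alpha\cdot^{H^\sharp}_{N^*}\beta$ for all $\alpha,\beta\in\Gamma(A^* )$. Cocycles. $\mathrm{Sym}^2(A^* )$ is the set of symmetric sections $\mathfrak B$ of $A^*\otimes A^*$; $\mathfrak B^\natural:A\to A^*$ is $\langle\mathfrak B^\natural(x),y\rangle=\mathfrak B(x,y)$. $\delta_A\mathfrak B(x,y,z)=a_A(x)\mathfrak B(y,z)-a_A(y)\mathfrak B(x,z)-\mathfrak B(y,x\cdot_A z)+\mathfrak B(x,y\cdot_A z)-\mathfrak B([x,y]_A,z)$; $\mathfrak B$ is a $2$-cocycle if $\delta_A\mathfrak B=0$. $\mathrm{KV\Omega}$-structure: a pair $(H,\mathfrak B)$ with $H$ a Koszul-Vinberg structure and $\mathfrak B\in \mathrm{Sym}^2(A^*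 )$ a $2$-cocycle such that $\mathfrak B_N$ is also a $2$-cocycle, where $N=H^\sharp\circ\mathfrak B^\natural$ and $\mathfrak B_N(x,y)=\mathfrak B(N(x),y)$. *)

theory Defs
  imports "HOL-Analysis.Analysis"
begin

section \<open>Smooth manifolds\<close>

text \<open>
  Finite-dimensional real inner product spaces serve as the model spaces \<open>\<real>\<^sup>n\<close>.  The library
  class \<open>euclidean_space\<close> would exclude the dimension 0, i.e. discrete base manifolds
  (in particular left-symmetric algebras, where the base is a point) and bundles of rank 0.
\<close>

class finite_dim_inner = real_inner +
  assumes finite_spanning_set: "\<exists>B. finite B \<and> (\<forall>x. \<exists>c. x = (\<Sum>b\<in>B. c b *\<^sub>R b))"

instance euclidean_space \<subseteq> finite_dim_inner
  proof
  show "\<exists>B::'a set. finite B \<and> (\<forall>x. \<exists>c. x = (\<Sum>b\<in>B. c b *\<^sub>R b))"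
    by (intro exI[of _ Basis] conjI allI) (auto intro!: exI euclidean_representation[symmetric])
qed

lemma finite_dim_inner_span: "\<exists>B::'e::finite_dim_inner set. finite B \<and> span B = UNIV"
proof -
  obtain B :: "'e set" where B: "finite B" "\<And>x. \<exists>c. x = (\<Sum>b\<in>B. c b *\<^sub>R b)"
    using finite_spanning_set by blast
  have "x \<in> span B" for x
  proof -
    obtain c where "x = (\<Sum>b\<in>B. c b *\<^sub>R b)"
      using B(2) by blast
    then show ?thesis
      by (simp add: span_sum span_scale span_base)
  qed
  with B(1) show ?thesis by blast
qed

text \<open>\<open>C\<^sup>k\<close> and smooth maps; both are meant for an open set \<open>S\<close>.\<close>

primrec Ck_on :: "nat \<Rightarrow> 'e set \<Rightarrow> ('e::real_normed_vector \<Rightarrow> 'b::real_normed_vector) \<Rightarrow> bool" where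
  "Ck_on 0 S f \<longleftrightarrow> continuous_on S f"
| "Ck_on (Suc k) S f \<longleftrightarrow>
     (\<forall>x\<in>S. f differentiable (at x)) \<and> (\<forall>v. Ck_on k S (\<lambda>x. frechet_derivative f (at x) v))"

definition smooth_on :: "'e set \<Rightarrow> ('e::real_normed_vector \<Rightarrow> 'b::real_normed_vector) \<Rightarrow> bool" where
  "smooth_on S f \<longleftrightarrow> (\<forall>k. Ck_on k S f)"

text \<open>
  The base manifold is the whole type \<open>'m\<close>; Hausdorff and second countable are type class
  assumptions.  A chart is a pair of its domain and its coordinate map.
\<close>

definition smooth_atlas ::
  "('m::{t2_space,second_countable_topology} set \<times> ('m \<Rightarrow> 'e::finite_dim_inner)) set \<Rightarrow> bool" where
  "smooth_atlas \<A> \<longleftrightarrow>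
     (\<Union>(U,\<kappa>)\<in>\<A>. U) = UNIV \<and>
     (\<forall>(U,\<kappa>)\<in>\<A>. open U \<and> open (\<kappa> ` U) \<and> homeomorphism U (\<kappa> ` U) \<kappa> (inv_into U \<kappa>)) \<and>
     (\<forall>(U,\<kappa>)\<in>\<A>. \<forall>(V,\<kappa>')\<in>\<A>. smooth_on (\<kappa> ` (U \<inter> V)) (\<kappa>' \<circ> inv_into U \<kappa>))"

section \<open>Vector bundles\<close>

text \<open>
  The fibre over \<open>p\<close> is a linear subspace \<open>fibre A p\<close> of one ambient real vector space \<open>'a\<close>,
  from which it inherits its operations.  The ambient space carries no topology and the subspaces
  may overlap: the total space is the disjoint union \<open>SIGMA p:UNIV. fibre A p\<close>, and its smooth
  structure is the one given by the local trivializations.  Every real vector bundle is of this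
  form, e.g. with the direct sum of all its fibres as ambient space.  A local trivialization is a
  pair of an open set \<open>U\<close> and a family of linear isomorphisms of the fibres over \<open>U\<close>
  with the typical fibre \<open>'v\<close>.
\<close>

record ('m,'e,'a,'v) vbundle =
  atlas :: "('m set \<times> ('m \<Rightarrow> 'e)) set"
  fibre :: "'m \<Rightarrow> 'a set"
  trivs :: "('m set \<times> ('m \<Rightarrow> 'a \<Rightarrow> 'v)) set"

definition smooth_map_on ::
  "('m::{t2_space,second_countable_topology},'e::finite_dim_inner,'a,'v,'z) vbundle_scheme
     \<Rightarrow> 'm set \<Rightarrow> ('m \<Rightarrow> 'b::real_normed_vector) \<Rightarrow> bool" where
  "smooth_map_on A W f \<longleftrightarrow> (\<forall>(U,\<kappa>)\<in>atlas A. smooth_on (\<kappa> ` (U \<inter> W)) (f \<circ> inv_into U \<kappa>))"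

text \<open>The local section that is constantly \<open>w\<close> in the trivialization \<open>\<phi>\<close>.\<close>

definition frame ::
  "('m,'e,'a,'v,'z) vbundle_scheme \<Rightarrow> ('m \<Rightarrow> 'a \<Rightarrow> 'v) \<Rightarrow> 'v \<Rightarrow> 'm \<Rightarrow> 'a" where
  "frame A \<phi> w p = inv_into (fibre A p) (\<phi> p) w"

definition vector_bundle ::
  "('m::{t2_space,second_countable_topology},'e::finite_dim_inner,'a::real_vector,
    'v::finite_dim_inner,'z) vbundle_scheme \<Rightarrow> bool" where
  "vector_bundle A \<longleftrightarrow>
     smooth_atlas (atlas A) \<and>
     (\<forall>p. subspace (fibre A p)) \<and>
     (\<Union>(U,\<phi>)\<in>trivs A. U) = UNIV \<and>
     (\<forall>(U,\<phi>)\<in>trivs A. open U \<and>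
        (\<forall>p\<in>U. bij_betw (\<phi> p) (fibre A p) UNIV \<and>
           (\<forall>u\<in>fibre A p. \<forall>v\<in>fibre A p. \<phi> p (u + v) = \<phi> p u + \<phi> p v) \<and>
           (\<forall>u\<in>fibre A p. \<forall>c. \<phi> p (c *\<^sub>R u) = c *\<^sub>R \<phi> p u))) \<and>
     (\<forall>(U,\<phi>)\<in>trivs A. \<forall>(V,\<psi>)\<in>trivs A. \<forall>w.
        smooth_map_on A (U \<inter> V) (\<lambda>p. \<psi> p (frame A \<phi> w p)))"

definition smooth_functions ::
  "('m::{t2_space,second_countable_topology},'e::finite_dim_inner,'a,'v,'z) vbundle_scheme
     \<Rightarrow> ('m \<Rightarrow> real) set" where
  "smooth_functions A = {f. smooth_map_on A UNIV f}"

definition sections ::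
  "('m::{t2_space,second_countable_topology},'e::finite_dim_inner,'a::real_vector,
    'v::finite_dim_inner,'z) vbundle_scheme \<Rightarrow> ('m \<Rightarrow> 'a) set" where
  "sections A = {x. (\<forall>p. x p \<in> fibre A p) \<and>
     (\<forall>(U,\<phi>)\<in>trivs A. smooth_map_on A U (\<lambda>p. \<phi> p (x p)))}"

text \<open>
  Linear functionals on the fibre are extended by 0 outside the fibre, so that equality of
  functionals is equality of functions.
\<close>

definition dual_fibre ::
  "('m,'e,'a::real_vector,'v,'z) vbundle_scheme \<Rightarrow> 'm \<Rightarrow> ('a \<Rightarrow> real) set" where
  "dual_fibre A p = {\<alpha>.
     (\<forall>u\<in>fibre A p. \<forall>v\<in>fibre A p. \<alpha> (u + v) = \<alpha> u + \<alpha> v) \<and>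
     (\<forall>u\<in>fibre A p. \<forall>c. \<alpha> (c *\<^sub>R u) = c * \<alpha> u) \<and>
     (\<forall>u. u \<notin> fibre A p \<longrightarrow> \<alpha> u = 0)}"

text \<open>The local section of the dual bundle that is constantly \<open>inner w\<close> in the dual
  trivialization of \<open>\<phi>\<close>.\<close>

definition coframe ::
  "('m,'e,'a,'v::finite_dim_inner,'z) vbundle_scheme \<Rightarrow> ('m \<Rightarrow> 'a \<Rightarrow> 'v) \<Rightarrow> 'v
     \<Rightarrow> 'm \<Rightarrow> 'a \<Rightarrow> real" where
  "coframe A \<phi> w p = (\<lambda>u. if u \<in> fibre A p then inner w (\<phi> p u) else 0)"

definition dual_sections ::
  "('m::{t2_space,second_countable_topology},'e::finite_dim_inner,'a::real_vector,
    'v::finite_dim_inner,'z) vbundle_scheme \<Rightarrow> ('m \<Rightarrow> 'a \<Rightarrow> real) set" where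
  "dual_sections A = {\<alpha>. (\<forall>p. \<alpha> p \<in> dual_fibre A p) \<and>
     (\<forall>(U,\<phi>)\<in>trivs A. \<forall>w. smooth_map_on A U (\<lambda>p. \<alpha> p (frame A \<phi> w p)))}"

definition pairing :: "('m \<Rightarrow> 'a \<Rightarrow> real) \<Rightarrow> ('m \<Rightarrow> 'a) \<Rightarrow> 'm \<Rightarrow> real" where
  "pairing \<alpha> x p = \<alpha> p (x p)"

definition bundle_endomorphism ::
  "('m::{t2_space,second_countable_topology},'e::finite_dim_inner,'a::real_vector,
    'v::finite_dim_inner,'z) vbundle_scheme \<Rightarrow> ('m \<Rightarrow> 'a \<Rightarrow> 'a) \<Rightarrow> bool" where
  "bundle_endomorphism A N \<longleftrightarrow>
     (\<forall>p. \<forall>u\<in>fibre A p. N p u \<in> fibre A p \<and>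
        (\<forall>v\<in>fibre A p. N p (u + v) = N p u + N p v) \<and>
        (\<forall>c. N p (c *\<^sub>R u) = c *\<^sub>R N p u)) \<and>
     (\<forall>(U,\<phi>)\<in>trivs A. \<forall>w. smooth_map_on A U (\<lambda>p. \<phi> p (N p (frame A \<phi> w p))))"

text \<open>Action of a family of fibrewise maps on sections (of the bundle or of its dual).\<close>

definition act :: "('m \<Rightarrow> 'b \<Rightarrow> 'c) \<Rightarrow> ('m \<Rightarrow> 'b) \<Rightarrow> 'm \<Rightarrow> 'c" where
  "act N x p = N p (x p)"

definition dual_map ::
  "('m,'e,'a,'v,'z) vbundle_scheme \<Rightarrow> ('m \<Rightarrow> 'a \<Rightarrow> 'a) \<Rightarrow> 'm \<Rightarrow> ('a \<Rightarrow> real) \<Rightarrow> 'a \<Rightarrow> real" where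
  "dual_map A N p \<alpha> = (\<lambda>u. if u \<in> fibre A p then \<alpha> (N p u) else 0)"

section \<open>Symmetric tensors\<close>

text \<open>
  Sections of \<open>A \<otimes> A\<close> are smooth families of bilinear forms on the dual fibres, sections of
  \<open>A\<^sup>* \<otimes> A\<^sup>*\<close> smooth families of bilinear forms on the fibres.  Only the values on
  \<^emph>\<open>(dual) fibres\<close> matter.  Symmetry makes linearity in the first argument sufficient.
\<close>

definition Sym2 ::
  "('m::{t2_space,second_countable_topology},'e::finite_dim_inner,'a::real_vector,
    'v::finite_dim_inner,'z) vbundle_scheme
     \<Rightarrow> ('m \<Rightarrow> ('a \<Rightarrow> real) \<Rightarrow> ('a \<Rightarrow> real) \<Rightarrow> real) set" where
  "Sym2 A = {H.
     (\<forall>p. \<forall>\<alpha>\<in>dual_fibre A p. \<forall>\<beta>\<in>dual_fibre A p.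
        H p \<alpha> \<beta> = H p \<beta> \<alpha> \<and>
        (\<forall>\<gamma>\<in>dual_fibre A p. H p (\<lambda>u. \<alpha> u + \<beta> u) \<gamma> = H p \<alpha> \<gamma> + H p \<beta> \<gamma>) \<and>
        (\<forall>c. H p (\<lambda>u. c * \<alpha> u) \<beta> = c * H p \<alpha> \<beta>)) \<and>
     (\<forall>(U,\<phi>)\<in>trivs A. \<forall>w w'.
        smooth_map_on A U (\<lambda>p. H p (coframe A \<phi> w p) (coframe A \<phi> w' p)))}"

definition Sym2_dual ::
  "('m::{t2_space,second_countable_topology},'e::finite_dim_inner,'a::real_vector,
    'v::finite_dim_inner,'z) vbundle_scheme \<Rightarrow> ('m \<Rightarrow> 'a \<Rightarrow> 'a \<Rightarrow> real) set" where
  "Sym2_dual A = {B.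
     (\<forall>p. \<forall>u\<in>fibre A p. \<forall>v\<in>fibre A p.
        B p u v = B p v u \<and>
        (\<forall>w\<in>fibre A p. B p (u + v) w = B p u w + B p v w) \<and>
        (\<forall>c. B p (c *\<^sub>R u) v = c * B p u v)) \<and>
     (\<forall>(U,\<phi>)\<in>trivs A. \<forall>w w'.
        smooth_map_on A U (\<lambda>p. B p (frame A \<phi> w p) (frame A \<phi> w' p)))}"

text \<open>\<open>H\<^sup>\<sharp>\<close> and \<open>\<BB>\<^sup>\<natural>\<close>.\<close>

definition sharp ::
  "('m,'e,'a::real_vector,'v,'z) vbundle_scheme
     \<Rightarrow> ('m \<Rightarrow> ('a \<Rightarrow> real) \<Rightarrow> ('a \<Rightarrow> real) \<Rightarrow> real) \<Rightarrow> 'm \<Rightarrow> ('a \<Rightarrow> real) \<Rightarrow> 'a" where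
  "sharp A H p \<alpha> = (THE u. u \<in> fibre A p \<and> (\<forall>\<beta>\<in>dual_fibre A p. \<beta> u = H p \<alpha> \<beta>))"

definition flat ::
  "('m,'e,'a,'v,'z) vbundle_scheme
     \<Rightarrow> ('m \<Rightarrow> 'a \<Rightarrow> 'a \<Rightarrow> real) \<Rightarrow> 'm \<Rightarrow> 'a \<Rightarrow> 'a \<Rightarrow> real" where
  "flat A B p u = (\<lambda>v. if v \<in> fibre A p then B p u v else 0)"

definition nondegenerate ::
  "('m,'e,'a::real_vector,'v,'z) vbundle_scheme
     \<Rightarrow> ('m \<Rightarrow> ('a \<Rightarrow> real) \<Rightarrow> ('a \<Rightarrow> real) \<Rightarrow> real) \<Rightarrow> bool" where
  "nondegenerate A H \<longleftrightarrow> (\<forall>p. bij_betw (sharp A H p) (dual_fibre A p) (fibre A p))"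

definition sharp_inv ::
  "('m,'e,'a::real_vector,'v,'z) vbundle_scheme
     \<Rightarrow> ('m \<Rightarrow> ('a \<Rightarrow> real) \<Rightarrow> ('a \<Rightarrow> real) \<Rightarrow> real) \<Rightarrow> 'm \<Rightarrow> 'a \<Rightarrow> 'a \<Rightarrow> real" where
  "sharp_inv A H p = inv_into (dual_fibre A p) (sharp A H p)"

text \<open>A form \<open>\<BB>\<close> with \<open>\<BB>\<^sup>\<natural> = (H\<^sup>\<sharp>)\<^sup>-\<^sup>1 \<circ> N\<close> exists; on the fibres it is clearly
  determined by this equation.\<close>

lemma flat_sharp_inv:
  assumes "nondegenerate A H" and "bundle_endomorphism A N" and "u \<in> fibre A p"
  shows "flat A (\<lambda>p u v. sharp_inv A H p (N p u) v) p u = sharp_inv A H p (N p u)"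
proof -
  have "N p u \<in> sharp A H p ` dual_fibre A p"
    using assms unfolding nondegenerate_def bundle_endomorphism_def bij_betw_def by blast
  then have "sharp_inv A H p (N p u) \<in> dual_fibre A p"
    unfolding sharp_inv_def by (rule inv_into_into)
  then show ?thesis
    by (auto simp: flat_def dual_fibre_def)
qed

section \<open>Left-symmetric algebroids\<close>

text \<open>
  Tangent vectors at \<open>p\<close> are the derivations at \<open>p\<close> of the algebra of smooth functions
  (set to 0 on functions that are not smooth).
\<close>

definition tangent_space ::
  "('m::{t2_space,second_countable_topology},'e::finite_dim_inner,'a,'v,'z) vbundle_scheme
     \<Rightarrow> 'm \<Rightarrow> (('m \<Rightarrow> real) \<Rightarrow> real) set" where
  "tangent_space A p = {D.
     (\<forall>f\<in>smooth_functions A. \<forall>g\<in>smooth_functions A.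
        D (\<lambda>q. f q + g q) = D f + D g \<and> D (\<lambda>q. f q * g q) = f p * D g + g p * D f) \<and>
     (\<forall>f\<in>smooth_functions A. \<forall>c. D (\<lambda>q. c * f q) = c * D f) \<and>
     (\<forall>f. f \<notin> smooth_functions A \<longrightarrow> D f = 0)}"

record ('m,'e,'a,'v) algebroid = "('m,'e,'a,'v) vbundle" +
  sprod :: "('m \<Rightarrow> 'a) \<Rightarrow> ('m \<Rightarrow> 'a) \<Rightarrow> 'm \<Rightarrow> 'a" (infixl "\<cdot>\<index>" 70)
  anchor :: "'m \<Rightarrow> 'a \<Rightarrow> ('m \<Rightarrow> real) \<Rightarrow> real"

text \<open>
  Bundle maps from \<open>A\<close> to the tangent bundle: smoothness means that the local frame sections
  are mapped to smooth local vector fields, i.e. ones that map smooth functions to smooth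
  functions.
\<close>

definition bundle_map_to_tangent ::
  "('m::{t2_space,second_countable_topology},'e::finite_dim_inner,'a::real_vector,
    'v::finite_dim_inner,'z) vbundle_scheme \<Rightarrow> ('m \<Rightarrow> 'a \<Rightarrow> ('m \<Rightarrow> real) \<Rightarrow> real) \<Rightarrow> bool" where
  "bundle_map_to_tangent A a \<longleftrightarrow>
     (\<forall>p. \<forall>u\<in>fibre A p. a p u \<in> tangent_space A p \<and>
        (\<forall>v\<in>fibre A p. \<forall>f. a p (u + v) f = a p u f + a p v f) \<and>
        (\<forall>c f. a p (c *\<^sub>R u) f = c * a p u f)) \<and>
     (\<forall>(U,\<phi>)\<in>trivs A. \<forall>w. \<forall>f\<in>smooth_functions A.
        smooth_map_on A U (\<lambda>p. a p (frame A \<phi> w p) f))"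

text \<open>The function \<open>a\<^sub>A(x)(f)\<close>.\<close>

definition anchor_deriv ::
  "('m,'e,'a,'v,'z) algebroid_scheme \<Rightarrow> ('m \<Rightarrow> 'a) \<Rightarrow> ('m \<Rightarrow> real) \<Rightarrow> 'm \<Rightarrow> real" where
  "anchor_deriv A x f p = anchor A p (x p) f"

definition bracket ::
  "('m,'e,'a::real_vector,'v,'z) algebroid_scheme \<Rightarrow> ('m \<Rightarrow> 'a) \<Rightarrow> ('m \<Rightarrow> 'a) \<Rightarrow> 'm \<Rightarrow> 'a" where
  "bracket A x y p = (x \<cdot>\<^bsub>A\<^esub> y) p - (y \<cdot>\<^bsub>A\<^esub> x) p"

definition left_symmetric_algebroid ::
  "('m::{t2_space,second_countable_topology},'e::finite_dim_inner,'a::real_vector,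
    'v::finite_dim_inner,'z) algebroid_scheme \<Rightarrow> bool" where
  "left_symmetric_algebroid A \<longleftrightarrow>
     vector_bundle A \<and>
     bundle_map_to_tangent A (anchor A) \<and>
     (\<forall>x\<in>sections A. \<forall>y\<in>sections A. x \<cdot>\<^bsub>A\<^esub> y \<in> sections A) \<and>
     (\<forall>x\<in>sections A. \<forall>y\<in>sections A. \<forall>z\<in>sections A.
        (\<lambda>p. x p + y p) \<cdot>\<^bsub>A\<^esub> z = (\<lambda>p. (x \<cdot>\<^bsub>A\<^esub> z) p + (y \<cdot>\<^bsub>A\<^esub> z) p) \<and>
        z \<cdot>\<^bsub>A\<^esub> (\<lambda>p. x p + y p) = (\<lambda>p. (z \<cdot>\<^bsub>A\<^esub> x) p + (z \<cdot>\<^bsub>A\<^esub> y) p)) \<and>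
     (\<forall>x\<in>sections A. \<forall>y\<in>sections A. \<forall>c.
        (\<lambda>p. c *\<^sub>R x p) \<cdot>\<^bsub>A\<^esub> y = (\<lambda>p. c *\<^sub>R (x \<cdot>\<^bsub>A\<^esub> y) p) \<and>
        x \<cdot>\<^bsub>A\<^esub> (\<lambda>p. c *\<^sub>R y p) = (\<lambda>p. c *\<^sub>R (x \<cdot>\<^bsub>A\<^esub> y) p)) \<and>
     (\<forall>x\<in>sections A. \<forall>y\<in>sections A. \<forall>z\<in>sections A.
        (\<lambda>p. (x \<cdot>\<^bsub>A\<^esub> (y \<cdot>\<^bsub>A\<^esub> z)) p - ((x \<cdot>\<^bsub>A\<^esub> y) \<cdot>\<^bsub>A\<^esub> z) p) =
        (\<lambda>p. (y \<cdot>\<^bsub>A\<^esub> (x \<cdot>\<^bsub>A\<^esub> z)) p - ((y \<cdot>\<^bsub>A\<^esub> x) \<cdot>\<^bsub>A\<^esub> z) p)) \<and>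
     (\<forall>x\<in>sections A. \<forall>y\<in>sections A. \<forall>f\<in>smooth_functions A.
        x \<cdot>\<^bsub>A\<^esub> (\<lambda>p. f p *\<^sub>R y p) = (\<lambda>p. f p *\<^sub>R (x \<cdot>\<^bsub>A\<^esub> y) p + anchor_deriv A x f p *\<^sub>R y p) \<and>
        (\<lambda>p. f p *\<^sub>R x p) \<cdot>\<^bsub>A\<^esub> y = (\<lambda>p. f p *\<^sub>R (x \<cdot>\<^bsub>A\<^esub> y) p))"

section \<open>Nijenhuis operators and Koszul-Vinberg structures\<close>

definition Nijenhuis_operator ::
  "('m::{t2_space,second_countable_topology},'e::finite_dim_inner,'a::real_vector,
    'v::finite_dim_inner,'z) algebroid_scheme \<Rightarrow> ('m \<Rightarrow> 'a \<Rightarrow> 'a) \<Rightarrow> bool" where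
  "Nijenhuis_operator A N \<longleftrightarrow>
     bundle_endomorphism A N \<and>
     (\<forall>x\<in>sections A. \<forall>y\<in>sections A.
        act N x \<cdot>\<^bsub>A\<^esub> act N y =
        act N (\<lambda>p. (x \<cdot>\<^bsub>A\<^esub> act N y) p + (act N x \<cdot>\<^bsub>A\<^esub> y) p - act N (x \<cdot>\<^bsub>A\<^esub> y) p))"

text \<open>The deformed algebroid \<open>(A, \<cdot>\<^sub>N, a\<^sub>N)\<close>.\<close>

definition deformed ::
  "('m,'e,'a::real_vector,'v,'z) algebroid_scheme \<Rightarrow> ('m \<Rightarrow> 'a \<Rightarrow> 'a)
     \<Rightarrow> ('m,'e,'a,'v,'z) algebroid_scheme" where
  "deformed A N = A\<lparr>
     sprod := (\<lambda>x y p. (act N x \<cdot>\<^bsub>A\<^esub> y) p + (x \<cdot>\<^bsub>A\<^esub> act N y) p - act N (x \<cdot>\<^bsub>A\<^esub> y) p),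
     anchor := (\<lambda>p u. anchor A p (N p u))\<rparr>"

definition KV_bracket ::
  "('m,'e,'a::real_vector,'v,'z) algebroid_scheme
     \<Rightarrow> ('m \<Rightarrow> ('a \<Rightarrow> real) \<Rightarrow> ('a \<Rightarrow> real) \<Rightarrow> real)
     \<Rightarrow> ('m \<Rightarrow> 'a \<Rightarrow> real) \<Rightarrow> ('m \<Rightarrow> 'a \<Rightarrow> real) \<Rightarrow> ('m \<Rightarrow> 'a \<Rightarrow> real) \<Rightarrow> 'm \<Rightarrow> real" where
  "KV_bracket A H \<alpha>1 \<alpha>2 \<alpha>3 p =
     (let h1 = act (sharp A H) \<alpha>1; h2 = act (sharp A H) \<alpha>2; h3 = act (sharp A H) \<alpha>3 in
        anchor_deriv A h1 (pairing \<alpha>3 h2) p - anchor_deriv A h2 (pairing \<alpha>3 h1) p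
        + pairing \<alpha>1 (h2 \<cdot>\<^bsub>A\<^esub> h3) p - pairing \<alpha>2 (h1 \<cdot>\<^bsub>A\<^esub> h3) p
        - pairing \<alpha>3 (bracket A h1 h2) p)"

definition Koszul_Vinberg ::
  "('m::{t2_space,second_countable_topology},'e::finite_dim_inner,'a::real_vector,
    'v::finite_dim_inner,'z) algebroid_scheme
     \<Rightarrow> ('m \<Rightarrow> ('a \<Rightarrow> real) \<Rightarrow> ('a \<Rightarrow> real) \<Rightarrow> real) \<Rightarrow> bool" where
  "Koszul_Vinberg A H \<longleftrightarrow>
     H \<in> Sym2 A \<and>
     (\<forall>\<alpha>1\<in>dual_sections A. \<forall>\<alpha>2\<in>dual_sections A. \<forall>\<alpha>3\<in>dual_sections A. \<forall>p.
        KV_bracket A H \<alpha>1 \<alpha>2 \<alpha>3 p = 0)"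

section \<open>Products on sections of the dual bundle\<close>

text \<open>
  The section of the dual bundle whose pairing with every section \<open>y\<close> is \<open>F y\<close>; it is always
  applied to maps \<open>F\<close> that are linear over the smooth functions.
\<close>

definition dual_section_of ::
  "('m::{t2_space,second_countable_topology},'e::finite_dim_inner,'a::real_vector,
    'v::finite_dim_inner,'z) vbundle_scheme
     \<Rightarrow> (('m \<Rightarrow> 'a) \<Rightarrow> 'm \<Rightarrow> real) \<Rightarrow> 'm \<Rightarrow> 'a \<Rightarrow> real" where
  "dual_section_of A F = (THE \<gamma>. \<gamma> \<in> dual_sections A \<and> (\<forall>y\<in>sections A. pairing \<gamma> y = F y))"

definition Lie_deriv ::
  "('m::{t2_space,second_countable_topology},'e::finite_dim_inner,'a::real_vector,
    'v::finite_dim_inner,'z) algebroid_scheme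
     \<Rightarrow> ('m \<Rightarrow> 'a) \<Rightarrow> ('m \<Rightarrow> 'a \<Rightarrow> real) \<Rightarrow> 'm \<Rightarrow> 'a \<Rightarrow> real" where
  "Lie_deriv A x \<alpha> = dual_section_of A
     (\<lambda>y p. anchor_deriv A x (pairing \<alpha> y) p - pairing \<alpha> (bracket A x y) p)"

definition R_dual ::
  "('m::{t2_space,second_countable_topology},'e::finite_dim_inner,'a::real_vector,
    'v::finite_dim_inner,'z) algebroid_scheme
     \<Rightarrow> ('m \<Rightarrow> 'a) \<Rightarrow> ('m \<Rightarrow> 'a \<Rightarrow> real) \<Rightarrow> 'm \<Rightarrow> 'a \<Rightarrow> real" where
  "R_dual A x \<alpha> = dual_section_of A (\<lambda>y p. - pairing \<alpha> (y \<cdot>\<^bsub>A\<^esub> x) p)"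

definition d_fun ::
  "('m::{t2_space,second_countable_topology},'e::finite_dim_inner,'a::real_vector,
    'v::finite_dim_inner,'z) algebroid_scheme \<Rightarrow> ('m \<Rightarrow> real) \<Rightarrow> 'm \<Rightarrow> 'a \<Rightarrow> real" where
  "d_fun A f = dual_section_of A (\<lambda>x. anchor_deriv A x f)"

text \<open>
  With \<open>C = A\<close> this is \<open>\<alpha> \<cdot>\<^sup>H \<beta>\<close>, with \<open>C = deformed A N\<close> it is \<open>\<alpha> \<star>\<^sup>H \<beta>\<close>; note that
  \<open>sharp\<close>, \<open>sections\<close>, etc. depend on the underlying vector bundle only.
\<close>

definition dual_prod ::
  "('m::{t2_space,second_countable_topology},'e::finite_dim_inner,'a::real_vector,
    'v::finite_dim_inner,'z) algebroid_scheme
     \<Rightarrow> ('m \<Rightarrow> ('a \<Rightarrow> real) \<Rightarrow> ('a \<Rightarrow> real) \<Rightarrow> real)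
     \<Rightarrow> ('m \<Rightarrow> 'a \<Rightarrow> real) \<Rightarrow> ('m \<Rightarrow> 'a \<Rightarrow> real) \<Rightarrow> 'm \<Rightarrow> 'a \<Rightarrow> real" where
  "dual_prod C H \<alpha> \<beta> p u =
     Lie_deriv C (act (sharp C H) \<alpha>) \<beta> p u - R_dual C (act (sharp C H) \<beta>) \<alpha> p u
     - d_fun C (\<lambda>q. H q (\<alpha> q) (\<beta> q)) p u"

definition dual_prod_N ::
  "('m::{t2_space,second_countable_topology},'e::finite_dim_inner,'a::real_vector,
    'v::finite_dim_inner,'z) algebroid_scheme
     \<Rightarrow> ('m \<Rightarrow> ('a \<Rightarrow> real) \<Rightarrow> ('a \<Rightarrow> real) \<Rightarrow> real) \<Rightarrow> ('m \<Rightarrow> 'a \<Rightarrow> 'a)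
     \<Rightarrow> ('m \<Rightarrow> 'a \<Rightarrow> real) \<Rightarrow> ('m \<Rightarrow> 'a \<Rightarrow> real) \<Rightarrow> 'm \<Rightarrow> 'a \<Rightarrow> real" where
  "dual_prod_N A H N \<alpha> \<beta> p u =
     dual_prod A H (act (dual_map A N) \<alpha>) \<beta> p u + dual_prod A H \<alpha> (act (dual_map A N) \<beta>) p u
     - act (dual_map A N) (dual_prod A H \<alpha> \<beta>) p u"

section \<open>KVN structures and KV-Omega structures\<close>

definition KVN_structure ::
  "('m::{t2_space,second_countable_topology},'e::finite_dim_inner,'a::real_vector,
    'v::finite_dim_inner,'z) algebroid_scheme
     \<Rightarrow> ('m \<Rightarrow> ('a \<Rightarrow> real) \<Rightarrow> ('a \<Rightarrow> real) \<Rightarrow> real) \<Rightarrow> ('m \<Rightarrow> 'a \<Rightarrow> 'a) \<Rightarrow> bool" where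
  "KVN_structure A H N \<longleftrightarrow>
     Koszul_Vinberg A H \<and> Nijenhuis_operator A N \<and>
     (\<forall>p. \<forall>\<alpha>\<in>dual_fibre A p. N p (sharp A H p \<alpha>) = sharp A H p (dual_map A N p \<alpha>)) \<and>
     (\<forall>\<alpha>\<in>dual_sections A. \<forall>\<beta>\<in>dual_sections A.
        dual_prod (deformed A N) H \<alpha> \<beta> = dual_prod_N A H N \<alpha> \<beta>)"

definition coboundary ::
  "('m,'e,'a::real_vector,'v,'z) algebroid_scheme \<Rightarrow> ('m \<Rightarrow> 'a \<Rightarrow> 'a \<Rightarrow> real)
     \<Rightarrow> ('m \<Rightarrow> 'a) \<Rightarrow> ('m \<Rightarrow> 'a) \<Rightarrow> ('m \<Rightarrow> 'a) \<Rightarrow> 'm \<Rightarrow> real" where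
  "coboundary A B x y z p =
     anchor_deriv A x (\<lambda>q. B q (y q) (z q)) p - anchor_deriv A y (\<lambda>q. B q (x q) (z q)) p
     - B p (y p) ((x \<cdot>\<^bsub>A\<^esub> z) p) + B p (x p) ((y \<cdot>\<^bsub>A\<^esub> z) p) - B p (bracket A x y p) (z p)"

definition two_cocycle ::
  "('m::{t2_space,second_countable_topology},'e::finite_dim_inner,'a::real_vector,
    'v::finite_dim_inner,'z) algebroid_scheme \<Rightarrow> ('m \<Rightarrow> 'a \<Rightarrow> 'a \<Rightarrow> real) \<Rightarrow> bool" where
  "two_cocycle A B \<longleftrightarrow>
     B \<in> Sym2_dual A \<and>
     (\<forall>x\<in>sections A. \<forall>y\<in>sections A. \<forall>z\<in>sections A. \<forall>p. coboundary A B x y z p = 0)"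

definition sharp_flat ::
  "('m,'e,'a::real_vector,'v,'z) vbundle_scheme
     \<Rightarrow> ('m \<Rightarrow> ('a \<Rightarrow> real) \<Rightarrow> ('a \<Rightarrow> real) \<Rightarrow> real) \<Rightarrow> ('m \<Rightarrow> 'a \<Rightarrow> 'a \<Rightarrow> real)
     \<Rightarrow> 'm \<Rightarrow> 'a \<Rightarrow> 'a" where
  "sharp_flat A H B p = sharp A H p \<circ> flat A B p"

definition KV_Omega_structure ::
  "('m::{t2_space,second_countable_topology},'e::finite_dim_inner,'a::real_vector,
    'v::finite_dim_inner,'z) algebroid_scheme
     \<Rightarrow> ('m \<Rightarrow> ('a \<Rightarrow> real) \<Rightarrow> ('a \<Rightarrow> real) \<Rightarrow> real) \<Rightarrow> ('m \<Rightarrow> 'a \<Rightarrow> 'a \<Rightarrow> real) \<Rightarrow> bool" where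
  "KV_Omega_structure A H B \<longleftrightarrow>
     Koszul_Vinberg A H \<and> two_cocycle A B \<and>
     two_cocycle A (\<lambda>p u v. B p (sharp_flat A H B p u) v)"

end

(*
  For sections x, y, z put h = H^sharp, b = B^natural, N = h b, and write alpha . beta for the product on
  dual sections defined by H.  Three identities carry the proof:
    [[H,H]](alpha, gamma, beta) = <alpha . beta, h gamma> - <gamma, h alpha . h beta>,
    <b x . b y, z> = B(x ._N y, z) + dB(N x, z, y) + dB(x, z, N y) - dB_N(x, z, y),
    <alpha * beta - alpha ._{N^*} beta, y> = 2 ([[H,H]](alpha, b y, beta) - dB(h alpha, y, h beta)).
  If H is a Koszul-Vinberg structure, the first one makes h multiplicative, so that N is a Nijenhuis operator
  as soon as b x . b y = b (x ._N y); both directions are then read off the second and the third identity.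
  The analytic part is that these pairings determine sections: bump functions extend local frames to
  global sections, so C^infinity-linear operators on sections are pointwise, and when h is invertible
  its inverse is smooth by Gaussian elimination.
*)

theory Submission
  imports Defs "HOL-Computational_Algebra.Polynomial"
begin

section \<open>Calculus of \<open>C\<^sup>k\<close> maps\<close>

text \<open>The products on dual sections are definite descriptions, so a formula for them carries
  no information until a smooth dual section with the prescribed pairings is known to exist. This
  shapes the analytic half: bundles, endomorphisms and tensors are smooth by a condition on local
  frames, whereas the product of the algebroid acts on global sections only, and one has to pass
  between the two in both directions. The same existence question arises for the deformed product,
  at a stage where \<open>N\<close> is only a bundle endomorphism; hence axioms that survive every
  such deformation. The converse has a fixed order. Since H^sharp is onto, h alpha and h beta in the
  third identity are arbitrary sections, and dividing by 2 gives dB = 0. Since H^sharp is injective,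
  it may be cancelled in h(b x . b y) = N x . N y = h b(x ._N y); then dB_N is the only term of the
  second identity that is left, and it vanishes.\<close>

lemma Ck_on_subset: "Ck_on k S f \<Longrightarrow> T \<subseteq> S \<Longrightarrow> Ck_on k T f"
  by (induction k arbitrary: f) (auto intro: continuous_on_subset)

lemma Ck_on_cong:
  assumes "Ck_on k S f" "open S" "\<And>x. x \<in> S \<Longrightarrow> f x = g x"
  shows "Ck_on k S g"
  using assms
proof (induction k arbitrary: f g)
  case 0
  then show ?case by (simp cong: continuous_on_cong)
next
  case (Suc k)
  have "g differentiable (at x)" if "x \<in> S" for x
    using that Suc.prems unfolding differentiable_def
    by (metis Ck_on.simps(2) differentiable_def has_derivative_transform_within_open)
  moreover have "Ck_on k S (\<lambda>x. frechet_derivative g (at x) v)" for v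
  proof (rule Suc.IH)
    show "Ck_on k S (\<lambda>x. frechet_derivative f (at x) v)"
      using Suc.prems by simp
    show "frechet_derivative f (at x) v = frechet_derivative g (at x) v" if "x \<in> S" for x
      using that Suc.prems frechet_derivative_transform_within_open[of f x S g] by auto
  qed (use Suc.prems in auto)
  ultimately show ?case by simp
qed

lemma Ck_on_local:
  assumes "\<And>x. x \<in> S \<Longrightarrow> \<exists>T. open T \<and> x \<in> T \<and> Ck_on k T f"
  shows "Ck_on k S f"
  using assms
proof (induction k arbitrary: f)
  case 0
  then show ?case
    by (force simp: continuous_on_eq_continuous_at intro: continuous_at_imp_continuous_on)
next
  case (Suc k)
  have "f differentiable (at x)" if "x \<in> S" for x
    using Suc.prems[OF that] by auto
  moreover have "Ck_on k S (\<lambda>x. frechet_derivative f (at x) v)" for v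
    by (rule Suc.IH) (use Suc.prems in fastforce)
  ultimately show ?case by simp
qed

text \<open>Makes the closure properties below inductions on \<open>k\<close>: the derivative is
  exhibited by its usual formula, and that formula is again of class C^k.\<close>

lemma Ck_on_SucI:
  assumes "\<And>x. x \<in> S \<Longrightarrow> (f has_derivative f' x) (at x)" "open S"
    and "\<And>v. Ck_on k S (\<lambda>x. f' x v)"
  shows "Ck_on (Suc k) S f"
proof -
  have "Ck_on k S (\<lambda>x. frechet_derivative f (at x) v)" for v
    using assms(3) \<open>open S\<close> by (rule Ck_on_cong) (simp add: frechet_derivative_at[OF assms(1)])
  then show ?thesis
    using assms(1) by (auto simp: differentiable_def)
qed

lemma Ck_on_SucD:
  assumes "Ck_on (Suc k) S f" "x \<in> S"
  shows "(f has_derivative frechet_derivative f (at x)) (at x)"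
  using assms frechet_derivative_works by auto

lemma Ck_on_Suc_imp: "Ck_on (Suc k) S f \<Longrightarrow> Ck_on k S f"
  by (induction k arbitrary: f)
    (auto intro!: continuous_at_imp_continuous_on differentiable_imp_continuous_within)

lemma Ck_on_const: "open S \<Longrightarrow> Ck_on k S (\<lambda>x. c)"
proof (induction k arbitrary: c)
  case (Suc k)
  then show ?case
    by (intro Ck_on_SucI[where f' = "\<lambda>x v. 0"]) auto
qed simp

lemma Ck_on_linear:
  assumes "bounded_linear L" "open S" "Ck_on k S f"
  shows "Ck_on k S (\<lambda>x. L (f x))"
  using assms(3)
proof (induction k arbitrary: f)
  case 0
  then show ?case
    using assms(1) by (simp add: bounded_linear.continuous_on)
next
  case (Suc k)
  show ?case
  proof (rule Ck_on_SucI)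
    show "((\<lambda>x. L (f x)) has_derivative (\<lambda>v. L (frechet_derivative f (at x) v))) (at x)" if "x \<in> S" for x
      by (rule bounded_linear.has_derivative[OF assms(1) Ck_on_SucD[OF Suc.prems that]])
    show "Ck_on k S (\<lambda>x. L (frechet_derivative f (at x) v))" for v
      using Suc by simp
  qed fact
qed

lemma Ck_on_add:
  assumes "open S" "Ck_on k S f" "Ck_on k S g"
  shows "Ck_on k S (\<lambda>x. f x + g x)"
  using assms(2,3)
proof (induction k arbitrary: f g)
  case 0
  then show ?case by (simp add: continuous_on_add)
next
  case (Suc k)
  show ?case
  proof (rule Ck_on_SucI)
    show "((\<lambda>x. f x + g x) has_derivative
        (\<lambda>v. frechet_derivative f (at x) v + frechet_derivative g (at x) v)) (at x)" if "x \<in> S" for x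
      by (intro has_derivative_add Ck_on_SucD[OF Suc.prems(1) that] Ck_on_SucD[OF Suc.prems(2) that])
    show "Ck_on k S (\<lambda>x. frechet_derivative f (at x) v + frechet_derivative g (at x) v)" for v
      using Suc by simp
  qed fact
qed

text \<open>The product rule contains the undifferentiated factors as well, which is why the
  induction step also needs \<open>Ck_on_Suc_imp\<close>.\<close>

lemma Ck_on_bilinear:
  assumes "bounded_bilinear prd" "open S" "Ck_on k S f" "Ck_on k S g"
  shows "Ck_on k S (\<lambda>x. prd (f x) (g x))"
  using assms(3,4)
proof (induction k arbitrary: f g)
  case 0
  then show ?case using assms(1) by (simp add: bounded_bilinear.continuous_on)
next
  case (Suc k)
  show ?case
  proof (rule Ck_on_SucI)
    show "((\<lambda>x. prd (f x) (g x)) has_derivative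
        (\<lambda>v. prd (f x) (frechet_derivative g (at x) v) + prd (frechet_derivative f (at x) v) (g x))) (at x)"
      if "x \<in> S" for x
      by (intro bounded_bilinear.FDERIV[OF assms(1)] Ck_on_SucD[OF Suc.prems(1) that]
          Ck_on_SucD[OF Suc.prems(2) that])
    show "Ck_on k S (\<lambda>x. prd (f x) (frechet_derivative g (at x) v) + prd (frechet_derivative f (at x) v) (g x))" for v
      using Suc.prems Suc.prems[THEN Ck_on_Suc_imp] by (intro Ck_on_add Suc.IH \<open>open S\<close>) auto
  qed fact
qed

lemma Ck_on_inverse:
  fixes f :: "'e::real_normed_vector \<Rightarrow> real"
  assumes "open S" "Ck_on k S f" "\<And>x. x \<in> S \<Longrightarrow> f x \<noteq> 0"
  shows "Ck_on k S (\<lambda>x. inverse (f x))"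
  using assms(2)
proof (induction k)
  case 0
  then show ?case using assms(3) by (simp add: continuous_on_inverse)
next
  case (Suc k)
  show ?case
  proof (rule Ck_on_SucI)
    show "((\<lambda>x. inverse (f x)) has_derivative
        (\<lambda>v. - (inverse (f x) * frechet_derivative f (at x) v * inverse (f x)))) (at x)"
      if "x \<in> S" for x
      by (rule has_derivative_inverse'[THEN has_derivative_compose[OF Ck_on_SucD[OF Suc.prems that]]])
        (use assms(3) that in auto)
    have "Ck_on k S (\<lambda>x. inverse (f x) * frechet_derivative f (at x) v * inverse (f x))" for v
      using Suc Ck_on_Suc_imp[OF Suc.prems]
      by (intro Ck_on_bilinear[OF bounded_bilinear_mult] assms(1)) auto
    then show "Ck_on k S (\<lambda>x. - (inverse (f x) * frechet_derivative f (at x) v * inverse (f x)))" for v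
      by (rule Ck_on_linear[OF bounded_linear_minus[OF bounded_linear_ident] assms(1)])
  qed fact
qed

text \<open>The outer function comes with the whole sequence of its derivatives. Differentiating
  \<open>G n\<close> after \<open>f\<close> produces \<open>G (Suc n)\<close> after \<open>f\<close>
  times the derivative of \<open>f\<close>, so the induction closes as soon as \<open>n\<close> is
  arbitrary.\<close>

lemma Ck_on_compose_real:
  fixes G :: "nat \<Rightarrow> real \<Rightarrow> real"
  assumes "open S" "Ck_on k S f" "\<And>n t. (G n has_real_derivative G (Suc n) t) (at t)"
  shows "Ck_on k S (\<lambda>x. G n (f x))"
  using assms(2)
proof (induction k arbitrary: n)
  case 0
  have "continuous_on UNIV (G n)"
    using assms(3) by (intro continuous_at_imp_continuous_on ballI) (metis DERIV_isCont)
  with 0 show ?case by (simp add: continuous_on_compose2)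
next
  case (Suc k)
  show ?case
  proof (rule Ck_on_SucI)
    show "((\<lambda>x. G n (f x)) has_derivative (\<lambda>v. G (Suc n) (f x) * frechet_derivative f (at x) v)) (at x)"
      if "x \<in> S" for x
      using has_derivative_compose[OF Ck_on_SucD[OF Suc.prems that] assms(3)[unfolded has_field_derivative_def]]
      by simp
    show "Ck_on k S (\<lambda>x. G (Suc n) (f x) * frechet_derivative f (at x) v)" for v
      using Suc Ck_on_Suc_imp[OF Suc.prems]
      by (intro Ck_on_bilinear[OF bounded_bilinear_mult] assms(1)) auto
  qed fact
qed

section \<open>A smooth function vanishing on a half-line\<close>

text \<open>For \<open>P = 1\<close> this is the classical function exp(-1/t) extended by 0. The
  polynomial factor makes the family closed under differentiation.\<close>

definition flat_exp :: "real poly \<Rightarrow> real \<Rightarrow> real" where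
  "flat_exp P t = (if t > 0 then poly P (1 / t) * exp (- (1 / t)) else 0)"

lemma poly_over_exp_tendsto_0: "((\<lambda>s::real. poly P s / exp s) \<longlongrightarrow> 0) at_top"
proof -
  have "((\<lambda>s::real. \<Sum>i\<le>degree P. coeff P i * (s ^ i / exp s)) \<longlongrightarrow> (\<Sum>i\<le>degree P. coeff P i * 0)) at_top"
    by (intro tendsto_intros tendsto_power_div_exp_0)
  then show ?thesis
    by (simp add: poly_altdef sum_divide_distrib)
qed

lemma flat_exp_tendsto_0: "(flat_exp P \<longlongrightarrow> 0) (at 0)"
proof (rule filterlim_split_at)
  show "(flat_exp P \<longlongrightarrow> 0) (at_left 0)"
    by (rule tendsto_eventually)
      (auto simp: eventually_at_filter flat_exp_def)
  have "((\<lambda>t. poly P (inverse t) / exp (inverse t)) \<longlongrightarrow> 0) (at_right 0)"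
    by (rule filterlim_compose[OF poly_over_exp_tendsto_0 filterlim_inverse_at_top_right])
  then show "(flat_exp P \<longlongrightarrow> 0) (at_right 0)"
    by (rule Lim_transform_eventually)
      (auto simp: eventually_at_filter flat_exp_def exp_minus field_simps)
qed

text \<open>With s = 1/t, the s-derivative of P(s) exp(-s) is (P' - P)(s) exp(-s), and ds/dt = -s^2;
  the polynomial \<open>[:0, 0, 1:]\<close> is s^2.\<close>

lemma DERIV_flat_exp:
  "(flat_exp P has_real_derivative flat_exp ((P - pderiv P) * [:0, 0, 1:]) t) (at t)"
proof -
  consider "t > 0" | "t < 0" | "t = 0" by linarith
  then show ?thesis
  proof cases
    case 1
    have "((\<lambda>t. poly P (1 / t) * exp (- (1 / t))) has_real_derivative
        flat_exp ((P - pderiv P) * [:0, 0, 1:]) t) (at t)"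
      using 1 by (auto intro!: derivative_eq_intros DERIV_chain2[OF poly_DERIV]
          simp: flat_exp_def field_simps power2_eq_square)
    then show ?thesis
      by (rule has_field_derivative_transform_within_open[of _ _ _ "{0<..}"])
        (use 1 in \<open>auto simp: flat_exp_def\<close>)
  next
    case 2
    have "((\<lambda>t. 0) has_real_derivative flat_exp ((P - pderiv P) * [:0, 0, 1:]) t) (at t)"
      using 2 by (simp add: flat_exp_def)
    then show ?thesis
      by (rule has_field_derivative_transform_within_open[of _ _ _ "{..<0}"])
        (use 2 in \<open>auto simp: flat_exp_def\<close>)
  next
    case 3
    \<comment> \<open>Dividing by h multiplies the polynomial by s = 1/h, so the difference quotient
      at 0 is itself a member of the family and tends to 0.\<close>
    have "(\<lambda>h. (flat_exp P (0 + h) - flat_exp P 0) / h) = flat_exp (P * [:0, 1:])"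
      by (auto simp: flat_exp_def fun_eq_iff)
    then have "(flat_exp P has_real_derivative 0) (at 0)"
      unfolding DERIV_def using flat_exp_tendsto_0 by simp
    then show ?thesis
      using 3 by (simp add: flat_exp_def)
  qed
qed

lemma Ck_on_flat_exp:
  assumes "open S" "Ck_on k S f"
  shows "Ck_on k S (\<lambda>x. flat_exp P (f x))"
proof -
  define G where "G n = flat_exp (((\<lambda>P. (P - pderiv P) * [:0, 0, 1:]) ^^ n) P)" for n
  have "Ck_on k S (\<lambda>x. G 0 (f x))"
    using assms by (rule Ck_on_compose_real) (simp only: G_def funpow.simps o_apply DERIV_flat_exp)
  then show ?thesis
    by (simp add: G_def)
qed

section \<open>Finite-dimensional inner product spaces\<close>

text \<open>Orthogonalising a finite spanning set may leave the vector 0, which is removed before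
  normalising. In dimension 0 nothing remains and \<open>E\<close> is empty.\<close>

lemma orthonormal_basis_exists:
  "\<exists>E::'v::finite_dim_inner set. finite E \<and>
     (\<forall>b\<in>E. \<forall>c\<in>E. inner b c = (if b = c then 1 else 0)) \<and> (\<forall>u. u = (\<Sum>b\<in>E. inner b u *\<^sub>R b))"
proof -
  obtain B :: "'v set" where B: "finite B" "span B = UNIV"
    using finite_dim_inner_span by blast
  obtain C where C: "finite C" "span C = span B" "pairwise orthogonal C"
    using basis_orthogonal[OF B(1)] by blast
  define E where "E = (\<lambda>b. b /\<^sub>R norm b) ` (C - {0})"
  have fin: "finite E"
    using C by (simp add: E_def)
  have "inner (b /\<^sub>R norm b) (c /\<^sub>R norm c) = (if b /\<^sub>R norm b = c /\<^sub>R norm c then 1 else 0)"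
    if "b \<in> C - {0}" "c \<in> C - {0}" for b c
  proof (cases "b = c")
    case True
    with that show ?thesis
      by (simp add: power2_norm_eq_inner[symmetric] power2_eq_square)
  next
    case False
    then have "inner b c = 0"
      using C(3) that by (auto simp: pairwise_def orthogonal_def)
    moreover from this have "b /\<^sub>R norm b \<noteq> c /\<^sub>R norm c"
    proof -
      have "inner (b /\<^sub>R norm b) (c /\<^sub>R norm c) = 0"
        using \<open>inner b c = 0\<close> by simp
      moreover have "inner (c /\<^sub>R norm c) (c /\<^sub>R norm c) \<noteq> 0"
        using that by simp
      ultimately show ?thesis by metis
    qed
    ultimately show ?thesis by simp
  qed
  then have on: "inner b c = (if b = c then 1 else 0)" if "b \<in> E" "c \<in> E" for b c
    using that unfolding E_def by blast
  have "b \<in> span E" if "b \<in> C" for b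
  proof (cases "b = 0")
    case False
    then have "norm b *\<^sub>R (b /\<^sub>R norm b) \<in> span E"
      using that by (intro span_scale span_base) (auto simp: E_def)
    with False show ?thesis by simp
  qed (simp add: span_zero)
  then have "span E = UNIV"
    using span_minimal[of C "span E"] C(2) B(2) by auto
  then have "u = (\<Sum>b\<in>E. inner b u *\<^sub>R b)" for u
  proof -
    obtain a where a: "u = (\<Sum>b\<in>E. a b *\<^sub>R b)"
    proof -
      have "u \<in> range (\<lambda>a. \<Sum>b\<in>E. a b *\<^sub>R b)"
        using \<open>span E = UNIV\<close> span_finite[OF fin] by auto
      then show ?thesis
        using that by blast
    qed
    have "inner c u = a c" if "c \<in> E" for c
    proof -
      have "inner c u = (\<Sum>b\<in>E. a b * inner c b)"
        by (simp add: a inner_sum_right)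
      also have "\<dots> = (\<Sum>b\<in>E. if c = b then a b else 0)"
        by (intro sum.cong) (simp_all add: on that)
      finally show ?thesis
        using fin that by simp
    qed
    with a show ?thesis by simp
  qed
  with fin on show ?thesis by blast
qed

text \<open>A ball around 0 is a closed subset of the coordinate box over an orthonormal basis, and
  the box is a finite Minkowski sum of compact segments, whence the induction on \<open>E\<close>.
  Translation moves the centre to \<open>x\<close>.\<close>

lemma compact_cball_finite_dim: "compact (cball (x::'v::finite_dim_inner) r)"
proof -
  obtain E :: "'v set" where E: "finite E"
    "\<And>b c. b \<in> E \<Longrightarrow> c \<in> E \<Longrightarrow> inner b c = (if b = c then 1 else 0)"
    "\<And>u. u = (\<Sum>b\<in>E. inner b u *\<^sub>R b)"
    using orthonormal_basis_exists by blast
  have "compact {\<Sum>b\<in>E. c b *\<^sub>R b |c. \<forall>b\<in>E. \<bar>c b\<bar> \<le> r}"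
    using E(1)
  proof (induction E)
    case (insert e F)
    have eq: "{\<Sum>b\<in>insert e F. c b *\<^sub>R b |c. \<forall>b\<in>insert e F. \<bar>c b\<bar> \<le> r} =
        {y + z |y z. y \<in> (\<lambda>t. t *\<^sub>R e) ` {-r..r} \<and> z \<in> {\<Sum>b\<in>F. c b *\<^sub>R b |c. \<forall>b\<in>F. \<bar>c b\<bar> \<le> r}}"
      (is "?L = ?R")
    proof
      show "?L \<subseteq> ?R"
        using insert.hyps by (auto simp: abs_le_iff) (smt (verit) atLeastAtMost_iff image_eqI)
      show "?R \<subseteq> ?L"
      proof safe
        fix t :: real and c :: "'v \<Rightarrow> real"
        assume "t \<in> {-r..r}" "\<forall>b\<in>F. \<bar>c b\<bar> \<le> r"
        moreover have "t *\<^sub>R e + (\<Sum>b\<in>F. c b *\<^sub>R b) = (\<Sum>b\<in>insert e F. (c(e := t)) b *\<^sub>R b)"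
          using insert.hyps by (auto intro: sum.cong)
        ultimately show "\<exists>c'. t *\<^sub>R e + (\<Sum>b\<in>F. c b *\<^sub>R b) = (\<Sum>b\<in>insert e F. c' b *\<^sub>R b) \<and>
            (\<forall>b\<in>insert e F. \<bar>c' b\<bar> \<le> r)"
          by (intro exI[of _ "c(e := t)"]) auto
      qed
    qed
    show ?case
      unfolding eq
      by (intro compact_sums insert.IH compact_continuous_image continuous_intros compact_Icc)
  qed simp
  moreover have "cball 0 r \<subseteq> {\<Sum>b\<in>E. c b *\<^sub>R b |c. \<forall>b\<in>E. \<bar>c b\<bar> \<le> r}"
  proof
    fix u :: 'v assume "u \<in> cball 0 r"
    have "\<bar>inner b u\<bar> \<le> r" if "b \<in> E" for b
      using Cauchy_Schwarz_ineq2[of b u] E(2)[OF that that] \<open>u \<in> cball 0 r\<close>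
      by (simp add: norm_eq_sqrt_inner[of b])
    then show "u \<in> {\<Sum>b\<in>E. c b *\<^sub>R b |c. \<forall>b\<in>E. \<bar>c b\<bar> \<le> r}"
      using E(3)[of u] by (intro CollectI exI[of _ "\<lambda>b. inner b u"]) auto
  qed
  ultimately have "compact ({\<Sum>b\<in>E. c b *\<^sub>R b |c. \<forall>b\<in>E. \<bar>c b\<bar> \<le> r} \<inter> cball 0 r)"
    "{\<Sum>b\<in>E. c b *\<^sub>R b |c. \<forall>b\<in>E. \<bar>c b\<bar> \<le> r} \<inter> cball 0 r = cball 0 r"
    using compact_Int_closed closed_cball by blast+
  then have "compact (cball (0::'v) r)"
    by (simp only:)
  then have "compact ((+) x ` cball 0 r)"
    by (rule compact_translation)
  then show ?thesis by simp
qed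

section \<open>Smooth functions and frames\<close>

text \<open>One fixed orthonormal basis of the typical fibre; it is the index set of all local
  frames and coframes below.\<close>

definition onb :: "'v::finite_dim_inner set" where
  "onb = (SOME E. finite E \<and> (\<forall>b\<in>E. \<forall>c\<in>E. inner b c = (if b = c then 1 else 0)) \<and>
     (\<forall>u. u = (\<Sum>b\<in>E. inner b u *\<^sub>R b)))"

lemma
  shows finite_onb: "finite (onb :: 'v::finite_dim_inner set)"
    and inner_onb: "b \<in> onb \<Longrightarrow> c \<in> onb \<Longrightarrow> inner b (c :: 'v) = (if b = c then 1 else 0)"
    and onb_expand: "(\<Sum>b\<in>onb. inner b u *\<^sub>R b) = (u :: 'v)"
proof -
  have "finite (onb :: 'v set) \<and> (\<forall>b\<in>onb. \<forall>c\<in>onb. inner b (c::'v) = (if b = c then 1 else 0)) \<and>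
     (\<forall>u::'v. u = (\<Sum>b\<in>onb. inner b u *\<^sub>R b))"
    unfolding onb_def by (rule someI_ex[OF orthonormal_basis_exists])
  then show "finite (onb :: 'v set)"
    "b \<in> onb \<Longrightarrow> c \<in> onb \<Longrightarrow> inner b (c :: 'v) = (if b = c then 1 else 0)"
    "(\<Sum>b\<in>onb. inner b u *\<^sub>R b) = (u :: 'v)"
    by auto
qed

text \<open>Bundle maps and forms are constrained on the fibres only and arbitrary elsewhere. So
  linearity is assumed on \<open>V\<close> alone, and the induction has to keep the partial sums
  inside \<open>V\<close>.\<close>

lemma linear_on_subspace_sum:
  fixes L :: "'a::real_vector \<Rightarrow> 'b::real_vector"
  assumes V: "subspace V"
    and add: "\<And>u v. u \<in> V \<Longrightarrow> v \<in> V \<Longrightarrow> L (u + v) = L u + L v"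
    and scale: "\<And>c u. u \<in> V \<Longrightarrow> L (c *\<^sub>R u) = c *\<^sub>R L u"
    and e: "\<And>b. b \<in> F \<Longrightarrow> e b \<in> V"
  shows "L (\<Sum>b\<in>F. c b *\<^sub>R e b) = (\<Sum>b\<in>F. c b *\<^sub>R L (e b))"
  using e
proof (induction F rule: infinite_finite_induct)
  case (insert b F)
  then have "(\<Sum>b\<in>F. c b *\<^sub>R e b) \<in> V"
    by (intro subspace_sum subspace_scale V) auto
  with insert V show ?case
    by (simp add: add scale subspace_scale)
qed (use scale[of 0 0] V in \<open>simp_all add: subspace_0\<close>)

text \<open>Smoothness as a property of the germ at a point: closure properties then need no
  bookkeeping of domains, and local pieces are patched by arguing point by point.\<close>

definition smooth_at ::
  "('m::{t2_space,second_countable_topology},'e::finite_dim_inner,'a,'v,'z) vbundle_scheme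
     \<Rightarrow> ('m \<Rightarrow> 'b::real_normed_vector) \<Rightarrow> 'm \<Rightarrow> bool" where
  "smooth_at A f p \<longleftrightarrow> (\<exists>W. open W \<and> p \<in> W \<and> smooth_map_on A W f)"

locale smooth_bundle =
  fixes A :: "('m::{t2_space,second_countable_topology},'e::finite_dim_inner,'a::real_vector,
    'v::finite_dim_inner,'z) vbundle_scheme"
  assumes vector_bundle: "vector_bundle A"
begin

lemma
  assumes "(U, \<kappa>) \<in> atlas A"
  shows chart_open: "open U" and chart_image_open': "open (\<kappa> ` U)"
    and chart_homeo: "homeomorphism U (\<kappa> ` U) \<kappa> (inv_into U \<kappa>)"
    and chart_smooth: "smooth_map_on A U \<kappa>"
proof -
  have sa: "smooth_atlas (atlas A)"
    using vector_bundle by (simp add: vector_bundle_def)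
  then show "open U" "open (\<kappa> ` U)" "homeomorphism U (\<kappa> ` U) \<kappa> (inv_into U \<kappa>)"
    using assms unfolding smooth_atlas_def by blast+
  show "smooth_map_on A U \<kappa>"
    using sa assms unfolding smooth_atlas_def smooth_map_on_def by blast
qed

lemma chart_ex: "\<exists>U \<kappa>. (U, \<kappa>) \<in> atlas A \<and> p \<in> U"
proof -
  have "\<Union>(case_prod (\<lambda>U \<kappa>. U) ` atlas A) = UNIV"
    using vector_bundle by (simp add: vector_bundle_def smooth_atlas_def)
  then have "p \<in> \<Union>(case_prod (\<lambda>U \<kappa>. U) ` atlas A)" by simp
  then show ?thesis by auto
qed

lemma chart_image_open:
  assumes "(U, \<kappa>) \<in> atlas A" "open W"
  shows "open (\<kappa> ` (U \<inter> W))"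
proof -
  have "openin (top_of_set U) (U \<inter> W)"
    using assms by blast
  then have "openin (top_of_set (\<kappa> ` U)) (\<kappa> ` (U \<inter> W))"
    by (rule homeomorphism_imp_open_map[OF chart_homeo[OF assms(1)]])
  then show ?thesis
    using chart_image_open'[OF assms(1)] openin_open_trans by blast
qed

lemma smooth_map_on_subset:
  "smooth_map_on A W f \<Longrightarrow> W' \<subseteq> W \<Longrightarrow> smooth_map_on A W' f"
  unfolding smooth_map_on_def smooth_on_def
  by (fast intro: Ck_on_subset)

lemma smooth_map_on_cong:
  assumes "smooth_map_on A W f" "open W" "\<And>q. q \<in> W \<Longrightarrow> f q = g q"
  shows "smooth_map_on A W g"
  unfolding smooth_map_on_def smooth_on_def
proof safe
  fix U \<kappa> k assume *: "(U, \<kappa>) \<in> atlas A"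
  have "Ck_on k (\<kappa> ` (U \<inter> W)) (f \<circ> inv_into U \<kappa>)"
    using assms(1) * unfolding smooth_map_on_def smooth_on_def by blast
  then show "Ck_on k (\<kappa> ` (U \<inter> W)) (g \<circ> inv_into U \<kappa>)"
  proof (rule Ck_on_cong)
    show "open (\<kappa> ` (U \<inter> W))"
      using * assms(2) by (rule chart_image_open)
    show "(f \<circ> inv_into U \<kappa>) x = (g \<circ> inv_into U \<kappa>) x" if "x \<in> \<kappa> ` (U \<inter> W)" for x
      using that chart_homeo[OF *] assms(3) by (auto simp: homeomorphism_apply1)
  qed
qed

lemma smooth_map_on_imp_at: "smooth_map_on A W f \<Longrightarrow> open W \<Longrightarrow> p \<in> W \<Longrightarrow> smooth_at A f p"
  by (auto simp: smooth_at_def)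

lemma smooth_map_onI:
  assumes "\<And>p. p \<in> W \<Longrightarrow> smooth_at A f p"
  shows "smooth_map_on A W f"
  unfolding smooth_map_on_def smooth_on_def
proof safe
  fix U \<kappa> k assume *: "(U, \<kappa>) \<in> atlas A"
  show "Ck_on k (\<kappa> ` (U \<inter> W)) (f \<circ> inv_into U \<kappa>)"
  proof (rule Ck_on_local)
    fix x assume "x \<in> \<kappa> ` (U \<inter> W)"
    then obtain p where p: "p \<in> U" "p \<in> W" "x = \<kappa> p" by blast
    then obtain W' where "open W'" "p \<in> W'" "smooth_map_on A W' f"
      using assms unfolding smooth_at_def by blast
    with * p chart_image_open[OF * \<open>open W'\<close>]
    show "\<exists>T. open T \<and> x \<in> T \<and> Ck_on k T (f \<circ> inv_into U \<kappa>)"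
      unfolding smooth_map_on_def smooth_on_def by (intro exI[of _ "\<kappa> ` (U \<inter> W')"]) blast
  qed
qed

lemma smooth_functions_iff: "f \<in> smooth_functions A \<longleftrightarrow> (\<forall>p. smooth_at A f p)"
  by (auto simp: smooth_functions_def intro: smooth_map_onI smooth_map_on_imp_at[of UNIV])

lemma smooth_at_cong:
  assumes "smooth_at A f p" "open W" "p \<in> W" "\<And>q. q \<in> W \<Longrightarrow> f q = g q"
  shows "smooth_at A g p"
proof -
  obtain W' where W': "open W'" "p \<in> W'" "smooth_map_on A W' f"
    using assms(1) by (auto simp: smooth_at_def)
  have "smooth_map_on A (W' \<inter> W) g"
    by (rule smooth_map_on_cong[OF smooth_map_on_subset[OF W'(3)]])
      (use W' assms in auto)
  with W' assms show ?thesis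
    by (auto simp: smooth_at_def)
qed

lemma smooth_at_const: "smooth_at A (\<lambda>q. c) p"
proof -
  have "smooth_map_on A UNIV (\<lambda>q. c)"
    using chart_image_open' by (auto simp: smooth_map_on_def smooth_on_def o_def intro!: Ck_on_const)
  then show ?thesis by (rule smooth_map_on_imp_at) auto
qed

lemma smooth_at_lift:
  assumes "\<And>k S f. open S \<Longrightarrow> Ck_on k S f \<Longrightarrow> Ck_on k S (\<lambda>x::'e. h (f x))" "smooth_at A f p"
  shows "smooth_at A (\<lambda>q. h (f q)) p"
proof -
  obtain W where W: "open W" "p \<in> W" "smooth_map_on A W f"
    using assms(2) by (auto simp: smooth_at_def)
  then have "smooth_map_on A W (\<lambda>q. h (f q))"
    using chart_image_open assms(1) unfolding smooth_map_on_def smooth_on_def o_def by blast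
  with W show ?thesis by (auto simp: smooth_at_def)
qed

lemma smooth_at_lift2:
  assumes "\<And>k S f g. open S \<Longrightarrow> Ck_on k S f \<Longrightarrow> Ck_on k S g \<Longrightarrow> Ck_on k S (\<lambda>x::'e. h (f x) (g x))"
    and "smooth_at A f p" "smooth_at A g p"
  shows "smooth_at A (\<lambda>q. h (f q) (g q)) p"
proof -
  obtain W where W: "open W" "p \<in> W" "smooth_map_on A W f"
    using assms(2) by (auto simp: smooth_at_def)
  obtain W' where W': "open W'" "p \<in> W'" "smooth_map_on A W' g"
    using assms(3) by (auto simp: smooth_at_def)
  have "smooth_map_on A (W \<inter> W') f" "smooth_map_on A (W \<inter> W') g" "open (W \<inter> W')"
    using W W' by (auto intro: smooth_map_on_subset)
  then have "smooth_map_on A (W \<inter> W') (\<lambda>q. h (f q) (g q))"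
    unfolding smooth_map_on_def smooth_on_def o_def
    by (auto intro!: assms(1) chart_image_open)
  with W W' show ?thesis by (auto simp: smooth_at_def)
qed

lemma smooth_at_linear:
  "bounded_linear L \<Longrightarrow> smooth_at A f p \<Longrightarrow> smooth_at A (\<lambda>q. L (f q)) p"
  by (rule smooth_at_lift[of L]) (auto intro: Ck_on_linear)

lemma smooth_at_bilinear:
  "bounded_bilinear h \<Longrightarrow> smooth_at A f p \<Longrightarrow> smooth_at A g p \<Longrightarrow> smooth_at A (\<lambda>q. h (f q) (g q)) p"
  by (rule smooth_at_lift2[of h]) (auto intro: Ck_on_bilinear)

lemmas smooth_at_scaleR = smooth_at_bilinear[OF bounded_bilinear_scaleR]
lemmas smooth_at_mult = smooth_at_bilinear[OF bounded_bilinear_mult]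
lemmas smooth_at_inner = smooth_at_bilinear[OF bounded_bilinear_inner]

lemma smooth_at_add:
  "smooth_at A f p \<Longrightarrow> smooth_at A g p \<Longrightarrow> smooth_at A (\<lambda>q. f q + g q) p"
  by (rule smooth_at_lift2[of "(+)"]) (auto intro: Ck_on_add)

lemma smooth_at_diff:
  assumes "smooth_at A f p" "smooth_at A g p"
  shows "smooth_at A (\<lambda>q. f q - g q) p"
  using smooth_at_add[OF assms(1) smooth_at_linear[OF bounded_linear_minus[OF bounded_linear_ident] assms(2)]]
  by simp

lemma smooth_at_sum:
  "(\<And>i. i \<in> I \<Longrightarrow> smooth_at A (f i) p) \<Longrightarrow> smooth_at A (\<lambda>q. \<Sum>i\<in>I. f i q) p"
  by (induction I rule: infinite_finite_induct) (auto intro: smooth_at_const smooth_at_add)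

lemma smooth_at_isCont:
  assumes "smooth_at A f p"
  shows "isCont f p"
proof -
  obtain W where W: "open W" "p \<in> W" "smooth_map_on A W f"
    using assms by (auto simp: smooth_at_def)
  obtain U \<kappa> where U: "(U, \<kappa>) \<in> atlas A" "p \<in> U"
    using chart_ex by blast
  have "Ck_on 0 (\<kappa> ` (U \<inter> W)) (f \<circ> inv_into U \<kappa>)"
    using W(3) U(1) unfolding smooth_map_on_def smooth_on_def by blast
  moreover have "continuous_on (U \<inter> W) \<kappa>"
    using chart_homeo[OF U(1)] by (meson continuous_on_subset homeomorphism_cont1 inf_le1)
  ultimately have "continuous_on (U \<inter> W) ((f \<circ> inv_into U \<kappa>) \<circ> \<kappa>)"
    using continuous_on_compose[of "U \<inter> W" \<kappa> "f \<circ> inv_into U \<kappa>"] by simp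
  then have "continuous_on (U \<inter> W) f"
    by (rule continuous_on_eq) (use chart_homeo[OF U(1)] in \<open>auto simp: homeomorphism_apply1\<close>)
  then show ?thesis
    using U W chart_open continuous_on_eq_continuous_at[of "U \<inter> W" f] by auto
qed

lemma smooth_at_nonzero_nbhd:
  fixes f :: "'m \<Rightarrow> real"
  assumes "smooth_at A f p" "f p \<noteq> 0"
  shows "\<exists>W. open W \<and> p \<in> W \<and> (\<forall>q\<in>W. f q \<noteq> 0)"
proof -
  have "\<exists>S. open S \<and> p \<in> S \<and> (\<forall>q\<in>S. f q \<in> - {0})"
    using smooth_at_isCont[OF assms(1)] assms(2) unfolding continuous_at_open by blast
  then show ?thesis by auto
qed

lemma smooth_at_inverse:
  fixes f :: "'m \<Rightarrow> real"
  assumes "smooth_at A f p" "f p \<noteq> 0"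
  shows "smooth_at A (\<lambda>q. inverse (f q)) p"
proof -
  obtain W where W: "open W" "p \<in> W" "smooth_map_on A W f"
    using assms by (auto simp: smooth_at_def)
  obtain W' where W': "open W'" "p \<in> W'" "\<And>q. q \<in> W' \<Longrightarrow> f q \<noteq> 0"
    using smooth_at_nonzero_nbhd[OF assms] by blast
  have "smooth_map_on A (W \<inter> W') (\<lambda>q. inverse (f q))"
    unfolding smooth_map_on_def smooth_on_def o_def
  proof safe
    fix U \<kappa> k assume *: "(U, \<kappa>) \<in> atlas A"
    have "smooth_map_on A (W \<inter> W') f"
      using W by (auto intro: smooth_map_on_subset)
    then have "Ck_on k (\<kappa> ` (U \<inter> (W \<inter> W'))) (\<lambda>x. f (inv_into U \<kappa> x))"
      using * unfolding smooth_map_on_def smooth_on_def o_def by blast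
    then show "Ck_on k (\<kappa> ` (U \<inter> (W \<inter> W'))) (\<lambda>x. inverse (f (inv_into U \<kappa> x)))"
    proof (rule Ck_on_inverse[rotated])
      show "open (\<kappa> ` (U \<inter> (W \<inter> W')))"
        using * W W' by (intro chart_image_open) auto
      show "f (inv_into U \<kappa> x) \<noteq> 0" if "x \<in> \<kappa> ` (U \<inter> (W \<inter> W'))" for x
        using that W'(3) chart_homeo[OF *] by (auto simp: homeomorphism_apply1)
    qed
  qed
  with W W' show ?thesis by (auto simp: smooth_at_def)
qed

text \<open>Used with a bump function for \<open>f\<close>: it recovers the smoothness of a local
  frame expression \<open>g\<close> from that of the globally defined product.\<close>

lemma smooth_at_cancel:
  fixes f :: "'m \<Rightarrow> real"
  assumes "smooth_at A f p" "f p \<noteq> 0" "smooth_at A (\<lambda>q. f q *\<^sub>R g q) p"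
  shows "smooth_at A g p"
proof -
  obtain W where W: "open W" "p \<in> W" "\<And>q. q \<in> W \<Longrightarrow> f q \<noteq> 0"
    using smooth_at_nonzero_nbhd[OF assms(1,2)] by blast
  show ?thesis
    by (rule smooth_at_cong[OF smooth_at_scaleR[OF smooth_at_inverse[OF assms(1,2)] assms(3)] W(1,2)])
      (use W(3) in auto)
qed

text \<open>In a chart, \<open>flat_exp 1\<close> is applied to r^2 - |x - \<kappa> p|^2, which is
  positive exactly on the open ball of radius r; the result is extended by 0 outside the chart
  domain and normalised at \<open>p\<close>. The closed set \<open>K\<close> is carried along
  because having zeros outside \<open>U\<close> would not by itself make products with local objects
  on \<open>U\<close> smooth at the boundary of \<open>U\<close>.\<close>

lemma bump:
  assumes "open U" "p \<in> U"
  obtains f K where "f \<in> smooth_functions A" "f p = 1" "closed K" "K \<subseteq> U" "\<And>q. q \<notin> K \<Longrightarrow> f q = 0"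
proof -
  obtain V \<kappa> where V: "(V, \<kappa>) \<in> atlas A" "p \<in> V"
    using chart_ex by blast
  note hom = chart_homeo[OF V(1)]
  obtain r where r: "r > 0" "cball (\<kappa> p) r \<subseteq> \<kappa> ` (V \<inter> U)"
  proof -
    have "\<kappa> p \<in> \<kappa> ` (V \<inter> U)"
      using V(2) assms(2) by blast
    then show ?thesis
      using chart_image_open[OF V(1) assms(1)] that unfolding open_contains_cball by blast
  qed
  define K where "K = inv_into V \<kappa> ` cball (\<kappa> p) r"
  define f where
    "f q = (if q \<in> V then flat_exp 1 (r\<^sup>2 - inner (\<kappa> q - \<kappa> p) (\<kappa> q - \<kappa> p)) else 0)" for q
  have "continuous_on (cball (\<kappa> p) r) (inv_into V \<kappa>)"
    by (rule continuous_on_subset[OF homeomorphism_cont2[OF hom]]) (use r in blast)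
  then have "compact K"
    unfolding K_def by (intro compact_continuous_image compact_cball_finite_dim)
  \<comment> \<open>Here the Hausdorff property of the base enters: the image of a closed chart ball
    is closed in the whole manifold, so a point outside the chart domain has the neighbourhood
    \<open>- K\<close> on which the extension is 0.\<close>
  then have "closed K" by (rule compact_imp_closed)
  moreover have KU: "K \<subseteq> U \<inter> V"
  proof
    fix x assume "x \<in> K"
    then obtain y where "y \<in> cball (\<kappa> p) r" "x = inv_into V \<kappa> y"
      by (auto simp: K_def)
    with r(2) obtain q where "q \<in> V \<inter> U" "x = inv_into V \<kappa> (\<kappa> q)"
      by blast
    with homeomorphism_apply1[OF hom] show "x \<in> U \<inter> V" by auto
  qed
  moreover have f0: "f q = 0" if "q \<notin> K" for q
  proof (cases "q \<in> V")
    case True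
    have "\<kappa> q \<notin> cball (\<kappa> p) r"
      using that True homeomorphism_apply1[OF hom True] by (force simp: K_def)
    then have "r \<le> norm (\<kappa> q - \<kappa> p)"
      by (simp add: dist_norm norm_minus_commute)
    then have "r\<^sup>2 \<le> inner (\<kappa> q - \<kappa> p) (\<kappa> q - \<kappa> p)"
      using r(1) by (simp add: power2_norm_eq_inner[symmetric])
    then show ?thesis
      by (simp add: f_def flat_exp_def)
  qed (simp add: f_def)
  moreover have "f p \<noteq> 0"
    using r(1) V(2) by (simp add: f_def flat_exp_def)
  moreover have sm: "smooth_at A f q" for q
  proof (cases "q \<in> V")
    case True
    have "smooth_at A \<kappa> q"
      using True V by (intro smooth_map_on_imp_at[OF chart_smooth]) (auto intro: chart_open)
    then have "smooth_at A (\<lambda>q. r\<^sup>2 - inner (\<kappa> q - \<kappa> p) (\<kappa> q - \<kappa> p)) q"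
      by (intro smooth_at_diff smooth_at_inner smooth_at_const)
    then have "smooth_at A (\<lambda>q. flat_exp 1 (r\<^sup>2 - inner (\<kappa> q - \<kappa> p) (\<kappa> q - \<kappa> p))) q"
      by (rule smooth_at_lift[rotated]) (rule Ck_on_flat_exp)
    then show ?thesis
      by (rule smooth_at_cong[OF _ chart_open[OF V(1)] True]) (simp add: f_def)
  next
    case False
    with KU have "q \<in> - K" by auto
    with \<open>closed K\<close> f0 show ?thesis
      by (intro smooth_at_cong[OF smooth_at_const[of 0], of "- K"]) auto
  qed
  moreover have "(\<lambda>q. inverse (f p) * f q) \<in> smooth_functions A"
    unfolding smooth_functions_iff by (intro allI smooth_at_mult smooth_at_const sm)
  ultimately show thesis
    using that[of "\<lambda>q. inverse (f p) * f q" K] by auto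
qed


section \<open>Local trivializations and frames\<close>

lemma smooth_functionsD: "f \<in> smooth_functions A \<Longrightarrow> smooth_at A f p"
  by (simp add: smooth_functions_iff)

lemma subspace_fibre: "subspace (fibre A p)"
  using vector_bundle by (simp add: vector_bundle_def)

lemma triv_ex: "\<exists>U \<phi>. (U, \<phi>) \<in> trivs A \<and> p \<in> U"
proof -
  have "\<Union>(case_prod (\<lambda>U \<phi>. U) ` trivs A) = UNIV"
    using vector_bundle by (simp add: vector_bundle_def)
  then have "p \<in> \<Union>(case_prod (\<lambda>U \<phi>. U) ` trivs A)" by simp
  then show ?thesis by auto
qed

lemma triv_open: "(U, \<phi>) \<in> trivs A \<Longrightarrow> open U"
  using vector_bundle unfolding vector_bundle_def by fast

lemma
  assumes "(U, \<phi>) \<in> trivs A" "p \<in> U"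
  shows triv_bij: "bij_betw (\<phi> p) (fibre A p) UNIV"
    and triv_add: "u \<in> fibre A p \<Longrightarrow> v \<in> fibre A p \<Longrightarrow> \<phi> p (u + v) = \<phi> p u + \<phi> p v"
    and triv_scale: "u \<in> fibre A p \<Longrightarrow> \<phi> p (c *\<^sub>R u) = c *\<^sub>R \<phi> p u"
  using vector_bundle assms unfolding vector_bundle_def by fast+

lemma transition_smooth:
  assumes "(U, \<phi>) \<in> trivs A" "(V, \<psi>) \<in> trivs A" "p \<in> U" "p \<in> V"
  shows "smooth_at A (\<lambda>p. \<psi> p (frame A \<phi> w p)) p"
proof -
  have "smooth_map_on A (U \<inter> V) (\<lambda>p. \<psi> p (frame A \<phi> w p))"
    using vector_bundle assms(1,2) unfolding vector_bundle_def by fast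
  then show ?thesis
    using assms triv_open by (auto intro: smooth_map_on_imp_at)
qed

lemma
  assumes "(U, \<phi>) \<in> trivs A" "p \<in> U"
  shows frame_fibre: "frame A \<phi> w p \<in> fibre A p"
    and triv_frame: "\<phi> p (frame A \<phi> w p) = w"
    and frame_triv: "u \<in> fibre A p \<Longrightarrow> frame A \<phi> (\<phi> p u) p = u"
  using triv_bij[OF assms] unfolding frame_def
  by (auto simp: bij_betw_def inv_into_into f_inv_into_f)

lemma fibre_expand:
  assumes "(U, \<phi>) \<in> trivs A" "p \<in> U" "u \<in> fibre A p"
  shows "(\<Sum>b\<in>onb. inner b (\<phi> p u) *\<^sub>R frame A \<phi> b p) = u"
proof -
  have "\<phi> p (\<Sum>b\<in>onb. inner b (\<phi> p u) *\<^sub>R frame A \<phi> b p)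
      = (\<Sum>b\<in>onb. inner b (\<phi> p u) *\<^sub>R \<phi> p (frame A \<phi> b p))"
    by (rule linear_on_subspace_sum[OF subspace_fibre])
      (use assms in \<open>auto intro: triv_add triv_scale frame_fibre\<close>)
  also have "\<dots> = \<phi> p u"
    using assms by (simp add: triv_frame onb_expand)
  finally have "\<phi> p (\<Sum>b\<in>onb. inner b (\<phi> p u) *\<^sub>R frame A \<phi> b p) = \<phi> p u" .
  moreover have "(\<Sum>b\<in>onb. inner b (\<phi> p u) *\<^sub>R frame A \<phi> b p) \<in> fibre A p"
    using assms by (intro subspace_sum subspace_scale subspace_fibre frame_fibre)
  ultimately show ?thesis
    using triv_bij[OF assms(1,2)] assms(3) by (auto simp: bij_betw_def inj_on_def)
qed

lemma fibrewise_linear_expand: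
  fixes L :: "'a \<Rightarrow> 'b::real_vector"
  assumes "(U, \<phi>) \<in> trivs A" "p \<in> U" "u \<in> fibre A p"
    and "\<And>u v. u \<in> fibre A p \<Longrightarrow> v \<in> fibre A p \<Longrightarrow> L (u + v) = L u + L v"
    and "\<And>c u. u \<in> fibre A p \<Longrightarrow> L (c *\<^sub>R u) = c *\<^sub>R L u"
  shows "L u = (\<Sum>b\<in>onb. inner b (\<phi> p u) *\<^sub>R L (frame A \<phi> b p))"
  using linear_on_subspace_sum[OF subspace_fibre assms(4,5),
      where F = onb and e = "\<lambda>b. frame A \<phi> b p" and c = "\<lambda>b. inner b (\<phi> p u)"]
    fibre_expand[OF assms(1-3)] frame_fibre[OF assms(1,2)] by simp

section \<open>Sections\<close>

lemma sections_fibre: "x \<in> sections A \<Longrightarrow> x p \<in> fibre A p"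
  by (simp add: sections_def)

lemma sections_smooth:
  assumes "x \<in> sections A" "(U, \<phi>) \<in> trivs A" "p \<in> U"
  shows "smooth_at A (\<lambda>q. \<phi> q (x q)) p"
proof -
  have "smooth_map_on A U (\<lambda>q. \<phi> q (x q))"
    using assms unfolding sections_def by fast
  then show ?thesis
    using assms triv_open by (auto intro: smooth_map_on_imp_at)
qed

lemma sections_coord_smooth:
  "x \<in> sections A \<Longrightarrow> (U, \<phi>) \<in> trivs A \<Longrightarrow> p \<in> U \<Longrightarrow> smooth_at A (\<lambda>q. inner b (\<phi> q (x q))) p"
  by (intro smooth_at_inner smooth_at_const sections_smooth)

text \<open>One trivialization around each point suffices: coordinates in another one are obtained
  through the transition functions, which are smooth.\<close>

lemma sectionsI:
  assumes "\<And>p. x p \<in> fibre A p"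
    and "\<And>p. \<exists>U \<phi>. (U, \<phi>) \<in> trivs A \<and> p \<in> U \<and> smooth_at A (\<lambda>q. \<phi> q (x q)) p"
  shows "x \<in> sections A"
proof -
  have "smooth_at A (\<lambda>q. \<psi> q (x q)) p" if V: "(V, \<psi>) \<in> trivs A" "p \<in> V" for V \<psi> p
  proof -
    obtain U \<phi> where U: "(U, \<phi>) \<in> trivs A" "p \<in> U" "smooth_at A (\<lambda>q. \<phi> q (x q)) p"
      using assms(2) by blast
    have "smooth_at A (\<lambda>q. \<Sum>b\<in>onb. inner b (\<phi> q (x q)) *\<^sub>R \<psi> q (frame A \<phi> b q)) p"
      by (intro smooth_at_sum smooth_at_scaleR smooth_at_inner smooth_at_const U(3)
          transition_smooth[OF U(1) V(1) U(2) V(2)])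
    then show ?thesis
      by (rule smooth_at_cong[of _ _ "U \<inter> V"])
        (use U V assms(1) in \<open>auto intro: triv_open fibrewise_linear_expand[symmetric] triv_add triv_scale\<close>)
  qed
  with assms(1) show ?thesis
    by (auto simp: sections_def intro: smooth_map_onI)
qed

lemma sections_add:
  assumes "x \<in> sections A" "y \<in> sections A"
  shows "(\<lambda>q. x q + y q) \<in> sections A"
proof (rule sectionsI)
  show "x p + y p \<in> fibre A p" for p
    by (intro subspace_add subspace_fibre sections_fibre assms)
  fix p
  obtain U \<phi> where U: "(U, \<phi>) \<in> trivs A" "p \<in> U"
    using triv_ex by blast
  have "smooth_at A (\<lambda>q. \<phi> q (x q + y q)) p"
    by (rule smooth_at_cong[OF smooth_at_add[OF assms[THEN sections_smooth, OF U]] triv_open[OF U(1)] U(2)])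
      (simp add: triv_add[OF U(1)] sections_fibre assms)
  with U show "\<exists>U \<phi>. (U, \<phi>) \<in> trivs A \<and> p \<in> U \<and> smooth_at A (\<lambda>q. \<phi> q (x q + y q)) p"
    by blast
qed

lemma sections_scale:
  assumes "x \<in> sections A" "f \<in> smooth_functions A"
  shows "(\<lambda>q. f q *\<^sub>R x q) \<in> sections A"
proof (rule sectionsI)
  show "f p *\<^sub>R x p \<in> fibre A p" for p
    by (intro subspace_scale subspace_fibre sections_fibre assms)
  fix p
  obtain U \<phi> where U: "(U, \<phi>) \<in> trivs A" "p \<in> U"
    using triv_ex by blast
  have "smooth_at A (\<lambda>q. \<phi> q (f q *\<^sub>R x q)) p"
    by (rule smooth_at_cong[OF smooth_at_scaleR[OF smooth_functionsD[OF assms(2)]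
            sections_smooth[OF assms(1) U]] triv_open[OF U(1)] U(2)])
      (simp add: triv_scale[OF U(1)] sections_fibre assms)
  with U show "\<exists>U \<phi>. (U, \<phi>) \<in> trivs A \<and> p \<in> U \<and> smooth_at A (\<lambda>q. \<phi> q (f q *\<^sub>R x q)) p"
    by blast
qed

lemma smooth_functions_const: "(\<lambda>q. c) \<in> smooth_functions A"
  by (simp add: smooth_functions_iff smooth_at_const)

lemma sections_diff:
  assumes "x \<in> sections A" "y \<in> sections A"
  shows "(\<lambda>q. x q - y q) \<in> sections A"
  using sections_add[OF assms(1) sections_scale[OF assms(2) smooth_functions_const[of "-1"]]] by simp

text \<open>Outside \<open>U\<close> the value of \<open>frame\<close> is meaningless, but there it
  is multiplied by 0. A point outside \<open>U\<close> lies in the open set \<open>- K\<close>,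
  where the product vanishes identically.\<close>

lemma bump_frame_section:
  assumes "(U, \<phi>) \<in> trivs A" "f \<in> smooth_functions A" "closed K" "K \<subseteq> U" "\<And>q. q \<notin> K \<Longrightarrow> f q = 0"
  shows "(\<lambda>q. f q *\<^sub>R frame A \<phi> w q) \<in> sections A"
proof (rule sectionsI)
  fix p
  show "f p *\<^sub>R frame A \<phi> w p \<in> fibre A p"
  proof (cases "p \<in> U")
    case True
    then show ?thesis
      by (intro subspace_scale subspace_fibre frame_fibre[OF assms(1)])
  next
    case False
    with assms(4) have "f p = 0"
      by (intro assms(5)) auto
    then show ?thesis
      by (simp add: subspace_0 subspace_fibre)
  qed
  show "\<exists>V \<psi>. (V, \<psi>) \<in> trivs A \<and> p \<in> V \<and> smooth_at A (\<lambda>q. \<psi> q (f q *\<^sub>R frame A \<phi> w q)) p"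
  proof (cases "p \<in> U")
    case True
    have "smooth_at A (\<lambda>q. \<phi> q (f q *\<^sub>R frame A \<phi> w q)) p"
      by (rule smooth_at_cong[of "\<lambda>q. f q *\<^sub>R w" _ U])
        (use True assms(1,2) in \<open>auto simp: triv_scale[OF assms(1)] frame_fibre[OF assms(1)] triv_frame
            intro!: smooth_at_scaleR smooth_functionsD smooth_at_const triv_open[OF assms(1)]\<close>)
    with assms(1) True show ?thesis by blast
  next
    case False
    obtain V \<psi> where V: "(V, \<psi>) \<in> trivs A" "p \<in> V"
      using triv_ex by blast
    have "smooth_at A (\<lambda>q. \<psi> q (f q *\<^sub>R frame A \<phi> w q)) p"
    proof (rule smooth_at_cong[of "\<lambda>q. 0" _ "- K \<inter> V"])
      fix q assume "q \<in> - K \<inter> V"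
      then have "\<psi> q (0 *\<^sub>R 0) = 0" "f q = 0"
        using triv_scale[OF V(1), of q 0 0] subspace_0[OF subspace_fibre] assms(5) by auto
      then show "0 = \<psi> q (f q *\<^sub>R frame A \<phi> w q)" by simp
    qed (use False V assms(3,4) triv_open[OF V(1)] in \<open>auto intro: smooth_at_const\<close>)
    with V show ?thesis by blast
  qed
qed

lemma section_ext:
  assumes "u \<in> fibre A p"
  shows "\<exists>x\<in>sections A. x p = u"
proof -
  obtain U \<phi> where U: "(U, \<phi>) \<in> trivs A" "p \<in> U"
    using triv_ex by blast
  obtain f K where f: "f \<in> smooth_functions A" "f p = 1" "closed K" "K \<subseteq> U" "\<And>q. q \<notin> K \<Longrightarrow> f q = 0"
    using bump[OF triv_open[OF U(1)] U(2)] by blast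
  show ?thesis
    by (rule bexI[OF _ bump_frame_section[OF U(1) f(1,3-5), of "\<phi> p u"]])
      (simp add: f(2) frame_triv[OF U assms])
qed

section \<open>Dual fibres and sections of the dual bundle\<close>

lemma dual_fibre_add:
  "\<alpha> \<in> dual_fibre A p \<Longrightarrow> u \<in> fibre A p \<Longrightarrow> v \<in> fibre A p \<Longrightarrow> \<alpha> (u + v) = \<alpha> u + \<alpha> v"
  by (simp add: dual_fibre_def)

lemma dual_fibre_scale: "\<alpha> \<in> dual_fibre A p \<Longrightarrow> u \<in> fibre A p \<Longrightarrow> \<alpha> (c *\<^sub>R u) = c * \<alpha> u"
  by (simp add: dual_fibre_def)

lemma dual_fibre_outside: "\<alpha> \<in> dual_fibre A p \<Longrightarrow> u \<notin> fibre A p \<Longrightarrow> \<alpha> u = 0"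
  by (simp add: dual_fibre_def)

lemma dual_fibre_diff:
  "\<alpha> \<in> dual_fibre A p \<Longrightarrow> u \<in> fibre A p \<Longrightarrow> v \<in> fibre A p \<Longrightarrow> \<alpha> (u - v) = \<alpha> u - \<alpha> v"
  using dual_fibre_add[of \<alpha> p u "(-1) *\<^sub>R v"] dual_fibre_scale[of \<alpha> p v "-1"]
    subspace_scale[OF subspace_fibre, of v p "-1"] by simp

lemma dual_fibre_expand:
  "(U, \<phi>) \<in> trivs A \<Longrightarrow> p \<in> U \<Longrightarrow> \<alpha> \<in> dual_fibre A p \<Longrightarrow> u \<in> fibre A p \<Longrightarrow>
    \<alpha> u = (\<Sum>b\<in>onb. inner b (\<phi> p u) * \<alpha> (frame A \<phi> b p))"
  by (subst fibrewise_linear_expand[of U \<phi> p u \<alpha>]) (auto intro: dual_fibre_add dual_fibre_scale)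

lemma dual_sections_fibre: "\<alpha> \<in> dual_sections A \<Longrightarrow> \<alpha> p \<in> dual_fibre A p"
  by (simp add: dual_sections_def)

lemma dual_sections_smooth:
  assumes "\<alpha> \<in> dual_sections A" "(U, \<phi>) \<in> trivs A" "p \<in> U"
  shows "smooth_at A (\<lambda>q. \<alpha> q (frame A \<phi> w q)) p"
proof -
  have "smooth_map_on A U (\<lambda>q. \<alpha> q (frame A \<phi> w q))"
    using assms unfolding dual_sections_def by fast
  then show ?thesis
    using assms triv_open by (auto intro: smooth_map_on_imp_at)
qed

lemma pairing_smooth:
  assumes "\<alpha> \<in> dual_sections A" "x \<in> sections A"
  shows "pairing \<alpha> x \<in> smooth_functions A"
  unfolding smooth_functions_iff
proof
  fix p
  obtain U \<phi> where U: "(U, \<phi>) \<in> trivs A" "p \<in> U"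
    using triv_ex by blast
  have "smooth_at A (\<lambda>q. \<Sum>b\<in>onb. inner b (\<phi> q (x q)) * \<alpha> q (frame A \<phi> b q)) p"
    by (intro smooth_at_sum smooth_at_mult sections_coord_smooth[OF assms(2) U]
        dual_sections_smooth[OF assms(1) U])
  then show "smooth_at A (pairing \<alpha> x) p"
    by (rule smooth_at_cong[OF _ triv_open[OF U(1)] U(2)])
      (use assms U(1) in \<open>simp add: pairing_def dual_fibre_expand[symmetric] sections_fibre dual_sections_fibre\<close>)
qed

text \<open>Smoothness of a fibrewise linear object may be tested on global sections, since the local
  frame agrees with one up to multiplication by a bump function.\<close>

lemma dual_sectionsI:
  assumes "\<And>p. \<alpha> p \<in> dual_fibre A p"
    and "\<And>x. x \<in> sections A \<Longrightarrow> pairing \<alpha> x \<in> smooth_functions A"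
  shows "\<alpha> \<in> dual_sections A"
proof -
  have "smooth_at A (\<lambda>q. \<alpha> q (frame A \<phi> w q)) p" if U: "(U, \<phi>) \<in> trivs A" "p \<in> U" for U \<phi> w p
  proof -
    obtain f K where f: "f \<in> smooth_functions A" "f p = 1" "closed K" "K \<subseteq> U" "\<And>q. q \<notin> K \<Longrightarrow> f q = 0"
      using bump[OF triv_open[OF U(1)] U(2)] by blast
    have "smooth_at A (pairing \<alpha> (\<lambda>q. f q *\<^sub>R frame A \<phi> w q)) p"
      by (intro smooth_functionsD assms bump_frame_section[OF U(1) f(1,3-5)])
    then have "smooth_at A (\<lambda>q. f q *\<^sub>R \<alpha> q (frame A \<phi> w q)) p"
      by (rule smooth_at_cong[OF _ triv_open[OF U(1)] U(2)])
        (simp add: pairing_def dual_fibre_scale[OF assms(1)] frame_fibre[OF U(1)])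
    then show ?thesis
      by (rule smooth_at_cancel[OF smooth_functionsD[OF f(1)], rotated]) (simp add: f)
  qed
  with assms(1) show ?thesis
    by (auto simp: dual_sections_def intro: smooth_map_onI)
qed

lemma coframe_dual_fibre:
  "(U, \<phi>) \<in> trivs A \<Longrightarrow> p \<in> U \<Longrightarrow> coframe A \<phi> w p \<in> dual_fibre A p"
  by (simp add: dual_fibre_def coframe_def triv_add triv_scale inner_add_right
      subspace_add subspace_scale subspace_fibre)

lemma bump_coframe_section:
  assumes U: "(U, \<phi>) \<in> trivs A" and f: "f \<in> smooth_functions A" "closed K" "K \<subseteq> U" "\<And>q. q \<notin> K \<Longrightarrow> f q = 0"
  shows "(\<lambda>q u. f q * coframe A \<phi> w q u) \<in> dual_sections A"
proof (rule dual_sectionsI)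
  fix p
  show "(\<lambda>u. f p * coframe A \<phi> w p u) \<in> dual_fibre A p"
  proof (cases "p \<in> U")
    case True
    then show ?thesis
      using coframe_dual_fibre[OF U True, of w] by (simp add: dual_fibre_def algebra_simps)
  next
    case False
    with f(3) have "f p = 0"
      by (intro f(4)) auto
    then show ?thesis
      by (simp add: dual_fibre_def)
  qed
next
  fix x assume x: "x \<in> sections A"
  show "pairing (\<lambda>q u. f q * coframe A \<phi> w q u) x \<in> smooth_functions A"
    unfolding smooth_functions_iff
  proof
    fix p
    show "smooth_at A (pairing (\<lambda>q u. f q * coframe A \<phi> w q u) x) p"
    proof (cases "p \<in> U")
      case True
      have "smooth_at A (\<lambda>q. f q * inner w (\<phi> q (x q))) p"
        by (intro smooth_at_mult smooth_functionsD f sections_coord_smooth[OF x U True])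
      then show ?thesis
        by (rule smooth_at_cong[OF _ triv_open[OF U] True])
          (simp add: pairing_def coframe_def sections_fibre[OF x])
    next
      case False
      then show ?thesis
        by (intro smooth_at_cong[OF smooth_at_const[of 0], of "- K"])
          (use f in \<open>auto simp: pairing_def\<close>)
    qed
  qed
qed

lemma coframe_expand:
  assumes "(U, \<phi>) \<in> trivs A" "p \<in> U" "\<alpha> \<in> dual_fibre A p"
  shows "(\<lambda>u. \<Sum>b\<in>onb. \<alpha> (frame A \<phi> b p) * coframe A \<phi> b p u) = \<alpha>"
proof
  fix u
  show "(\<Sum>b\<in>onb. \<alpha> (frame A \<phi> b p) * coframe A \<phi> b p u) = \<alpha> u"
    using dual_fibre_expand[OF assms, of u] dual_fibre_outside[OF assms(3), of u]
    by (cases "u \<in> fibre A p") (simp_all add: coframe_def mult.commute)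
qed

lemma dual_section_ext:
  assumes "\<alpha>\<^sub>0 \<in> dual_fibre A p"
  shows "\<exists>\<alpha>\<in>dual_sections A. \<alpha> p = \<alpha>\<^sub>0"
proof -
  obtain U \<phi> where U: "(U, \<phi>) \<in> trivs A" "p \<in> U"
    using triv_ex by blast
  obtain f K where f: "f \<in> smooth_functions A" "f p = 1" "closed K" "K \<subseteq> U" "\<And>q. q \<notin> K \<Longrightarrow> f q = 0"
    using bump[OF triv_open[OF U(1)] U(2)] by blast
  \<comment> \<open>The vector representing the given functional by the inner product in the
    trivialization, so that its coframe at \<open>p\<close> is that functional.\<close>
  define w where "w = (\<Sum>b\<in>onb. \<alpha>\<^sub>0 (frame A \<phi> b p) *\<^sub>R b)"
  have "coframe A \<phi> w p u = \<alpha>\<^sub>0 u" for u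
  proof -
    have "coframe A \<phi> w p u = (\<Sum>b\<in>onb. \<alpha>\<^sub>0 (frame A \<phi> b p) * coframe A \<phi> b p u)"
      by (simp add: w_def coframe_def inner_sum_left)
    then show ?thesis
      by (simp add: fun_cong[OF coframe_expand[OF U assms]])
  qed
  then show ?thesis
    by (intro bexI[OF _ bump_coframe_section[OF U(1) f(1,3-5), of w]]) (simp add: f(2))
qed

lemma fibre_eqI:
  assumes "u \<in> fibre A p" "v \<in> fibre A p" "\<And>\<beta>. \<beta> \<in> dual_fibre A p \<Longrightarrow> \<beta> u = \<beta> v"
  shows "u = v"
proof -
  obtain U \<phi> where U: "(U, \<phi>) \<in> trivs A" "p \<in> U"
    using triv_ex by blast
  have "inner b (\<phi> p u) = inner b (\<phi> p v)" for b
    using assms(3)[OF coframe_dual_fibre[OF U, of b]] assms(1,2) by (simp add: coframe_def)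
  then have "\<phi> p u = \<phi> p v"
    by (metis vector_eq_ldot)
  with triv_bij[OF U] assms(1,2) show ?thesis
    by (auto simp: bij_betw_def inj_on_def)
qed

lemma section_eqI:
  assumes "x \<in> sections A" "y \<in> sections A"
    and "\<And>\<beta> p. \<beta> \<in> dual_sections A \<Longrightarrow> pairing \<beta> x p = pairing \<beta> y p"
  shows "x = y"
proof
  fix p
  have "\<beta> (x p) = \<beta> (y p)" if "\<beta> \<in> dual_fibre A p" for \<beta>
    using dual_section_ext[OF that] assms(3) by (auto simp: pairing_def)
  then show "x p = y p"
    by (rule fibre_eqI[OF sections_fibre[OF assms(1)] sections_fibre[OF assms(2)]])
qed

lemma dual_section_eqI:
  assumes "\<alpha> \<in> dual_sections A" "\<beta> \<in> dual_sections A"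
    and "\<And>y p. y \<in> sections A \<Longrightarrow> pairing \<alpha> y p = pairing \<beta> y p"
  shows "\<alpha> = \<beta>"
proof (intro ext)
  fix p u
  show "\<alpha> p u = \<beta> p u"
  proof (cases "u \<in> fibre A p")
    case True
    with section_ext assms(3) show ?thesis
      by (fastforce simp: pairing_def)
  qed (use assms in \<open>simp add: dual_sections_def dual_fibre_def\<close>)
qed

text \<open>The coordinates of \<open>x\<close> are its pairings with the coframe; times a bump
  function the coframe is a global dual section, and the factor is cancelled near \<open>p\<close>.
  This is how H^sharp of a smooth dual section is seen to be smooth.\<close>

lemma sectionsI_pairing:
  assumes "\<And>p. x p \<in> fibre A p"
    and "\<And>\<alpha>. \<alpha> \<in> dual_sections A \<Longrightarrow> pairing \<alpha> x \<in> smooth_functions A"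
  shows "x \<in> sections A"
proof (rule sectionsI)
  fix p
  obtain U \<phi> where U: "(U, \<phi>) \<in> trivs A" "p \<in> U"
    using triv_ex by blast
  obtain f K where f: "f \<in> smooth_functions A" "f p = 1" "closed K" "K \<subseteq> U" "\<And>q. q \<notin> K \<Longrightarrow> f q = 0"
    using bump[OF triv_open[OF U(1)] U(2)] by blast
  have "smooth_at A (\<lambda>q. inner b (\<phi> q (x q))) p" for b
  proof -
    have "smooth_at A (pairing (\<lambda>q u. f q * coframe A \<phi> b q u) x) p"
      by (intro smooth_functionsD assms bump_coframe_section[OF U(1) f(1,3-5)])
    then have "smooth_at A (\<lambda>q. f q *\<^sub>R inner b (\<phi> q (x q))) p"
      by (rule smooth_at_cong[OF _ triv_open[OF U(1)] U(2)])
        (simp add: pairing_def coframe_def assms(1))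
    then show ?thesis
      by (rule smooth_at_cancel[OF smooth_functionsD[OF f(1)], rotated]) (simp add: f)
  qed
  then have "smooth_at A (\<lambda>q. \<Sum>b\<in>onb. inner b (\<phi> q (x q)) *\<^sub>R b) p"
    by (intro smooth_at_sum smooth_at_scaleR smooth_at_const)
  then show "\<exists>U \<phi>. (U, \<phi>) \<in> trivs A \<and> p \<in> U \<and> smooth_at A (\<lambda>q. \<phi> q (x q)) p"
    using U by (auto simp: onb_expand)
qed (rule assms(1))

section \<open>Bundle maps and symmetric tensors\<close>

lemma
  assumes "bundle_endomorphism A N" "u \<in> fibre A p"
  shows endo_fibre: "N p u \<in> fibre A p"
    and endo_add: "v \<in> fibre A p \<Longrightarrow> N p (u + v) = N p u + N p v"
    and endo_scale: "N p (c *\<^sub>R u) = c *\<^sub>R N p u"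
  using assms by (auto simp: bundle_endomorphism_def)

lemma endo_section:
  assumes N: "bundle_endomorphism A N" and x: "x \<in> sections A"
  shows "act N x \<in> sections A"
proof (rule sectionsI)
  show "act N x p \<in> fibre A p" for p
    by (simp add: act_def endo_fibre[OF N] sections_fibre[OF x])
  fix p
  obtain U \<phi> where U: "(U, \<phi>) \<in> trivs A" "p \<in> U"
    using triv_ex by blast
  have "smooth_map_on A U (\<lambda>p. \<phi> p (N p (frame A \<phi> b p)))" for b
    using N U(1) unfolding bundle_endomorphism_def by fast
  then have "smooth_at A (\<lambda>q. \<Sum>b\<in>onb. inner b (\<phi> q (x q)) *\<^sub>R \<phi> q (N q (frame A \<phi> b q))) p"
    by (intro smooth_at_sum smooth_at_scaleR sections_coord_smooth[OF x U]
        smooth_map_on_imp_at[OF _ triv_open[OF U(1)] U(2)])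
  then have "smooth_at A (\<lambda>q. \<phi> q (act N x q)) p"
  proof (rule smooth_at_cong[OF _ triv_open[OF U(1)] U(2)])
    fix q assume q: "q \<in> U"
    show "(\<Sum>b\<in>onb. inner b (\<phi> q (x q)) *\<^sub>R \<phi> q (N q (frame A \<phi> b q))) = \<phi> q (act N x q)"
      unfolding act_def
      by (rule fibrewise_linear_expand[OF U(1) q, of "x q" "\<lambda>u. \<phi> q (N q u)", symmetric])
        (auto simp: endo_fibre[OF N] endo_add[OF N] endo_scale[OF N] triv_add[OF U(1) q]
          triv_scale[OF U(1) q] sections_fibre[OF x])
  qed
  with U show "\<exists>U \<phi>. (U, \<phi>) \<in> trivs A \<and> p \<in> U \<and> smooth_at A (\<lambda>q. \<phi> q (act N x q)) p"
    by blast
qed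

text \<open>Converse of \<open>endo_section\<close>: the action is tested on a frame multiplied by a
  bump function, which is 1 at \<open>p\<close> and can be divided out nearby.\<close>

lemma bundle_endomorphismI:
  assumes fib: "\<And>p u. u \<in> fibre A p \<Longrightarrow> N p u \<in> fibre A p"
    and add: "\<And>p u v. u \<in> fibre A p \<Longrightarrow> v \<in> fibre A p \<Longrightarrow> N p (u + v) = N p u + N p v"
    and scale: "\<And>p c u. u \<in> fibre A p \<Longrightarrow> N p (c *\<^sub>R u) = c *\<^sub>R N p u"
    and act: "\<And>x. x \<in> sections A \<Longrightarrow> act N x \<in> sections A"
  shows "bundle_endomorphism A N"
proof -
  have "smooth_at A (\<lambda>q. \<phi> q (N q (frame A \<phi> w q))) p" if U: "(U, \<phi>) \<in> trivs A" "p \<in> U" for U \<phi> w p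
  proof -
    obtain f K where f: "f \<in> smooth_functions A" "f p = 1" "closed K" "K \<subseteq> U" "\<And>q. q \<notin> K \<Longrightarrow> f q = 0"
      using bump[OF triv_open[OF U(1)] U(2)] by blast
    have "smooth_at A (\<lambda>q. \<phi> q (act N (\<lambda>q. f q *\<^sub>R frame A \<phi> w q) q)) p"
      by (intro sections_smooth[OF _ U] act bump_frame_section[OF U(1) f(1,3-5)])
    then have "smooth_at A (\<lambda>q. f q *\<^sub>R \<phi> q (N q (frame A \<phi> w q))) p"
      by (rule smooth_at_cong[OF _ triv_open[OF U(1)] U(2)])
        (simp add: act_def scale fib triv_scale[OF U(1)] frame_fibre[OF U(1)])
    then show ?thesis
      by (rule smooth_at_cancel[OF smooth_functionsD[OF f(1)], rotated]) (simp add: f)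
  qed
  with assms(1-3) show ?thesis
    by (auto simp: bundle_endomorphism_def intro: smooth_map_onI)
qed


section \<open>Symmetric tensors and their maps H^sharp and B^natural\<close>

lemma dual_fibre_zero_vec: "\<alpha> \<in> dual_fibre A p \<Longrightarrow> \<alpha> 0 = 0"
  using dual_fibre_scale[of \<alpha> p 0 0] subspace_0[OF subspace_fibre] by simp

lemma dual_fibre_add_closed:
  "\<alpha> \<in> dual_fibre A p \<Longrightarrow> \<beta> \<in> dual_fibre A p \<Longrightarrow> (\<lambda>u. \<alpha> u + \<beta> u) \<in> dual_fibre A p"
  by (simp add: dual_fibre_def algebra_simps)

lemma dual_fibre_scale_closed: "\<alpha> \<in> dual_fibre A p \<Longrightarrow> (\<lambda>u. c * \<alpha> u) \<in> dual_fibre A p"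
  by (simp add: dual_fibre_def algebra_simps)

lemma dual_fibre_zero: "(\<lambda>u. 0) \<in> dual_fibre A p"
  by (simp add: dual_fibre_def)

lemma dual_fibre_sum_closed:
  "(\<And>b. b \<in> F \<Longrightarrow> e b \<in> dual_fibre A p) \<Longrightarrow> (\<lambda>u. \<Sum>b\<in>F. c b * e b u) \<in> dual_fibre A p"
  by (induction F rule: infinite_finite_induct)
    (auto intro!: dual_fibre_zero dual_fibre_add_closed dual_fibre_scale_closed)

lemma
  assumes "H \<in> Sym2 A" "\<alpha> \<in> dual_fibre A p" "\<beta> \<in> dual_fibre A p"
  shows Sym2_commute: "H p \<alpha> \<beta> = H p \<beta> \<alpha>"
    and Sym2_add: "\<gamma> \<in> dual_fibre A p \<Longrightarrow> H p (\<lambda>u. \<alpha> u + \<beta> u) \<gamma> = H p \<alpha> \<gamma> + H p \<beta> \<gamma>"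
    and Sym2_scale: "H p (\<lambda>u. c * \<alpha> u) \<beta> = c * H p \<alpha> \<beta>"
  using assms by (auto simp: Sym2_def)

lemma Sym2_sum:
  assumes H: "H \<in> Sym2 A" and \<gamma>: "\<gamma> \<in> dual_fibre A p"
    and "\<And>b. b \<in> F \<Longrightarrow> e b \<in> dual_fibre A p"
  shows "H p (\<lambda>u. \<Sum>b\<in>F. c b * e b u) \<gamma> = (\<Sum>b\<in>F. c b * H p (e b) \<gamma>)"
  using assms(3)
proof (induction F rule: infinite_finite_induct)
  case (insert b F)
  then show ?case
    by (simp add: Sym2_add[OF H] Sym2_scale[OF H] dual_fibre_sum_closed dual_fibre_scale_closed \<gamma>)
qed (use Sym2_scale[OF H dual_fibre_zero \<gamma>, of 0] in simp_all)

lemma Sym2_expand: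
  assumes H: "H \<in> Sym2 A" and U: "(U, \<phi>) \<in> trivs A" "p \<in> U"
    and \<alpha>: "\<alpha> \<in> dual_fibre A p" and \<beta>: "\<beta> \<in> dual_fibre A p"
  shows "H p \<alpha> \<beta> = (\<Sum>b\<in>onb. \<alpha> (frame A \<phi> b p) * H p (coframe A \<phi> b p) \<beta>)"
proof -
  have "H p (\<lambda>u. \<Sum>b\<in>onb. \<alpha> (frame A \<phi> b p) * coframe A \<phi> b p u) \<beta> =
      (\<Sum>b\<in>onb. \<alpha> (frame A \<phi> b p) * H p (coframe A \<phi> b p) \<beta>)"
    by (rule Sym2_sum[OF H \<beta> coframe_dual_fibre[OF U]])
  then show ?thesis
    by (simp add: coframe_expand[OF U \<alpha>])
qed

lemma Sym2_coframe_smooth: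
  assumes "H \<in> Sym2 A" "(U, \<phi>) \<in> trivs A" "p \<in> U"
  shows "smooth_at A (\<lambda>q. H q (coframe A \<phi> w q) (coframe A \<phi> w' q)) p"
proof -
  have "smooth_map_on A U (\<lambda>q. H q (coframe A \<phi> w q) (coframe A \<phi> w' q))"
    using assms unfolding Sym2_def by fast
  then show ?thesis
    using assms triv_open by (auto intro: smooth_map_on_imp_at)
qed

lemma Sym2_smooth:
  assumes H: "H \<in> Sym2 A" and \<alpha>: "\<alpha> \<in> dual_sections A" and \<beta>: "\<beta> \<in> dual_sections A"
  shows "(\<lambda>q. H q (\<alpha> q) (\<beta> q)) \<in> smooth_functions A"
  unfolding smooth_functions_iff
proof
  fix p
  obtain U \<phi> where U: "(U, \<phi>) \<in> trivs A" "p \<in> U"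
    using triv_ex by blast
  have "smooth_at A (\<lambda>q. \<Sum>b\<in>onb. \<alpha> q (frame A \<phi> b q) * (\<Sum>c\<in>onb. \<beta> q (frame A \<phi> c q) *
      H q (coframe A \<phi> c q) (coframe A \<phi> b q))) p"
    by (intro smooth_at_sum smooth_at_mult dual_sections_smooth[OF \<alpha> U] dual_sections_smooth[OF \<beta> U]
        Sym2_coframe_smooth[OF H U])
  then show "smooth_at A (\<lambda>q. H q (\<alpha> q) (\<beta> q)) p"
  proof (rule smooth_at_cong[OF _ triv_open[OF U(1)] U(2)])
    fix q assume q: "q \<in> U"
    note fib = dual_sections_fibre[OF \<alpha>] dual_sections_fibre[OF \<beta>] coframe_dual_fibre[OF U(1) q]
    show "(\<Sum>b\<in>onb. \<alpha> q (frame A \<phi> b q) * (\<Sum>c\<in>onb. \<beta> q (frame A \<phi> c q) *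
      H q (coframe A \<phi> c q) (coframe A \<phi> b q))) = H q (\<alpha> q) (\<beta> q)"
      by (simp add: Sym2_expand[OF H U(1) q fib(1,2)] Sym2_expand[OF H U(1) q fib(2,3), symmetric]
          Sym2_commute[OF H fib(2,3)])
  qed
qed

lemma
  assumes H: "H \<in> Sym2 A" and \<alpha>: "\<alpha> \<in> dual_fibre A p"
  shows sharp_fibre: "sharp A H p \<alpha> \<in> fibre A p"
    and sharp_eval: "\<beta> \<in> dual_fibre A p \<Longrightarrow> \<beta> (sharp A H p \<alpha>) = H p \<alpha> \<beta>"
proof -
  obtain U \<phi> where U: "(U, \<phi>) \<in> trivs A" "p \<in> U"
    using triv_ex by blast
  \<comment> \<open>Existence for the definite description \<open>sharp\<close> is reflexivity in
    finite dimension: the values of \<open>H p \<alpha>\<close> on the coframe are the frame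
    coordinates of the vector that represents it.\<close>
  define u where "u = (\<Sum>b\<in>onb. H p \<alpha> (coframe A \<phi> b p) *\<^sub>R frame A \<phi> b p)"
  have u: "u \<in> fibre A p"
    unfolding u_def by (intro subspace_sum subspace_scale subspace_fibre frame_fibre[OF U])
  have u_eval: "\<beta> u = H p \<alpha> \<beta>" if \<beta>: "\<beta> \<in> dual_fibre A p" for \<beta>
  proof -
    have "\<beta> u = (\<Sum>b\<in>onb. H p \<alpha> (coframe A \<phi> b p) *\<^sub>R \<beta> (frame A \<phi> b p))"
      unfolding u_def
      by (rule linear_on_subspace_sum[OF subspace_fibre[of p]])
        (simp_all add: dual_fibre_add[OF \<beta>] dual_fibre_scale[OF \<beta>] frame_fibre[OF U])
    also have "\<dots> = H p \<beta> \<alpha>"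
      by (simp add: Sym2_expand[OF H U \<beta> \<alpha>] Sym2_commute[OF H coframe_dual_fibre[OF U] \<alpha>] mult.commute)
    finally show ?thesis
      by (simp add: Sym2_commute[OF H \<alpha> \<beta>])
  qed
  have "\<exists>!u. u \<in> fibre A p \<and> (\<forall>\<beta>\<in>dual_fibre A p. \<beta> u = H p \<alpha> \<beta>)"
  proof (intro ex1I[of _ u])
    fix v assume "v \<in> fibre A p \<and> (\<forall>\<beta>\<in>dual_fibre A p. \<beta> v = H p \<alpha> \<beta>)"
    with u u_eval show "v = u"
      by (metis fibre_eqI)
  qed (simp add: u u_eval)
  from theI'[OF this] show "sharp A H p \<alpha> \<in> fibre A p"
    "\<beta> \<in> dual_fibre A p \<Longrightarrow> \<beta> (sharp A H p \<alpha>) = H p \<alpha> \<beta>"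
    by (auto simp: sharp_def)
qed

lemma sharp_section:
  assumes "H \<in> Sym2 A" "\<alpha> \<in> dual_sections A"
  shows "act (sharp A H) \<alpha> \<in> sections A"
proof (rule sectionsI_pairing)
  show "act (sharp A H) \<alpha> p \<in> fibre A p" for p
    by (simp add: act_def sharp_fibre dual_sections_fibre assms)
  show "pairing \<beta> (act (sharp A H) \<alpha>) \<in> smooth_functions A" if "\<beta> \<in> dual_sections A" for \<beta>
    using Sym2_smooth[OF assms that] assms that
    by (simp add: pairing_def[abs_def] act_def sharp_eval dual_sections_fibre)
qed

lemma sharp_add:
  assumes "H \<in> Sym2 A" "\<alpha> \<in> dual_fibre A p" "\<beta> \<in> dual_fibre A p"
  shows "sharp A H p (\<lambda>u. \<alpha> u + \<beta> u) = sharp A H p \<alpha> + sharp A H p \<beta>"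
  by (rule fibre_eqI[of _ p])
    (use assms in \<open>auto simp: sharp_fibre sharp_eval subspace_add subspace_fibre dual_fibre_add_closed
      dual_fibre_add Sym2_add\<close>)

lemma sharp_scale:
  assumes "H \<in> Sym2 A" "\<alpha> \<in> dual_fibre A p"
  shows "sharp A H p (\<lambda>u. c * \<alpha> u) = c *\<^sub>R sharp A H p \<alpha>"
  by (rule fibre_eqI[of _ p])
    (use assms in \<open>auto simp: sharp_fibre sharp_eval subspace_scale subspace_fibre dual_fibre_scale_closed
      dual_fibre_scale Sym2_scale\<close>)

lemma
  assumes "B \<in> Sym2_dual A" "u \<in> fibre A p" "v \<in> fibre A p"
  shows Sym2_dual_commute: "B p u v = B p v u"
    and Sym2_dual_add: "w \<in> fibre A p \<Longrightarrow> B p (u + v) w = B p u w + B p v w"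
    and Sym2_dual_scale: "B p (c *\<^sub>R u) v = c * B p u v"
  using assms by (auto simp: Sym2_dual_def)

lemma flat_dual_fibre:
  assumes B: "B \<in> Sym2_dual A" and u: "u \<in> fibre A p"
  shows "flat A B p u \<in> dual_fibre A p"
  using B u subspace_add[OF subspace_fibre[of p]] subspace_scale[OF subspace_fibre[of p]]
  by (auto simp: dual_fibre_def flat_def Sym2_dual_add Sym2_dual_scale Sym2_dual_commute[OF B u])

lemma flat_eval: "v \<in> fibre A p \<Longrightarrow> flat A B p u v = B p u v"
  by (simp add: flat_def)

lemma Sym2_dual_smooth:
  assumes B: "B \<in> Sym2_dual A" and x: "x \<in> sections A" and y: "y \<in> sections A"
  shows "(\<lambda>q. B q (x q) (y q)) \<in> smooth_functions A"
  unfolding smooth_functions_iff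
proof
  fix p
  obtain U \<phi> where U: "(U, \<phi>) \<in> trivs A" "p \<in> U"
    using triv_ex by blast
  have "smooth_map_on A U (\<lambda>q. B q (frame A \<phi> w q) (frame A \<phi> w' q))" for w w'
    using B U(1) unfolding Sym2_dual_def by fast
  then have "smooth_at A (\<lambda>q. \<Sum>b\<in>onb. inner b (\<phi> q (y q)) * (\<Sum>c\<in>onb. inner c (\<phi> q (x q)) *
      B q (frame A \<phi> c q) (frame A \<phi> b q))) p"
    by (intro smooth_at_sum smooth_at_mult sections_coord_smooth[OF x U] sections_coord_smooth[OF y U]
        smooth_map_on_imp_at[OF _ triv_open[OF U(1)] U(2)])
  then show "smooth_at A (\<lambda>q. B q (x q) (y q)) p"
  proof (rule smooth_at_cong[OF _ triv_open[OF U(1)] U(2)])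
    fix q assume q: "q \<in> U"
    note fib = sections_fibre[OF x] sections_fibre[OF y] frame_fibre[OF U(1) q]
    have "(\<Sum>c\<in>onb. inner c (\<phi> q (x q)) * B q (frame A \<phi> c q) (frame A \<phi> b q)) =
        B q (x q) (frame A \<phi> b q)" for b
      using fibrewise_linear_expand[OF U(1) q fib(1)[of q], of "\<lambda>u. B q u (frame A \<phi> b q)"]
      by (simp add: fib Sym2_dual_add[OF B] Sym2_dual_scale[OF B])
    moreover have "flat A B q (x q) (y q) =
        (\<Sum>b\<in>onb. inner b (\<phi> q (y q)) * flat A B q (x q) (frame A \<phi> b q))"
      by (intro dual_fibre_expand[OF U(1) q] flat_dual_fibre B fib)
    ultimately show "(\<Sum>b\<in>onb. inner b (\<phi> q (y q)) * (\<Sum>c\<in>onb. inner c (\<phi> q (x q)) *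
      B q (frame A \<phi> c q) (frame A \<phi> b q))) = B q (x q) (y q)"
      by (simp add: flat_eval fib)
  qed
qed

lemma flat_section:
  assumes B: "B \<in> Sym2_dual A" and x: "x \<in> sections A"
  shows "act (flat A B) x \<in> dual_sections A"
proof (rule dual_sectionsI)
  show "act (flat A B) x p \<in> dual_fibre A p" for p
    by (simp add: act_def flat_dual_fibre[OF B] sections_fibre[OF x])
  show "pairing (act (flat A B) x) y \<in> smooth_functions A" if "y \<in> sections A" for y
    using Sym2_dual_smooth[OF assms that] by (simp add: pairing_def[abs_def] act_def flat_eval sections_fibre[OF that])
qed

lemma Sym2_dualI:
  assumes comm: "\<And>p u v. u \<in> fibre A p \<Longrightarrow> v \<in> fibre A p \<Longrightarrow> B p u v = B p v u"
    and add: "\<And>p u v w. u \<in> fibre A p \<Longrightarrow> v \<in> fibre A p \<Longrightarrow> w \<in> fibre A p \<Longrightarrow>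
      B p (u + v) w = B p u w + B p v w"
    and scale: "\<And>p c u v. u \<in> fibre A p \<Longrightarrow> v \<in> fibre A p \<Longrightarrow> B p (c *\<^sub>R u) v = c * B p u v"
    and smooth: "\<And>x y. x \<in> sections A \<Longrightarrow> y \<in> sections A \<Longrightarrow> (\<lambda>q. B q (x q) (y q)) \<in> smooth_functions A"
  shows "B \<in> Sym2_dual A"
proof -
  have "smooth_at A (\<lambda>q. B q (frame A \<phi> w q) (frame A \<phi> w' q)) p"
    if U: "(U, \<phi>) \<in> trivs A" "p \<in> U" for U \<phi> w w' p
  proof -
    obtain f K where f: "f \<in> smooth_functions A" "f p = 1" "closed K" "K \<subseteq> U" "\<And>q. q \<notin> K \<Longrightarrow> f q = 0"
      using bump[OF triv_open[OF U(1)] U(2)] by blast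
    have "smooth_at A (\<lambda>q. B q (f q *\<^sub>R frame A \<phi> w q) (f q *\<^sub>R frame A \<phi> w' q)) p"
      by (intro smooth_functionsD[OF smooth] bump_frame_section[OF U(1) f(1,3-5)])
    \<comment> \<open>Both arguments are multiplied by the bump function, so its square comes out;
      linearity in the second argument is obtained from symmetry.\<close>
    then have "smooth_at A (\<lambda>q. (f q * f q) *\<^sub>R B q (frame A \<phi> w q) (frame A \<phi> w' q)) p"
    proof (rule smooth_at_cong[OF _ triv_open[OF U(1)] U(2)])
      fix q assume q: "q \<in> U"
      note fib = frame_fibre[OF U(1) q] subspace_scale[OF subspace_fibre frame_fibre[OF U(1) q]]
      show "B q (f q *\<^sub>R frame A \<phi> w q) (f q *\<^sub>R frame A \<phi> w' q) =
          (f q * f q) *\<^sub>R B q (frame A \<phi> w q) (frame A \<phi> w' q)"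
        using comm[OF fib(1)[of w] fib(2)[of "f q" w']] comm[OF fib(1)[of w] fib(1)[of w']]
        by (simp add: scale fib)
    qed
    then show ?thesis
      by (rule smooth_at_cancel[of "\<lambda>q. f q * f q", rotated 2])
        (simp_all add: f(2) smooth_at_mult smooth_functionsD[OF f(1)])
  qed
  then show ?thesis
    unfolding Sym2_dual_def using comm add scale
    by (auto intro!: smooth_map_onI)
qed

section \<open>Smoothness of the inverse of a nondegenerate tensor\<close>

text \<open>Gaussian elimination, by induction on the number of columns.  Only injectivity at the point
  \<open>p\<close> itself is needed.\<close>

lemma smooth_at_solution:
  fixes M :: "'i \<Rightarrow> 'j \<Rightarrow> 'm \<Rightarrow> real"
  assumes "finite J" "open W" "p \<in> W"
    and "\<And>i j. i \<in> I \<Longrightarrow> j \<in> J \<Longrightarrow> smooth_at A (M i j) p"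
    and "\<And>i. i \<in> I \<Longrightarrow> smooth_at A (d i) p"
    and "\<And>i q. i \<in> I \<Longrightarrow> q \<in> W \<Longrightarrow> (\<Sum>j\<in>J. M i j q * c j q) = d i q"
    and "\<And>v j. (\<And>i. i \<in> I \<Longrightarrow> (\<Sum>j\<in>J. M i j p * v j) = 0) \<Longrightarrow> j \<in> J \<Longrightarrow> v j = 0"
    and "j \<in> J"
  shows "smooth_at A (c j) p"
  using assms
proof (induction J arbitrary: M d W j rule: finite_induct)
  case (insert k J)
  obtain i\<^sub>0 where i\<^sub>0: "i\<^sub>0 \<in> I" "M i\<^sub>0 k p \<noteq> 0"
  proof (rule ccontr)
    assume "\<not> thesis"
    with that have 0: "M i k p = 0" if "i \<in> I" for i
      using \<open>i \<in> I\<close> by blast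
    \<comment> \<open>Choice of the pivot: if column \<open>k\<close> vanished at \<open>p\<close>,
      the unit vector in direction \<open>k\<close> would lie in the kernel.\<close>
    have "(\<lambda>j. if j = k then 1 else 0 :: real) k = 0"
    proof (rule insert.prems(6)[of "\<lambda>j. if j = k then 1 else 0"])
      fix i assume "i \<in> I"
      have "(\<Sum>j\<in>insert k J. M i j p * (if j = k then 1 else 0)) = (\<Sum>j\<in>insert k J. if j = k then M i k p else 0)"
        by (intro sum.cong) auto
      with insert.hyps 0[OF \<open>i \<in> I\<close>]
      show "(\<Sum>j\<in>insert k J. M i j p * (if j = k then 1 else 0)) = 0" by simp
    qed simp
    then show False by simp
  qed
  have sm0: "smooth_at A (M i\<^sub>0 k) p"
    using insert.prems i\<^sub>0 by blast
  obtain W' where W': "open W'" "p \<in> W'" "\<And>q. q \<in> W' \<Longrightarrow> M i\<^sub>0 k q \<noteq> 0"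
    using smooth_at_nonzero_nbhd[OF sm0 i\<^sub>0(2)] by blast
  \<comment> \<open>Multiple of the pivot row that cancels the entry of row \<open>i\<close> in
    column \<open>k\<close>; this works on \<open>W'\<close>, where the pivot does not
    vanish.\<close>
  define r where "r i q = M i k q * inverse (M i\<^sub>0 k q)" for i q
  have sm_r: "smooth_at A (r i) p" if "i \<in> I" for i
    unfolding r_def using insert.prems(3)[OF that] sm0 i\<^sub>0(2)
    by (intro smooth_at_mult smooth_at_inverse) auto
  have r: "r i q * M i\<^sub>0 k q = M i k q" if "q \<in> W'" for i q
    using W'(3)[OF that] by (simp add: r_def)
  have elim: "(\<Sum>j\<in>J. (M i j q - r i q * M i\<^sub>0 j q) * v j) =
      (\<Sum>j\<in>insert k J. M i j q * v j) - r i q * (\<Sum>j\<in>insert k J. M i\<^sub>0 j q * v j)"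
    if "q \<in> W'" for i q v
    using insert.hyps r[OF that, of i]
    by (simp add: sum_subtractf sum_distrib_left algebra_simps)
  have IH: "smooth_at A (c j) p" if "j \<in> J" for j
  proof (rule insert.IH[of "W \<inter> W'" "\<lambda>i j q. M i j q - r i q * M i\<^sub>0 j q" "\<lambda>i q. d i q - r i q * d i\<^sub>0 q"])
    show "smooth_at A (\<lambda>q. M i j q - r i q * M i\<^sub>0 j q) p" if "i \<in> I" "j \<in> J" for i j
      using that i\<^sub>0 by (intro smooth_at_diff smooth_at_mult sm_r insert.prems(3)) auto
    show "smooth_at A (\<lambda>q. d i q - r i q * d i\<^sub>0 q) p" if "i \<in> I" for i
      using that i\<^sub>0 by (intro smooth_at_diff smooth_at_mult sm_r insert.prems(4)) auto
    show "(\<Sum>j\<in>J. (M i j q - r i q * M i\<^sub>0 j q) * c j q) = d i q - r i q * d i\<^sub>0 q"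
      if "i \<in> I" "q \<in> W \<inter> W'" for i q
      using that i\<^sub>0 elim[of q i "\<lambda>j. c j q"] insert.prems(5) by simp
    show "v j = 0" if v: "\<And>i. i \<in> I \<Longrightarrow> (\<Sum>j\<in>J. (M i j p - r i p * M i\<^sub>0 j p) * v j) = 0" and "j \<in> J" for v j
    proof -
      \<comment> \<open>A kernel vector of the reduced matrix is completed to one of the full matrix
        by solving the pivot row for the entry at \<open>k\<close>, so injectivity at
        \<open>p\<close> passes to the reduced system.\<close>
      define v' where "v' = v(k := - (\<Sum>j\<in>J. M i\<^sub>0 j p * v j) / M i\<^sub>0 k p)"
      have on_J: "(\<Sum>j\<in>J. g j * v' j) = (\<Sum>j\<in>J. g j * v j)" for g
        using insert.hyps by (intro sum.cong) (auto simp: v'_def)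
      have row0: "(\<Sum>j\<in>insert k J. M i\<^sub>0 j p * v' j) = 0"
        using insert.hyps i\<^sub>0 on_J[of "\<lambda>j. M i\<^sub>0 j p"] by (simp add: v'_def)
      have "v' j = 0"
      proof (rule insert.prems(6))
        show "(\<Sum>j\<in>insert k J. M i j p * v' j) = 0" if "i \<in> I" for i
          using elim[OF W'(2), of i v'] v[OF that] row0 on_J by simp
        show "j \<in> insert k J"
          using \<open>j \<in> J\<close> by simp
      qed
      with insert.hyps \<open>j \<in> J\<close> show ?thesis
        by (auto simp: v'_def split: if_splits)
    qed
  qed (use insert.prems W' that in auto)
  \<comment> \<open>Back substitution in the pivot row gives the remaining unknown.\<close>
  have "smooth_at A (\<lambda>q. (d i\<^sub>0 q - (\<Sum>j\<in>J. M i\<^sub>0 j q * c j q)) * inverse (M i\<^sub>0 k q)) p"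
    using i\<^sub>0 insert.prems(3,4)
    by (intro smooth_at_mult smooth_at_diff smooth_at_sum IH smooth_at_inverse) auto
  then have "smooth_at A (c k) p"
  proof (rule smooth_at_cong[of _ _ "W \<inter> W'"])
    fix q assume "q \<in> W \<inter> W'"
    then show "(d i\<^sub>0 q - (\<Sum>j\<in>J. M i\<^sub>0 j q * c j q)) * inverse (M i\<^sub>0 k q) = c k q"
      using insert.prems(5)[OF i\<^sub>0(1), of q, symmetric] W'(3)[of q] insert.hyps by simp
  qed (use insert.prems W' in auto)
  with IH insert.prems(7) show ?case by blast
qed simp

lemma
  assumes H: "H \<in> Sym2 A" and nd: "nondegenerate A H" and u: "u \<in> fibre A p"
  shows sharp_inv_fibre: "sharp_inv A H p u \<in> dual_fibre A p"
    and sharp_sharp_inv: "sharp A H p (sharp_inv A H p u) = u"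
proof -
  have "u \<in> sharp A H p ` dual_fibre A p"
    using nd u by (auto simp: nondegenerate_def bij_betw_def)
  then show "sharp_inv A H p u \<in> dual_fibre A p" "sharp A H p (sharp_inv A H p u) = u"
    by (auto simp: sharp_inv_def inv_into_into f_inv_into_f)
qed

text \<open>In a trivialization the coordinates of the preimage of \<open>z\<close> solve a linear
  system whose coefficients are the smooth entries of \<open>H\<close> and whose right-hand side
  consists of the coordinates of \<open>z\<close>.\<close>

lemma sharp_inv_section:
  assumes H: "H \<in> Sym2 A" and nd: "nondegenerate A H" and z: "z \<in> sections A"
  shows "act (sharp_inv A H) z \<in> dual_sections A"
proof -
  define \<alpha> where "\<alpha> = act (sharp_inv A H) z"
  have \<alpha>: "\<alpha> q \<in> dual_fibre A q" "sharp A H q (\<alpha> q) = z q" for q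
    using sharp_inv_fibre[OF H nd] sharp_sharp_inv[OF H nd] sections_fibre[OF z]
    by (auto simp: \<alpha>_def act_def)
  have "smooth_at A (\<lambda>q. \<alpha> q (frame A \<phi> w q)) p" if U: "(U, \<phi>) \<in> trivs A" "p \<in> U" for U \<phi> w p
  proof -
    have "smooth_at A (\<lambda>q. \<alpha> q (frame A \<phi> b q)) p" if "b \<in> onb" for b
    proof (rule smooth_at_solution[OF finite_onb triv_open[OF U(1)] U(2),
          where I = UNIV and M = "\<lambda>i j q. H q (coframe A \<phi> j q) (coframe A \<phi> i q)"
            and d = "\<lambda>i q. inner i (\<phi> q (z q))" and c = "\<lambda>b q. \<alpha> q (frame A \<phi> b q)"])
      show "smooth_at A (\<lambda>q. H q (coframe A \<phi> j q) (coframe A \<phi> i q)) p" for i j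
        by (rule Sym2_coframe_smooth[OF H U])
      show "smooth_at A (\<lambda>q. inner i (\<phi> q (z q))) p" for i
        by (rule sections_coord_smooth[OF z U])
      fix i q assume q: "q \<in> U"
      have "(\<Sum>j\<in>onb. H q (coframe A \<phi> j q) (coframe A \<phi> i q) * \<alpha> q (frame A \<phi> j q)) =
          H q (\<alpha> q) (coframe A \<phi> i q)"
        by (simp add: Sym2_expand[OF H U(1) q \<alpha>(1) coframe_dual_fibre[OF U(1) q]] mult.commute)
      also have "\<dots> = coframe A \<phi> i q (z q)"
        using sharp_eval[OF H \<alpha>(1)[of q] coframe_dual_fibre[OF U(1) q]] \<alpha>(2)[of q] by simp
      finally show "(\<Sum>j\<in>onb. H q (coframe A \<phi> j q) (coframe A \<phi> i q) * \<alpha> q (frame A \<phi> j q)) =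
          inner i (\<phi> q (z q))"
        by (simp add: coframe_def sections_fibre[OF z])
    next
      fix v :: "'v \<Rightarrow> real" and b :: 'v
      assume v: "\<And>i. i \<in> UNIV \<Longrightarrow> (\<Sum>j\<in>onb. H p (coframe A \<phi> j p) (coframe A \<phi> i p) * v j) = 0"
        and b: "b \<in> onb"
      \<comment> \<open>The functional with coordinates \<open>v\<close>. A kernel vector of the
        matrix makes it a kernel element of H^sharp at \<open>p\<close>, hence 0.\<close>
      define \<gamma> where "\<gamma> = (\<lambda>u. \<Sum>j\<in>onb. v j * coframe A \<phi> j p u)"
      have \<gamma>: "\<gamma> \<in> dual_fibre A p"
        unfolding \<gamma>_def by (intro dual_fibre_sum_closed coframe_dual_fibre[OF U])
      have H\<gamma>: "H p \<gamma> (coframe A \<phi> i p) = 0" for i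
        using v[of i] unfolding \<gamma>_def
        by (subst Sym2_sum[OF H coframe_dual_fibre[OF U] coframe_dual_fibre[OF U]]) (simp add: mult.commute)
      have "H p \<gamma> \<beta> = 0" if "\<beta> \<in> dual_fibre A p" for \<beta>
        using Sym2_expand[OF H U that \<gamma>] H\<gamma> Sym2_commute[OF H \<gamma> that]
          Sym2_commute[OF H \<gamma> coframe_dual_fibre[OF U]] by simp
      then have "sharp A H p \<gamma> = sharp A H p (\<lambda>u. 0)"
        using sharp_scale[OF H \<gamma>, of 0]
        by (intro fibre_eqI[of _ p])
          (auto simp: sharp_fibre[OF H] sharp_eval[OF H] \<gamma> dual_fibre_zero subspace_0[OF subspace_fibre]
            dual_fibre_zero_vec)
      then have "\<gamma> = (\<lambda>u. 0)"
        using nd \<gamma> dual_fibre_zero by (auto simp: nondegenerate_def bij_betw_def inj_on_def)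
      then have "0 = \<gamma> (frame A \<phi> b p)" by simp
      also have "\<dots> = (\<Sum>j\<in>onb. if j = b then v j else 0)"
        unfolding \<gamma>_def using b
        by (intro sum.cong) (auto simp: coframe_def frame_fibre[OF U] triv_frame[OF U] inner_onb)
      finally show "v b = 0"
        using b by (simp add: finite_onb)
    qed (rule that)
    then have "smooth_at A (\<lambda>q. \<Sum>b\<in>onb. inner b w * \<alpha> q (frame A \<phi> b q)) p"
      by (intro smooth_at_sum smooth_at_mult smooth_at_const)
    then show ?thesis
      by (rule smooth_at_cong[OF _ triv_open[OF U(1)] U(2)])
        (simp add: dual_fibre_expand[OF U(1) _ \<alpha>(1) frame_fibre[OF U(1)]] triv_frame[OF U(1)])
  qed
  with \<alpha>(1) have "\<alpha> \<in> dual_sections A"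
    by (auto simp: dual_sections_def intro: smooth_map_onI)
  then show ?thesis
    by (simp add: \<alpha>_def)
qed

section \<open>Tensoriality\<close>

text \<open>A \<open>C\<^sup>\<infinity>\<close>-linear operator depends on the values of the section only: with a bump
  function \<open>f\<close>, the section \<open>f\<^sup>2 y\<close> is a combination of the global sections \<open>f e\<^sub>b\<close>, with
  coefficients that vanish where \<open>y\<close> does.\<close>

lemma tensorial_at:
  fixes F :: "('m \<Rightarrow> 'a) \<Rightarrow> 'm \<Rightarrow> real"
  assumes add: "\<And>y z. y \<in> sections A \<Longrightarrow> z \<in> sections A \<Longrightarrow> F (\<lambda>q. y q + z q) = (\<lambda>q. F y q + F z q)"
    and scale: "\<And>f y. f \<in> smooth_functions A \<Longrightarrow> y \<in> sections A \<Longrightarrow> F (\<lambda>q. f q *\<^sub>R y q) = (\<lambda>q. f q * F y q)"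
    and y: "y \<in> sections A" "y p = 0"
  shows "F y p = 0"
proof -
  obtain U \<phi> where U: "(U, \<phi>) \<in> trivs A" "p \<in> U"
    using triv_ex by blast
  obtain f K where f: "f \<in> smooth_functions A" "f p = 1" "closed K" "K \<subseteq> U" "\<And>q. q \<notin> K \<Longrightarrow> f q = 0"
    using bump[OF triv_open[OF U(1)] U(2)] by blast
  \<comment> \<open>Two factors \<open>f\<close> are spent: one makes the coordinate functions of
    \<open>y\<close> global, the other makes the frame sections global.\<close>
  define g where "g b q = f q * inner b (\<phi> q (y q))" for b q
  define s where "s b q = f q *\<^sub>R frame A \<phi> b q" for b q
  have s: "s b \<in> sections A" for b
    unfolding s_def by (rule bump_frame_section[OF U(1) f(1,3-5)])
  have g: "g b \<in> smooth_functions A" for b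
    unfolding smooth_functions_iff
  proof
    fix q
    show "smooth_at A (g b) q"
    proof (cases "q \<in> U")
      case True
      then show ?thesis
        unfolding g_def by (intro smooth_at_mult smooth_functionsD[OF f(1)] sections_coord_smooth[OF y(1) U(1)])
    next
      case False
      then show ?thesis
        by (intro smooth_at_cong[OF smooth_at_const[of 0], of "- K"]) (use f in \<open>auto simp: g_def\<close>)
    qed
  qed
  have zero: "(\<lambda>q. 0) \<in> sections A"
    using sections_scale[OF y(1) smooth_functions_const[of 0]] by simp
  have F_sum: "(\<lambda>q. \<Sum>b\<in>I. g b q *\<^sub>R s b q) \<in> sections A \<and>
      F (\<lambda>q. \<Sum>b\<in>I. g b q *\<^sub>R s b q) = (\<lambda>q. \<Sum>b\<in>I. g b q * F (s b) q)" if "finite I" for I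
    using that
  proof (induction I)
    case empty
    then show ?case
      using scale[OF smooth_functions_const[of 0] y(1)] zero by simp
  next
    case (insert b I)
    then show ?case
      by (simp add: add scale g s sections_add sections_scale)
  qed
  have "f q *\<^sub>R f q *\<^sub>R y q = (\<Sum>b\<in>onb. g b q *\<^sub>R s b q)" for q
  proof (cases "q \<in> U")
    case True
    have "(\<Sum>b\<in>onb. g b q *\<^sub>R s b q) = f q *\<^sub>R f q *\<^sub>R (\<Sum>b\<in>onb. inner b (\<phi> q (y q)) *\<^sub>R frame A \<phi> b q)"
      by (simp add: g_def s_def scaleR_sum_right algebra_simps)
    then show ?thesis
      by (simp add: fibre_expand[OF U(1) True sections_fibre[OF y(1)]])
  next
    case False
    with f(4) have "f q = 0"
      by (intro f(5)) auto
    then show ?thesis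
      by (simp add: g_def)
  qed
  then have "F (\<lambda>q. f q *\<^sub>R f q *\<^sub>R y q) p = (\<Sum>b\<in>onb. g b p * F (s b) p)"
    using F_sum[OF finite_onb] by simp
  moreover have "g b p = 0" for b
    using triv_scale[OF U, of 0 0] subspace_0[OF subspace_fibre] by (simp add: g_def y(2))
  moreover have "F (\<lambda>q. f q *\<^sub>R f q *\<^sub>R y q) = (\<lambda>q. f q * (f q * F y q))"
    by (simp only: scale f(1) y(1) sections_scale)
  ultimately show ?thesis
    using f(2) by simp
qed

text \<open>Uniqueness is \<open>dual_section_eqI\<close>. For existence, the functional at
  \<open>p\<close> sends u to \<open>F y p\<close> for any global section y with value u at
  \<open>p\<close>; by \<open>tensorial_at\<close>, applied to the difference of two such sections,
  the choice does not matter.\<close>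

lemma dual_section_of_char:
  assumes smooth: "\<And>y. y \<in> sections A \<Longrightarrow> F y \<in> smooth_functions A"
    and add: "\<And>y z. y \<in> sections A \<Longrightarrow> z \<in> sections A \<Longrightarrow> F (\<lambda>q. y q + z q) = (\<lambda>q. F y q + F z q)"
    and scale: "\<And>f y. f \<in> smooth_functions A \<Longrightarrow> y \<in> sections A \<Longrightarrow> F (\<lambda>q. f q *\<^sub>R y q) = (\<lambda>q. f q * F y q)"
  shows "dual_section_of A F \<in> dual_sections A \<and> (\<forall>y\<in>sections A. pairing (dual_section_of A F) y = F y)"
proof -
  define \<gamma> where "\<gamma> p u = (if u \<in> fibre A p then F (SOME y. y \<in> sections A \<and> y p = u) p else 0)" for p u
  have \<gamma>_eq: "\<gamma> p (y p) = F y p" if y: "y \<in> sections A" for y p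
  proof -
    define y' where "y' = (SOME y'. y' \<in> sections A \<and> y' p = y p)"
    have y': "y' \<in> sections A \<and> y' p = y p"
      unfolding y'_def by (rule someI[of _ y]) (use y in simp)
    have "(\<lambda>q. y' q + (-1) *\<^sub>R y q) \<in> sections A"
      using y y' by (intro sections_add sections_scale smooth_functions_const) auto
    then have "F (\<lambda>q. y' q + (-1) *\<^sub>R y q) p = 0"
      using y' by (intro tensorial_at[OF add scale]) auto
    then have "F y' p = F y p"
      using add[of y' "\<lambda>q. (-1) *\<^sub>R y q"] scale[OF smooth_functions_const[of "-1"] y]
        sections_scale[OF y smooth_functions_const[of "-1"]] y' by simp
    then show ?thesis
      by (simp add: \<gamma>_def y'_def sections_fibre[OF y])
  qed
  have "\<gamma> \<in> dual_sections A"
  proof (rule dual_sectionsI)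
    fix p
    have "\<gamma> p (u + v) = \<gamma> p u + \<gamma> p v" if uv: "u \<in> fibre A p" "v \<in> fibre A p" for u v
    proof -
      obtain x y where xy: "x \<in> sections A" "x p = u" "y \<in> sections A" "y p = v"
        using section_ext uv by blast
      then show ?thesis
        using \<gamma>_eq[OF sections_add[OF xy(1,3)], of p] \<gamma>_eq[OF xy(1), of p] \<gamma>_eq[OF xy(3), of p]
        by (simp add: add)
    qed
    moreover have "\<gamma> p (c *\<^sub>R u) = c * \<gamma> p u" if u: "u \<in> fibre A p" for c u
    proof -
      obtain x where x: "x \<in> sections A" "x p = u"
        using section_ext u by blast
      then show ?thesis
        using \<gamma>_eq[OF sections_scale[OF x(1) smooth_functions_const[of c]], of p] \<gamma>_eq[OF x(1), of p]
        by (simp add: scale smooth_functions_const)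
    qed
    ultimately show "\<gamma> p \<in> dual_fibre A p"
      by (auto simp: dual_fibre_def) (simp add: \<gamma>_def)
  next
    fix x assume "x \<in> sections A"
    with smooth \<gamma>_eq show "pairing \<gamma> x \<in> smooth_functions A"
      by (simp add: pairing_def[abs_def])
  qed
  moreover have "\<forall>y\<in>sections A. pairing \<gamma> y = F y"
    using \<gamma>_eq by (simp add: pairing_def[abs_def])
  ultimately have "\<exists>!\<gamma>. \<gamma> \<in> dual_sections A \<and> (\<forall>y\<in>sections A. pairing \<gamma> y = F y)"
    by (intro ex1I[of _ \<gamma>]) (auto intro: dual_section_eqI)
  from theI'[OF this] show ?thesis
    by (simp add: dual_section_of_def)
qed


section \<open>Pairings, dual maps, and the operators built from \<open>H\<close> and
  \<open>B\<close>\<close>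

lemma smooth_functions_add:
  "f \<in> smooth_functions A \<Longrightarrow> g \<in> smooth_functions A \<Longrightarrow> (\<lambda>q. f q + g q) \<in> smooth_functions A"
  by (simp add: smooth_functions_iff smooth_at_add)

lemma smooth_functions_diff:
  "f \<in> smooth_functions A \<Longrightarrow> g \<in> smooth_functions A \<Longrightarrow> (\<lambda>q. f q - g q) \<in> smooth_functions A"
  by (simp add: smooth_functions_iff smooth_at_diff)

lemma smooth_functions_mult:
  "f \<in> smooth_functions A \<Longrightarrow> g \<in> smooth_functions A \<Longrightarrow> (\<lambda>q. f q * g q) \<in> smooth_functions A"
  by (simp add: smooth_functions_iff smooth_at_mult)

lemma pairing_add:
  "\<alpha> \<in> dual_sections A \<Longrightarrow> x \<in> sections A \<Longrightarrow> y \<in> sections A \<Longrightarrow>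
    pairing \<alpha> (\<lambda>q. x q + y q) = (\<lambda>q. pairing \<alpha> x q + pairing \<alpha> y q)"
  by (simp add: pairing_def fun_eq_iff dual_fibre_add[OF dual_sections_fibre] sections_fibre)

lemma pairing_scale:
  "\<alpha> \<in> dual_sections A \<Longrightarrow> x \<in> sections A \<Longrightarrow>
    pairing \<alpha> (\<lambda>q. f q *\<^sub>R x q) = (\<lambda>q. f q * pairing \<alpha> x q)"
  by (simp add: pairing_def fun_eq_iff dual_fibre_scale[OF dual_sections_fibre] sections_fibre)

lemma dual_sections_add:
  assumes "\<alpha> \<in> dual_sections A" "\<beta> \<in> dual_sections A"
  shows "(\<lambda>p u. \<alpha> p u + \<beta> p u) \<in> dual_sections A"
  using assms smooth_functions_add[OF pairing_smooth[OF assms(1)] pairing_smooth[OF assms(2)]]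
  by (intro dual_sectionsI) (simp_all add: pairing_def[abs_def] dual_sections_fibre dual_fibre_add_closed)

lemma dual_sections_uminus:
  assumes "\<alpha> \<in> dual_sections A"
  shows "(\<lambda>p u. (-1) * \<alpha> p u) \<in> dual_sections A"
proof (rule dual_sectionsI)
  show "(\<lambda>u. (-1) * \<alpha> p u) \<in> dual_fibre A p" for p
    by (intro dual_fibre_scale_closed dual_sections_fibre assms)
  show "pairing (\<lambda>p u. (-1) * \<alpha> p u) x \<in> smooth_functions A" if "x \<in> sections A" for x
    using smooth_functions_mult[OF smooth_functions_const[of "-1"] pairing_smooth[OF assms that]]
    by (simp add: pairing_def[abs_def])
qed

lemma dual_sections_diff:
  assumes "\<alpha> \<in> dual_sections A" "\<beta> \<in> dual_sections A"
  shows "(\<lambda>p u. \<alpha> p u - \<beta> p u) \<in> dual_sections A"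
  using dual_sections_add[OF assms(1) dual_sections_uminus[OF assms(2)]] by simp

lemma dual_map_fibre:
  assumes N: "bundle_endomorphism A N" and \<alpha>: "\<alpha> \<in> dual_fibre A p"
  shows "dual_map A N p \<alpha> \<in> dual_fibre A p"
  using subspace_add[OF subspace_fibre[of p]] subspace_scale[OF subspace_fibre[of p]]
  by (auto simp: dual_fibre_def dual_map_def endo_add[OF N] endo_scale[OF N] endo_fibre[OF N]
      dual_fibre_add[OF \<alpha>] dual_fibre_scale[OF \<alpha>])

lemma dual_map_section:
  assumes N: "bundle_endomorphism A N" and \<alpha>: "\<alpha> \<in> dual_sections A"
  shows "act (dual_map A N) \<alpha> \<in> dual_sections A"
proof (rule dual_sectionsI)
  show "act (dual_map A N) \<alpha> p \<in> dual_fibre A p" for p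
    by (simp add: act_def dual_map_fibre[OF N] dual_sections_fibre[OF \<alpha>])
  show "pairing (act (dual_map A N) \<alpha>) x \<in> smooth_functions A" if "x \<in> sections A" for x
    using pairing_smooth[OF \<alpha> endo_section[OF N that]]
    by (simp add: pairing_def[abs_def] act_def dual_map_def sections_fibre[OF that])
qed

lemma pairing_dual_map:
  "x \<in> sections A \<Longrightarrow> pairing (act (dual_map A N) \<alpha>) x = pairing \<alpha> (act N x)"
  by (simp add: pairing_def[abs_def] act_def dual_map_def sections_fibre)

lemma pairing_flat:
  "y \<in> sections A \<Longrightarrow> pairing (act (flat A B) x) y = (\<lambda>q. B q (x q) (y q))"
  by (simp add: pairing_def[abs_def] act_def flat_eval sections_fibre)

lemma pairing_sharp:
  "H \<in> Sym2 A \<Longrightarrow> \<alpha> \<in> dual_sections A \<Longrightarrow> \<beta> \<in> dual_sections A \<Longrightarrow>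
    pairing \<beta> (act (sharp A H) \<alpha>) = (\<lambda>q. H q (\<alpha> q) (\<beta> q))"
  by (simp add: pairing_def[abs_def] act_def sharp_eval dual_sections_fibre)

lemma sharp_flat_endomorphism:
  assumes H: "H \<in> Sym2 A" and B: "B \<in> Sym2_dual A"
  shows "bundle_endomorphism A (sharp_flat A H B)"
proof (rule bundle_endomorphismI)
  note flat = flat_dual_fibre[OF B]
  show "sharp_flat A H B p u \<in> fibre A p" if "u \<in> fibre A p" for p u
    using that by (simp add: sharp_flat_def sharp_fibre[OF H] flat)
  show "sharp_flat A H B p (u + v) = sharp_flat A H B p u + sharp_flat A H B p v"
    if "u \<in> fibre A p" "v \<in> fibre A p" for p u v
  proof -
    have "flat A B p (u + v) = (\<lambda>w. flat A B p u w + flat A B p v w)"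
      using that by (simp add: fun_eq_iff flat_def Sym2_dual_add[OF B])
    with that show ?thesis
      by (simp add: sharp_flat_def sharp_add[OF H] flat)
  qed
  show "sharp_flat A H B p (c *\<^sub>R u) = c *\<^sub>R sharp_flat A H B p u" if "u \<in> fibre A p" for p c u
  proof -
    have "flat A B p (c *\<^sub>R u) = (\<lambda>w. c * flat A B p u w)"
      using that by (simp add: fun_eq_iff flat_def Sym2_dual_scale[OF B])
    with that show ?thesis
      by (simp add: sharp_flat_def sharp_scale[OF H] flat)
  qed
  show "act (sharp_flat A H B) x \<in> sections A" if "x \<in> sections A" for x
    using sharp_section[OF H flat_section[OF B that]] by (simp add: act_def[abs_def] sharp_flat_def)
qed

text \<open>Symmetry of \<open>B\<close> is the compatibility of \<open>N\<close> with H^sharp in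
  disguise: for u = H^sharp alpha and v = H^sharp beta one has B(v,u) = beta(N u) = H(N^* alpha,
  beta), and this is B(u,v) because H is symmetric. Smoothness rests on
  \<open>sharp_inv_section\<close>.\<close>

lemma sharp_inv_form:
  assumes H: "H \<in> Sym2 A" and nd: "nondegenerate A H" and N: "bundle_endomorphism A N"
    and NH: "\<And>p \<alpha>. \<alpha> \<in> dual_fibre A p \<Longrightarrow> N p (sharp A H p \<alpha>) = sharp A H p (dual_map A N p \<alpha>)"
    and flat: "\<And>p u. u \<in> fibre A p \<Longrightarrow> flat A B p u = sharp_inv A H p (N p u)"
  shows "B \<in> Sym2_dual A"
proof -
  have B_eq: "B p u v = sharp_inv A H p (N p u) v" if "u \<in> fibre A p" "v \<in> fibre A p" for p u v
    using flat[OF that(1)] that(2) by (metis flat_eval)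
  have inv_N: "sharp_inv A H p (N p u) \<in> dual_fibre A p" if "u \<in> fibre A p" for p u
    using that by (intro sharp_inv_fibre[OF H nd] endo_fibre[OF N])
  have comm: "B p u v = B p v u" if u: "u \<in> fibre A p" and v: "v \<in> fibre A p" for p u v
  proof -
    define \<alpha> \<beta> where "\<alpha> = sharp_inv A H p u" and "\<beta> = sharp_inv A H p v"
    have fib: "\<alpha> \<in> dual_fibre A p" "\<beta> \<in> dual_fibre A p" and h: "sharp A H p \<alpha> = u" "sharp A H p \<beta> = v"
      using u v by (simp_all add: \<alpha>_def \<beta>_def sharp_inv_fibre[OF H nd] sharp_sharp_inv[OF H nd])
    have inv: "sharp_inv A H p (N p (sharp A H p \<gamma>)) = dual_map A N p \<gamma>" if "\<gamma> \<in> dual_fibre A p" for \<gamma>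
      using nd that dual_map_fibre[OF N that]
      by (simp add: NH sharp_inv_def nondegenerate_def bij_betw_def inv_into_f_f)
    have eval: "B p (sharp A H p \<gamma>) (sharp A H p \<delta>) = H p \<delta> (dual_map A N p \<gamma>)"
      if "\<gamma> \<in> dual_fibre A p" "\<delta> \<in> dual_fibre A p" for \<gamma> \<delta>
      using that by (simp add: B_eq inv sharp_fibre[OF H] sharp_eval[OF H] dual_map_fibre[OF N])
    have "B p v u = \<beta> (N p u)"
      using inv[OF fib(2)] u v by (simp add: B_eq h dual_map_def)
    also have "\<dots> = H p (dual_map A N p \<alpha>) \<beta>"
      using NH[OF fib(1)] sharp_eval[OF H dual_map_fibre[OF N fib(1)] fib(2)] by (simp add: h)
    also have "\<dots> = B p u v"
      using eval[OF fib] by (simp add: h Sym2_commute[OF H fib(2) dual_map_fibre[OF N fib(1)]])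
    finally show ?thesis ..
  qed
  show ?thesis
  proof (rule Sym2_dualI)
    show "B p (u + v) w = B p u w + B p v w"
      if "u \<in> fibre A p" "v \<in> fibre A p" "w \<in> fibre A p" for p u v w
    proof -
      \<comment> \<open>Linearity is immediate in the second argument, where \<open>B\<close> is a
        dual vector; symmetry carries it to the first.\<close>
      have "B p w (u + v) = B p w u + B p w v"
        using that by (simp add: B_eq subspace_add[OF subspace_fibre] dual_fibre_add[OF inv_N])
      then show ?thesis
        using comm[OF _ that(3)] that subspace_add[OF subspace_fibre that(1,2)] by simp
    qed
    show "B p (c *\<^sub>R u) v = c * B p u v" if "u \<in> fibre A p" "v \<in> fibre A p" for p c u v
    proof -
      have "B p v (c *\<^sub>R u) = c * B p v u"
        using that by (simp add: B_eq subspace_scale[OF subspace_fibre] dual_fibre_scale[OF inv_N])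
      then show ?thesis
        using comm[OF _ that(2)] that subspace_scale[OF subspace_fibre that(1)] by simp
    qed
    show "(\<lambda>q. B q (x q) (y q)) \<in> smooth_functions A" if "x \<in> sections A" "y \<in> sections A" for x y
      using pairing_smooth[OF sharp_inv_section[OF H nd endo_section[OF N that(1)]] that(2)] that
      by (simp add: pairing_def[abs_def] act_def B_eq sections_fibre)
  qed (rule comm)
qed

end

section \<open>Algebroids without left-symmetry\<close>

text \<open>These axioms, unlike left-symmetry, pass to the deformed product of every bundle
  endomorphism, Nijenhuis or not.\<close>

locale pre_algebroid = smooth_bundle A
  for A :: "('m::{t2_space,second_countable_topology},'e::finite_dim_inner,'a::real_vector,
    'v::finite_dim_inner,'z) algebroid_scheme" +
  assumes anchor_smooth: "x \<in> sections A \<Longrightarrow> f \<in> smooth_functions A \<Longrightarrow> anchor_deriv A x f \<in> smooth_functions A"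
    and anchor_fun_add: "x \<in> sections A \<Longrightarrow> f \<in> smooth_functions A \<Longrightarrow> g \<in> smooth_functions A \<Longrightarrow>
      anchor_deriv A x (\<lambda>q. f q + g q) p = anchor_deriv A x f p + anchor_deriv A x g p"
    and anchor_fun_mult: "x \<in> sections A \<Longrightarrow> f \<in> smooth_functions A \<Longrightarrow> g \<in> smooth_functions A \<Longrightarrow>
      anchor_deriv A x (\<lambda>q. f q * g q) p = f p * anchor_deriv A x g p + g p * anchor_deriv A x f p"
    and anchor_sec_add: "x \<in> sections A \<Longrightarrow> y \<in> sections A \<Longrightarrow>
      anchor_deriv A (\<lambda>q. x q + y q) f p = anchor_deriv A x f p + anchor_deriv A y f p"
    and anchor_sec_scale: "x \<in> sections A \<Longrightarrow> 
      anchor_deriv A (\<lambda>q. g q *\<^sub>R x q) f p = g p * anchor_deriv A x f p"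
    and sprod_closed: "x \<in> sections A \<Longrightarrow> y \<in> sections A \<Longrightarrow> sprod A x y \<in> sections A"
    and sprod_add_left: "x \<in> sections A \<Longrightarrow> y \<in> sections A \<Longrightarrow> z \<in> sections A \<Longrightarrow>
      sprod A (\<lambda>q. x q + y q) z = (\<lambda>p. sprod A x z p + sprod A y z p)"
    and sprod_add_right: "x \<in> sections A \<Longrightarrow> y \<in> sections A \<Longrightarrow> z \<in> sections A \<Longrightarrow>
      sprod A z (\<lambda>q. x q + y q) = (\<lambda>p. sprod A z x p + sprod A z y p)"
    and sprod_scale_left: "x \<in> sections A \<Longrightarrow> y \<in> sections A \<Longrightarrow> f \<in> smooth_functions A \<Longrightarrow>
      sprod A (\<lambda>q. f q *\<^sub>R x q) y = (\<lambda>p. f p *\<^sub>R sprod A x y p)"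
    and sprod_scale_right: "x \<in> sections A \<Longrightarrow> y \<in> sections A \<Longrightarrow> f \<in> smooth_functions A \<Longrightarrow>
      sprod A x (\<lambda>q. f q *\<^sub>R y q) = (\<lambda>p. f p *\<^sub>R sprod A x y p + anchor_deriv A x f p *\<^sub>R y p)"
begin

lemma bracket_closed: "x \<in> sections A \<Longrightarrow> y \<in> sections A \<Longrightarrow> bracket A x y \<in> sections A"
  unfolding bracket_def[abs_def] by (intro sections_diff sprod_closed)

lemma pairing_bracket:
  "\<alpha> \<in> dual_sections A \<Longrightarrow> x \<in> sections A \<Longrightarrow> y \<in> sections A \<Longrightarrow>
    pairing \<alpha> (bracket A x y) p = pairing \<alpha> (sprod A x y) p - pairing \<alpha> (sprod A y x) p"
  by (simp add: pairing_def bracket_def dual_fibre_diff[OF dual_sections_fibre] sections_fibre sprod_closed)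

text \<open>Linearity over smooth functions: replacing y by f y, differentiating the pairing
  produces the extra term a(x)(f) <alpha, y>, and the Leibniz rule of the bracket produces the same
  term, which is subtracted.\<close>

lemma Lie_deriv_char:
  assumes x: "x \<in> sections A" and \<alpha>: "\<alpha> \<in> dual_sections A"
  shows "Lie_deriv A x \<alpha> \<in> dual_sections A \<and> (\<forall>y\<in>sections A. pairing (Lie_deriv A x \<alpha>) y =
    (\<lambda>p. anchor_deriv A x (pairing \<alpha> y) p - pairing \<alpha> (bracket A x y) p))"
  unfolding Lie_deriv_def
proof (rule dual_section_of_char)
  fix y assume y: "y \<in> sections A"
  show "(\<lambda>p. anchor_deriv A x (pairing \<alpha> y) p - pairing \<alpha> (bracket A x y) p) \<in> smooth_functions A"
    by (intro smooth_functions_diff anchor_smooth pairing_smooth bracket_closed x y \<alpha>)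
  show "(\<lambda>p. anchor_deriv A x (pairing \<alpha> (\<lambda>q. y q + z q)) p - pairing \<alpha> (bracket A x (\<lambda>q. y q + z q)) p) =
      (\<lambda>q. anchor_deriv A x (pairing \<alpha> y) q - pairing \<alpha> (bracket A x y) q +
        (anchor_deriv A x (pairing \<alpha> z) q - pairing \<alpha> (bracket A x z) q))" if z: "z \<in> sections A" for z
    by (simp add: fun_eq_iff pairing_add pairing_bracket sections_add sprod_add_left sprod_add_right
        sprod_closed x y z \<alpha> anchor_fun_add pairing_smooth)
  show "(\<lambda>p. anchor_deriv A x (pairing \<alpha> (\<lambda>q. f q *\<^sub>R y q)) p - pairing \<alpha> (bracket A x (\<lambda>q. f q *\<^sub>R y q)) p) =
      (\<lambda>q. f q * (anchor_deriv A x (pairing \<alpha> y) q - pairing \<alpha> (bracket A x y) q))"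
    if f: "f \<in> smooth_functions A" for f
    by (simp add: fun_eq_iff pairing_add pairing_scale pairing_bracket sections_scale sprod_scale_left
        sprod_scale_right sprod_closed x y f \<alpha> anchor_fun_mult anchor_smooth pairing_smooth algebra_simps)
qed

lemma R_dual_char:
  assumes x: "x \<in> sections A" and \<alpha>: "\<alpha> \<in> dual_sections A"
  shows "R_dual A x \<alpha> \<in> dual_sections A \<and> (\<forall>y\<in>sections A. pairing (R_dual A x \<alpha>) y =
    (\<lambda>p. - pairing \<alpha> (sprod A y x) p))"
  unfolding R_dual_def
proof (rule dual_section_of_char)
  fix y assume y: "y \<in> sections A"
  show "(\<lambda>p. - pairing \<alpha> (sprod A y x) p) \<in> smooth_functions A"
    using smooth_functions_diff[OF smooth_functions_const[of 0] pairing_smooth[OF \<alpha> sprod_closed[OF y x]]]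
    by simp
  show "(\<lambda>p. - pairing \<alpha> (sprod A (\<lambda>q. y q + z q) x) p) =
      (\<lambda>q. - pairing \<alpha> (sprod A y x) q + - pairing \<alpha> (sprod A z x) q)" if "z \<in> sections A" for z
    by (simp add: fun_eq_iff pairing_add sprod_add_left sprod_closed x y that \<alpha>)
  show "(\<lambda>p. - pairing \<alpha> (sprod A (\<lambda>q. f q *\<^sub>R y q) x) p) = (\<lambda>q. f q * - pairing \<alpha> (sprod A y x) q)"
    if "f \<in> smooth_functions A" for f
    by (simp add: fun_eq_iff pairing_scale sprod_scale_left sprod_closed x y that \<alpha>)
qed

lemma d_fun_char:
  assumes f: "f \<in> smooth_functions A"
  shows "d_fun A f \<in> dual_sections A \<and> (\<forall>y\<in>sections A. pairing (d_fun A f) y = anchor_deriv A y f)"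
  unfolding d_fun_def
  by (rule dual_section_of_char) (simp_all add: fun_eq_iff anchor_smooth anchor_sec_add anchor_sec_scale f)

lemma
  assumes H: "H \<in> Sym2 A" and \<alpha>: "\<alpha> \<in> dual_sections A" and \<beta>: "\<beta> \<in> dual_sections A"
  shows dual_prod_section: "dual_prod A H \<alpha> \<beta> \<in> dual_sections A"
    and dual_prod_eval: "y \<in> sections A \<Longrightarrow> pairing (dual_prod A H \<alpha> \<beta>) y p =
      anchor_deriv A (act (sharp A H) \<alpha>) (pairing \<beta> y) p
      - pairing \<beta> (sprod A (act (sharp A H) \<alpha>) y) p + pairing \<beta> (sprod A y (act (sharp A H) \<alpha>)) p
      + pairing \<alpha> (sprod A y (act (sharp A H) \<beta>)) p - anchor_deriv A y (\<lambda>q. H q (\<alpha> q) (\<beta> q)) p"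
proof -
  note h = sharp_section[OF H \<alpha>] sharp_section[OF H \<beta>]
  note chars = Lie_deriv_char[OF h(1) \<beta>] R_dual_char[OF h(2) \<alpha>] d_fun_char[OF Sym2_smooth[OF H \<alpha> \<beta>]]
  show "dual_prod A H \<alpha> \<beta> \<in> dual_sections A"
    unfolding dual_prod_def[abs_def] using chars by (intro dual_sections_diff) auto
  assume y: "y \<in> sections A"
  have "pairing (dual_prod A H \<alpha> \<beta>) y p = pairing (Lie_deriv A (act (sharp A H) \<alpha>) \<beta>) y p
      - pairing (R_dual A (act (sharp A H) \<beta>) \<alpha>) y p - pairing (d_fun A (\<lambda>q. H q (\<alpha> q) (\<beta> q))) y p"
    by (simp add: pairing_def dual_prod_def)
  also have "\<dots> = anchor_deriv A (act (sharp A H) \<alpha>) (pairing \<beta> y) p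
      - pairing \<beta> (bracket A (act (sharp A H) \<alpha>) y) p
      + pairing \<alpha> (sprod A y (act (sharp A H) \<beta>)) p - anchor_deriv A y (\<lambda>q. H q (\<alpha> q) (\<beta> q)) p"
    using chars y by simp
  finally show "pairing (dual_prod A H \<alpha> \<beta>) y p =
      anchor_deriv A (act (sharp A H) \<alpha>) (pairing \<beta> y) p
      - pairing \<beta> (sprod A (act (sharp A H) \<alpha>) y) p + pairing \<beta> (sprod A y (act (sharp A H) \<alpha>)) p
      + pairing \<alpha> (sprod A y (act (sharp A H) \<beta>)) p - anchor_deriv A y (\<lambda>q. H q (\<alpha> q) (\<beta> q)) p"
    by (simp add: pairing_bracket \<beta> h y)
qed

text \<open>With gamma in the second slot, all terms but one contain H^sharp gamma as an argument,
  and these add up to the dual product evaluated on it; the remaining one is the pairing with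
  gamma.\<close>

lemma KV_bracket_eq:
  assumes H: "H \<in> Sym2 A" and \<alpha>: "\<alpha> \<in> dual_sections A" and \<beta>: "\<beta> \<in> dual_sections A"
    and \<gamma>: "\<gamma> \<in> dual_sections A"
  shows "KV_bracket A H \<alpha> \<gamma> \<beta> p = pairing (dual_prod A H \<alpha> \<beta>) (act (sharp A H) \<gamma>) p
    - pairing \<gamma> (sprod A (act (sharp A H) \<alpha>) (act (sharp A H) \<beta>)) p"
  by (simp add: KV_bracket_def Let_def dual_prod_eval[OF H \<alpha> \<beta> sharp_section[OF H \<gamma>]]
      pairing_bracket[OF \<beta> sharp_section[OF H \<alpha>] sharp_section[OF H \<gamma>]] pairing_sharp[OF H \<alpha> \<beta>])

lemma sharp_dual_prod:
  assumes KV: "Koszul_Vinberg A H" and \<alpha>: "\<alpha> \<in> dual_sections A" and \<beta>: "\<beta> \<in> dual_sections A"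
  shows "act (sharp A H) (dual_prod A H \<alpha> \<beta>) = sprod A (act (sharp A H) \<alpha>) (act (sharp A H) \<beta>)"
proof (rule section_eqI)
  have H: "H \<in> Sym2 A"
    using KV by (simp add: Koszul_Vinberg_def)
  show "act (sharp A H) (dual_prod A H \<alpha> \<beta>) \<in> sections A"
    "sprod A (act (sharp A H) \<alpha>) (act (sharp A H) \<beta>) \<in> sections A"
    by (intro sharp_section sprod_closed dual_prod_section H \<alpha> \<beta>)+
  fix \<gamma> p assume \<gamma>: "\<gamma> \<in> dual_sections A"
  \<comment> \<open>Symmetry of \<open>H\<close> moves H^sharp from the product onto gamma, which
    brings the pairing into the form of \<open>KV_bracket_eq\<close>.\<close>
  have "pairing \<gamma> (act (sharp A H) (dual_prod A H \<alpha> \<beta>)) p = pairing (dual_prod A H \<alpha> \<beta>) (act (sharp A H) \<gamma>) p"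
    using dual_prod_section[OF H \<alpha> \<beta>] \<gamma>
    by (simp add: pairing_sharp[OF H] Sym2_commute[OF H] dual_sections_fibre)
  also have "\<dots> = pairing \<gamma> (sprod A (act (sharp A H) \<alpha>) (act (sharp A H) \<beta>)) p"
    using KV KV_bracket_eq[OF H \<alpha> \<beta> \<gamma>, of p] \<alpha> \<beta> \<gamma> by (simp add: Koszul_Vinberg_def)
  finally show "pairing \<gamma> (act (sharp A H) (dual_prod A H \<alpha> \<beta>)) p =
    pairing \<gamma> (sprod A (act (sharp A H) \<alpha>) (act (sharp A H) \<beta>)) p" .
qed

end

text \<open>The anchor is given fibre by fibre and its smoothness only on local frames; expanding a
  global section in a frame shows that it maps smooth functions to smooth functions.\<close>

lemma left_symmetric_algebroid_imp_pre_algebroid: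
  fixes A :: "('m::{t2_space,second_countable_topology},'e::finite_dim_inner,'a::real_vector,
    'v::finite_dim_inner,'z) algebroid_scheme"
  assumes "left_symmetric_algebroid A"
  shows "pre_algebroid A"
proof -
  note A = assms[unfolded left_symmetric_algebroid_def]
  interpret smooth_bundle A
    by standard (use A in blast)
  have bm: "bundle_map_to_tangent A (anchor A)"
    using A by blast
  have tangent: "anchor A p u \<in> tangent_space A p" if "u \<in> fibre A p" for p u
    using bm that by (simp add: bundle_map_to_tangent_def)
  have lin: "v \<in> fibre A p \<Longrightarrow> anchor A p (u + v) f = anchor A p u f + anchor A p v f"
    "anchor A p (c *\<^sub>R u) f = c * anchor A p u f" if "u \<in> fibre A p" for p u v c f
    using bm that by (simp_all add: bundle_map_to_tangent_def)
  show ?thesis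
  proof unfold_locales
    fix x f assume x: "x \<in> sections A" and f: "f \<in> smooth_functions A"
    show "anchor_deriv A x f \<in> smooth_functions A"
      unfolding smooth_functions_iff
    proof
      fix p
      obtain U \<phi> where U: "(U, \<phi>) \<in> trivs A" "p \<in> U"
        using triv_ex by blast
      have "smooth_map_on A U (\<lambda>p. anchor A p (frame A \<phi> w p) f)" for w
        using bm U(1) f unfolding bundle_map_to_tangent_def by fast
      then have "smooth_at A (\<lambda>q. \<Sum>b\<in>onb. inner b (\<phi> q (x q)) *\<^sub>R anchor A q (frame A \<phi> b q) f) p"
        by (intro smooth_at_sum smooth_at_scaleR sections_coord_smooth[OF x U]
            smooth_map_on_imp_at[OF _ triv_open[OF U(1)] U(2)])
      then show "smooth_at A (anchor_deriv A x f) p"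
      proof (rule smooth_at_cong[OF _ triv_open[OF U(1)] U(2)])
        fix q assume q: "q \<in> U"
        show "(\<Sum>b\<in>onb. inner b (\<phi> q (x q)) *\<^sub>R anchor A q (frame A \<phi> b q) f) = anchor_deriv A x f q"
          using fibrewise_linear_expand[OF U(1) q sections_fibre[OF x], of "\<lambda>u. anchor A q u f"]
          by (simp add: lin anchor_deriv_def)
      qed
    qed
  next
    fix x f g p assume "x \<in> sections A" "f \<in> smooth_functions A" "g \<in> smooth_functions A"
    then show "anchor_deriv A x (\<lambda>q. f q + g q) p = anchor_deriv A x f p + anchor_deriv A x g p"
      "anchor_deriv A x (\<lambda>q. f q * g q) p = f p * anchor_deriv A x g p + g p * anchor_deriv A x f p"
      using tangent[OF sections_fibre[of x p]] by (auto simp: tangent_space_def anchor_deriv_def)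
  qed (use A in \<open>simp_all add: anchor_deriv_def lin sections_fibre\<close>)
qed

section \<open>The deformed algebroid; only the product and the anchor change, not the underlying
  bundle\<close>

lemma
  shows fibre_deformed [simp]: "fibre (deformed A N) = fibre A"
    and trivs_deformed [simp]: "trivs (deformed A N) = trivs A"
    and atlas_deformed [simp]: "atlas (deformed A N) = atlas A"
    and frame_deformed [simp]: "frame (deformed A N) = frame A"
    and coframe_deformed [simp]: "coframe (deformed A N) = coframe A"
    and dual_fibre_deformed [simp]: "dual_fibre (deformed A N) = dual_fibre A"
    and sharp_deformed [simp]: "sharp (deformed A N) = sharp A"
    and smooth_map_on_deformed [simp]: "smooth_map_on (deformed A N) = smooth_map_on A"
    and smooth_functions_deformed [simp]: "smooth_functions (deformed A N) = smooth_functions A"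
    and sections_deformed [simp]: "sections (deformed A N) = sections A"
    and dual_sections_deformed [simp]: "dual_sections (deformed A N) = dual_sections A"
    and Sym2_deformed [simp]: "Sym2 (deformed A N) = Sym2 A"
    and vector_bundle_deformed [simp]: "vector_bundle (deformed A N) = vector_bundle A"
proof -
  show [simp]: "fibre (deformed A N) = fibre A" "trivs (deformed A N) = trivs A"
    "atlas (deformed A N) = atlas A"
    by (simp_all add: deformed_def)
  show [simp]: "frame (deformed A N) = frame A" "coframe (deformed A N) = coframe A"
    "dual_fibre (deformed A N) = dual_fibre A"
    by (simp_all add: fun_eq_iff frame_def coframe_def dual_fibre_def)
  show [simp]: "sharp (deformed A N) = sharp A"
    by (simp add: fun_eq_iff sharp_def)
  show [simp]: "smooth_map_on (deformed A N) = smooth_map_on A"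
    by (simp add: fun_eq_iff smooth_map_on_def)
  show "smooth_functions (deformed A N) = smooth_functions A" "sections (deformed A N) = sections A"
    "dual_sections (deformed A N) = dual_sections A" "Sym2 (deformed A N) = Sym2 A"
    "vector_bundle (deformed A N) = vector_bundle A"
    by (simp_all add: smooth_functions_def sections_def dual_sections_def Sym2_def vector_bundle_def)
qed

lemma anchor_deriv_deformed [simp]: "anchor_deriv (deformed A N) x = anchor_deriv A (act N x)"
  by (simp add: fun_eq_iff anchor_deriv_def deformed_def act_def)

lemma sprod_deformed:
  "sprod (deformed A N) x y = (\<lambda>p. sprod A (act N x) y p + sprod A x (act N y) p - act N (sprod A x y) p)"
  by (simp add: deformed_def)

context pre_algebroid
begin

text \<open>In the right Leibniz rule the terms a(x)(f) N y coming from x . (f N y) and from N(x .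
  (f y)) cancel. What survives is a(N x)(f) y, the rule for the deformed anchor. No identity for
  products of the form N x . N y enters.\<close>

lemma pre_algebroid_deformed:
  assumes N: "bundle_endomorphism A N"
  shows "pre_algebroid (deformed A N)"
proof -
  have act_add: "act N (\<lambda>q. x q + y q) = (\<lambda>q. act N x q + act N y q)"
    if "x \<in> sections A" "y \<in> sections A" for x y
    using that by (simp add: fun_eq_iff act_def endo_add[OF N] sections_fibre)
  have act_scale: "act N (\<lambda>q. f q *\<^sub>R x q) = (\<lambda>q. f q *\<^sub>R act N x q)" if "x \<in> sections A" for f x
    using that by (simp add: fun_eq_iff act_def endo_scale[OF N] sections_fibre)
  show ?thesis
  proof (unfold_locales, simp_all only: vector_bundle_deformed sections_deformed smooth_functions_deformed
      anchor_deriv_deformed sprod_deformed)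
    show "vector_bundle A" by (rule vector_bundle)
    show "x \<in> sections A \<Longrightarrow> y \<in> sections A \<Longrightarrow>
       (\<lambda>p. sprod A (act N x) y p + sprod A x (act N y) p - act N (sprod A x y) p) \<in> sections A" for x y
      by (intro sections_add sections_diff sprod_closed endo_section[OF N])
    show "x \<in> sections A \<Longrightarrow> y \<in> sections A \<Longrightarrow> f \<in> smooth_functions A \<Longrightarrow>
       (\<lambda>p. sprod A (act N x) (\<lambda>q. f q *\<^sub>R y q) p + sprod A x (act N (\<lambda>q. f q *\<^sub>R y q)) p -
             act N (sprod A x (\<lambda>q. f q *\<^sub>R y q)) p) =
       (\<lambda>p. f p *\<^sub>R (sprod A (act N x) y p + sprod A x (act N y) p - act N (sprod A x y) p) +
             anchor_deriv A (act N x) f p *\<^sub>R y p)" for x y f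
      by (simp add: fun_eq_iff act_scale sprod_scale_right endo_section[OF N] act_add sprod_closed
          sections_scale anchor_smooth algebra_simps)
  qed (simp_all add: fun_eq_iff endo_section[OF N] act_add act_scale anchor_smooth anchor_fun_add
      anchor_fun_mult anchor_sec_add anchor_sec_scale sprod_add_left sprod_add_right sprod_scale_left
      sprod_closed algebra_simps)
qed

end

section \<open>The two defect identities\<close>

text \<open>Common setting of both directions. \<open>N\<close> is a separate parameter because in
  the converse it is given first and agrees with H^sharp B^natural on the fibres only.\<close>

locale form_pair = pre_algebroid A
  for A :: "('m::{t2_space,second_countable_topology},'e::finite_dim_inner,'a::real_vector,
    'v::finite_dim_inner,'z) algebroid_scheme" +
  fixes H B N
  assumes H: "H \<in> Sym2 A" and B: "B \<in> Sym2_dual A" and N: "bundle_endomorphism A N"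
    and N_eq: "u \<in> fibre A p \<Longrightarrow> N p u = sharp_flat A H B p u"
begin

abbreviation "h \<equiv> act (sharp A H)"
abbreviation "b \<equiv> act (flat A B)"
abbreviation "n \<equiv> act N"
abbreviation "ns \<equiv> act (dual_map A N)"
abbreviation "B\<^sub>N \<equiv> \<lambda>p u v. B p (sharp_flat A H B p u) v"

text \<open>\<open>B\<^sub>N\<close> is spelled as in \<open>KV_Omega_structure\<close>; this
  replaces the composite by \<open>N\<close>, for which linearity and smoothness are at
  hand.\<close>

lemma B_N_eq: "u \<in> fibre A p \<Longrightarrow> B\<^sub>N p u v = B p (N p u) v"
  by (simp add: N_eq)

text \<open>Both sides are H(b u, b v), by the symmetry of H and of B.\<close>

lemma B_N_commute:
  assumes u: "u \<in> fibre A p" and v: "v \<in> fibre A p"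
  shows "B p (N p u) v = B p u (N p v)"
proof -
  have "B p (N p w) w' = H p (flat A B p w) (flat A B p w')"
    if w: "w \<in> fibre A p" and w': "w' \<in> fibre A p" for w w'
    using sharp_eval[OF H flat_dual_fibre[OF B w] flat_dual_fibre[OF B w']]
    by (simp add: flat_eval endo_fibre[OF N] w N_eq[OF w, symmetric, unfolded sharp_flat_def o_apply]
        Sym2_dual_commute[OF B w'])
  from this[OF u v] this[OF v u] show ?thesis
    by (simp add: Sym2_commute[OF H flat_dual_fibre[OF B u] flat_dual_fibre[OF B v]]
        Sym2_dual_commute[OF B u endo_fibre[OF N v]])
qed

lemma n_eq: "x \<in> sections A \<Longrightarrow> n x = h (b x)"
  by (simp add: fun_eq_iff act_def N_eq sections_fibre sharp_flat_def)

text \<open>H^sharp and B^natural are self-adjoint, so dualising N = h b reverses the factors and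
  gives b h. Consequently N h and h composed with the dual map are both h b h.\<close>

lemma dual_map_eq:
  assumes \<alpha>: "\<alpha> \<in> dual_fibre A p"
  shows "dual_map A N p \<alpha> = flat A B p (sharp A H p \<alpha>)"
proof
  fix u
  have "\<alpha> (sharp A H p (flat A B p u)) = B p (sharp A H p \<alpha>) u" if u: "u \<in> fibre A p"
    using sharp_eval[OF H flat_dual_fibre[OF B u] \<alpha>] sharp_eval[OF H \<alpha> flat_dual_fibre[OF B u]]
    by (simp add: Sym2_commute[OF H \<alpha> flat_dual_fibre[OF B u]] flat_eval sharp_fibre[OF H \<alpha>]
        Sym2_dual_commute[OF B u])
  then show "dual_map A N p \<alpha> u = flat A B p (sharp A H p \<alpha>) u"
    by (simp add: dual_map_def flat_def N_eq sharp_flat_def)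
qed

lemma N_sharp: "\<alpha> \<in> dual_fibre A p \<Longrightarrow> N p (sharp A H p \<alpha>) = sharp A H p (dual_map A N p \<alpha>)"
  by (simp add: dual_map_eq N_eq sharp_fibre[OF H] sharp_flat_def)

lemma n_h: "\<alpha> \<in> dual_sections A \<Longrightarrow> h (ns \<alpha>) = n (h \<alpha>)"
  by (simp add: fun_eq_iff act_def N_sharp dual_sections_fibre)

text \<open>After expansion the anchor terms of the two \<open>B\<close>-coboundaries match those of
  the product and of the \<open>B\<^sub>N\<close>-coboundary, and the deformed product supplies the
  terms in which z is paired with a product of x and y. The arguments appear in the order x, z, y
  because z is the vector that the dual product is evaluated on.\<close>

lemma dual_prod_flat:
  assumes x: "x \<in> sections A" and y: "y \<in> sections A" and z: "z \<in> sections A"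
  shows "pairing (dual_prod A H (b x) (b y)) z p = B p (sprod (deformed A N) x y p) (z p)
    + coboundary A B (n x) z y p + coboundary A B x z (n y) p - coboundary A B\<^sub>N x z y p"
proof -
  note [simp] = x y z sections_fibre sprod_closed endo_section[OF N] flat_section[OF B]
    bracket_closed
  note comm = Sym2_dual_commute[OF B]
  \<comment> \<open>The anchor differentiates whole functions, so equal functions must first be
    brought to one syntactic form; the next rules do this.\<close>
  have fun1: "pairing (b y) z = (\<lambda>q. B q (z q) (y q))"
    by (simp add: pairing_flat comm fun_eq_iff)
  have fun2: "(\<lambda>q. H q (b x q) (b y q)) = (\<lambda>q. B q (n x q) (y q))"
    by (simp add: pairing_sharp[OF H, symmetric] n_eq[symmetric] pairing_flat comm fun_eq_iff)
  have fun3: "(\<lambda>q. B\<^sub>N q (w q) (y q)) = (\<lambda>q. B q (w q) (n y q))" if "w \<in> sections A" for w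
    using that by (simp add: fun_eq_iff B_N_eq B_N_commute act_def)
  have fun4: "(\<lambda>q. B q (x q) (n y q)) = (\<lambda>q. B q (n x q) (y q))"
    by (simp add: fun_eq_iff B_N_commute act_def)
  have BN: "B\<^sub>N p (v p) (w p) = B p (v p) (n w p)" if "v \<in> sections A" "w \<in> sections A" for v w
    using that by (simp add: B_N_eq B_N_commute act_def)
  have nB: "B p (v p) (n w p) = B p (n v p) (w p)" if "v \<in> sections A" "w \<in> sections A" for v w
    using that by (simp add: B_N_commute act_def)
  have br: "B p (bracket A v w p) (u p) = B p (u p) (sprod A v w p) - B p (u p) (sprod A w v p)"
    if "u \<in> sections A" "v \<in> sections A" "w \<in> sections A" for u v w
    using that dual_fibre_diff[OF flat_dual_fibre[OF B], of "u p" p "sprod A v w p" "sprod A w v p"]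
      subspace_diff[OF subspace_fibre, of "sprod A v w p" p "sprod A w v p"]
    by (simp add: comm flat_eval bracket_def)
  have "sprod (deformed A N) x y p \<in> fibre A p"
    by (simp add: sprod_deformed subspace_diff subspace_add subspace_fibre)
  then have "B p (sprod (deformed A N) x y p) (z p) = flat A B p (z p) (sprod (deformed A N) x y p)"
    by (simp add: comm flat_eval)
  also have "\<dots> = flat A B p (z p) (sprod A (n x) y p) + flat A B p (z p) (sprod A x (n y) p)
      - flat A B p (z p) (n (sprod A x y) p)"
    by (simp add: sprod_deformed dual_fibre_diff[OF flat_dual_fibre[OF B]] dual_fibre_add[OF flat_dual_fibre[OF B]]
        subspace_add subspace_fibre)
  also have "\<dots> = B p (z p) (sprod A (n x) y p) + B p (z p) (sprod A x (n y) p) - B p (z p) (n (sprod A x y) p)"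
    by (simp add: flat_eval)
  finally have def: "B p (sprod (deformed A N) x y p) (z p) =
      B p (z p) (sprod A (n x) y p) + B p (z p) (sprod A x (n y) p) - B p (z p) (n (sprod A x y) p)" .
  show ?thesis
    \<comment> \<open>Once the other terms have cancelled, B(N x, z . y) and B(x, N(z . y)) remain;
      \<open>nB\<close> identifies them.\<close>
    by (simp add: dual_prod_eval[OF H] n_eq[symmetric] fun1 fun2 fun3 fun4 pairing_flat def coboundary_def
        BN br) (simp add: nB)
qed

text \<open>Write u = h alpha and v = h beta. The terms with N u or N v inside a product or an
  anchor are common to both products and cancel. The other terms of the deformed product recur in
  \<open>dual_prod_N\<close> with the opposite sign, so they double in the difference. Two terms
  show up only on the right, a(u)<beta, N y> and B(y, u . v); they cancel between the bracket and
  the coboundary.\<close>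

lemma dual_prod_deformed:
  assumes \<alpha>: "\<alpha> \<in> dual_sections A" and \<beta>: "\<beta> \<in> dual_sections A" and y: "y \<in> sections A"
  shows "pairing (dual_prod (deformed A N) H \<alpha> \<beta>) y p = pairing (dual_prod_N A H N \<alpha> \<beta>) y p
    + 2 * (KV_bracket A H \<alpha> (b y) \<beta> p - coboundary A B (h \<alpha>) y (h \<beta>) p)"
proof -
  interpret D: pre_algebroid "deformed A N"
    by (rule pre_algebroid_deformed[OF N])
  define u v where "u = h \<alpha>" and "v = h \<beta>"
  have uv [simp]: "u \<in> sections A" "v \<in> sections A"
    by (simp_all add: u_def v_def sharp_section[OF H] \<alpha> \<beta>)
  note [simp] = \<alpha> \<beta> y sprod_closed endo_section[OF N] flat_section[OF B] dual_map_section[OF N]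
    bracket_closed
  note comm = Sym2_dual_commute[OF B]
  note diff = dual_fibre_diff[OF dual_sections_fibre] and add = dual_fibre_add[OF dual_sections_fibre]
  have ns_eq: "ns \<gamma> = b (h \<gamma>)" if "\<gamma> \<in> dual_sections A" for \<gamma>
    using that by (simp add: fun_eq_iff act_def dual_map_eq dual_sections_fibre)
  have pair_ns: "pairing (ns \<gamma>) w p = pairing \<gamma> (n w) p" if "w \<in> sections A" for \<gamma> w
    using that by (simp add: pairing_dual_map)
  have n_linear: "pairing \<gamma> (n (bracket A w w')) p = pairing \<gamma> (n (sprod A w w')) p - pairing \<gamma> (n (sprod A w' w)) p"
    if "w \<in> sections A" "w' \<in> sections A" "\<gamma> \<in> dual_sections A" for \<gamma> w w'
    using that pairing_bracket[OF dual_map_section[OF N that(3)] that(1,2), of p]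
    by (simp add: pair_ns)
  have def: "pairing \<gamma> (sprod (deformed A N) w w') p = pairing \<gamma> (sprod A (n w) w') p
      + pairing \<gamma> (sprod A w (n w')) p - pairing \<gamma> (n (sprod A w w')) p"
    if "w \<in> sections A" "w' \<in> sections A" "\<gamma> \<in> dual_sections A" for \<gamma> w w'
    using that by (simp add: sprod_deformed pairing_def diff add sections_fibre subspace_add subspace_fibre)
  have H\<alpha>\<beta>: "pairing \<beta> u = (\<lambda>q. H q (\<alpha> q) (\<beta> q))"
    by (simp add: u_def pairing_sharp[OF H])
  have Bvy: "(\<lambda>q. B q (y q) (v q)) = pairing \<beta> (n y)"
    by (simp add: pairing_dual_map[symmetric] ns_eq v_def[symmetric] pairing_flat comm sections_fibre fun_eq_iff)
  have "pairing \<beta> (n u) = (\<lambda>q. B q (u q) (v q))"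
    by (simp add: pairing_dual_map[symmetric] ns_eq v_def[symmetric] pairing_flat comm sections_fibre fun_eq_iff)
  \<comment> \<open>Here and in \<open>Hns2\<close>: the two mixed products differentiate the same
    function B(u,v) along y, so this term also carries the factor 2.\<close>
  then have Hns1: "(\<lambda>q. H q (ns \<alpha> q) (\<beta> q)) = (\<lambda>q. B q (u q) (v q))"
    by (simp add: pairing_sharp[OF H, symmetric] n_h u_def)
  have "pairing (ns \<beta>) u = (\<lambda>q. B q (u q) (v q))"
    by (simp add: ns_eq v_def[symmetric] pairing_flat comm sections_fibre fun_eq_iff)
  then have Hns2: "(\<lambda>q. H q (\<alpha> q) (ns \<beta> q)) = (\<lambda>q. B q (u q) (v q))"
    by (simp add: pairing_sharp[OF H, symmetric] u_def)
  have h: "h \<alpha> = u" "h \<beta> = v" "h (ns \<alpha>) = n u" "h (ns \<beta>) = n v" "h (b y) = n y"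
    by (simp_all add: u_def v_def n_h n_eq)
  have star: "pairing (dual_prod (deformed A N) H \<alpha> \<beta>) y p =
      anchor_deriv A (n u) (pairing \<beta> y) p
      - pairing \<beta> (sprod (deformed A N) u y) p + pairing \<beta> (sprod (deformed A N) y u) p
      + pairing \<alpha> (sprod (deformed A N) y v) p - anchor_deriv A (n y) (pairing \<beta> u) p"
    using D.dual_prod_eval[of H \<alpha> \<beta> y p] by (simp add: H h H\<alpha>\<beta>)
  have prod_N: "pairing (dual_prod_N A H N \<alpha> \<beta>) y p = pairing (dual_prod A H (ns \<alpha>) \<beta>) y p
      + pairing (dual_prod A H \<alpha> (ns \<beta>)) y p - pairing (dual_prod A H \<alpha> \<beta>) (n y) p"
    using pair_ns[OF y, of "dual_prod A H \<alpha> \<beta>"] by (simp add: dual_prod_N_def pairing_def)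
  have KV: "KV_bracket A H \<alpha> (b y) \<beta> p = anchor_deriv A u (pairing \<beta> (n y)) p
      - anchor_deriv A (n y) (pairing \<beta> u) p + pairing \<alpha> (sprod A (n y) v) p
      - B p (y p) (sprod A u v p) - pairing \<beta> (bracket A u (n y)) p"
    by (simp add: KV_bracket_def Let_def h pairing_flat)
  \<comment> \<open>Since the dual of \<open>N\<close> is b h, values of \<open>B\<close> on u or v
    become pairings of alpha or beta with N, the form in which the products are expanded.\<close>
  have "B p (u p) (sprod A y v p) = pairing \<alpha> (n (sprod A y v)) p"
    by (simp add: pair_ns[symmetric] ns_eq h pairing_flat)
  moreover have "B p (bracket A u y p) (v p) = pairing \<beta> (n (bracket A u y)) p"
    by (simp add: pair_ns[symmetric] ns_eq h pairing_flat comm sections_fibre)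
  ultimately have cob: "coboundary A B u y v p = anchor_deriv A u (pairing \<beta> (n y)) p
      - anchor_deriv A y (\<lambda>q. B q (u q) (v q)) p
      - B p (y p) (sprod A u v p) + pairing \<alpha> (n (sprod A y v)) p - pairing \<beta> (n (bracket A u y)) p"
    by (simp add: coboundary_def Bvy)
  show ?thesis
    by (simp add: star prod_N KV cob h def dual_prod_eval[OF H] pair_ns pairing_dual_map Hns1 Hns2
        H\<alpha>\<beta>[symmetric] n_linear pairing_bracket)
qed

lemma dual_prod_N_section:
  "\<alpha> \<in> dual_sections A \<Longrightarrow> \<beta> \<in> dual_sections A \<Longrightarrow> dual_prod_N A H N \<alpha> \<beta> \<in> dual_sections A"
  unfolding dual_prod_N_def[abs_def]
  by (intro dual_sections_add dual_sections_diff dual_map_section[OF N] dual_prod_section[OF H])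

lemma dual_prod_deformed_section:
  assumes "\<alpha> \<in> dual_sections A" "\<beta> \<in> dual_sections A"
  shows "dual_prod (deformed A N) H \<alpha> \<beta> \<in> dual_sections A"
  using pre_algebroid.dual_prod_section[OF pre_algebroid_deformed[OF N], of H \<alpha> \<beta>] H assms by simp

lemma sprod_deformed_section:
  "x \<in> sections A \<Longrightarrow> y \<in> sections A \<Longrightarrow> sprod (deformed A N) x y \<in> sections A"
  using pre_algebroid.sprod_closed[OF pre_algebroid_deformed[OF N], of x y] by simp

section \<open>The two implications\<close>

lemma KVN_of_KV_Omega:
  assumes KV: "Koszul_Vinberg A H"
    and cob: "\<And>x y z p. x \<in> sections A \<Longrightarrow> y \<in> sections A \<Longrightarrow> z \<in> sections A \<Longrightarrow> coboundary A B x y z p = 0"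
    and cob_N: "\<And>x y z p. x \<in> sections A \<Longrightarrow> y \<in> sections A \<Longrightarrow> z \<in> sections A \<Longrightarrow> coboundary A B\<^sub>N x y z p = 0"
  shows "KVN_structure A H N"
  unfolding KVN_structure_def
proof (intro conjI ballI allI)
  show "Nijenhuis_operator A N"
    unfolding Nijenhuis_operator_def
  proof (intro conjI ballI N)
    fix x y assume x: "x \<in> sections A" and y: "y \<in> sections A"
    have "dual_prod A H (b x) (b y) = b (sprod (deformed A N) x y)"
    proof (rule dual_section_eqI)
      fix z p assume z: "z \<in> sections A"
      show "pairing (dual_prod A H (b x) (b y)) z p = pairing (b (sprod (deformed A N) x y)) z p"
        by (simp add: dual_prod_flat x y z cob cob_N endo_section[OF N] pairing_flat)
    qed (intro dual_prod_section[OF H] flat_section[OF B] sprod_deformed_section x y)+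
    then have "sprod A (n x) (n y) = n (sprod (deformed A N) x y)"
      using sharp_dual_prod[OF KV flat_section[OF B x] flat_section[OF B y]]
      by (simp add: n_eq x y sprod_deformed_section)
    then show "sprod A (n x) (n y) = n (\<lambda>p. sprod A x (n y) p + sprod A (n x) y p - n (sprod A x y) p)"
      by (simp add: sprod_deformed add.commute)
  qed
next
  fix \<alpha> \<beta> assume \<alpha>: "\<alpha> \<in> dual_sections A" and \<beta>: "\<beta> \<in> dual_sections A"
  show "dual_prod (deformed A N) H \<alpha> \<beta> = dual_prod_N A H N \<alpha> \<beta>"
  proof (rule dual_section_eqI)
    fix y p assume y: "y \<in> sections A"
    have "KV_bracket A H \<alpha> (b y) \<beta> p = 0"
      using KV \<alpha> \<beta> flat_section[OF B y] by (simp add: Koszul_Vinberg_def)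
    then show "pairing (dual_prod (deformed A N) H \<alpha> \<beta>) y p = pairing (dual_prod_N A H N \<alpha> \<beta>) y p"
      by (simp add: dual_prod_deformed \<alpha> \<beta> y cob sharp_section[OF H])
  qed (intro dual_prod_N_section dual_prod_deformed_section \<alpha> \<beta>)+
qed (use KV N_sharp in auto)

text \<open>Nondegeneracy is used in two ways: surjectivity of H^sharp for the cocycle condition on
  \<open>B\<close>, injectivity for the one on \<open>B\<^sub>N\<close>.\<close>

lemma KV_Omega_of_KVN:
  assumes KVN: "KVN_structure A H N" and nd: "nondegenerate A H"
  shows "KV_Omega_structure A H B"
proof -
  have KV: "Koszul_Vinberg A H"
    using KVN by (simp add: KVN_structure_def)
  have cob: "coboundary A B x y z p = 0"
    if x: "x \<in> sections A" and y: "y \<in> sections A" and z: "z \<in> sections A" for x y z p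
  proof -
    \<comment> \<open>The preimages must be smooth dual sections, not merely pointwise ones, before
      the third identity can be applied to them; this is \<open>sharp_inv_section\<close>.\<close>
    define \<alpha> \<beta> where "\<alpha> = act (sharp_inv A H) x" and "\<beta> = act (sharp_inv A H) z"
    have \<alpha>\<beta>: "\<alpha> \<in> dual_sections A" "\<beta> \<in> dual_sections A"
      unfolding \<alpha>_def \<beta>_def by (intro sharp_inv_section[OF H nd] x z)+
    have h: "h \<alpha> = x" "h \<beta> = z"
      by (simp_all add: \<alpha>_def \<beta>_def fun_eq_iff act_def sharp_sharp_inv[OF H nd] sections_fibre x z)
    have "KV_bracket A H \<alpha> (b y) \<beta> p = 0"
      using KV \<alpha>\<beta> flat_section[OF B y] by (simp add: Koszul_Vinberg_def)
    moreover have "dual_prod (deformed A N) H \<alpha> \<beta> = dual_prod_N A H N \<alpha> \<beta>"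
      using KVN \<alpha>\<beta> by (simp add: KVN_structure_def)
    ultimately show ?thesis
      using dual_prod_deformed[OF \<alpha>\<beta> y, of p] by (simp add: h)
  qed
  \<comment> \<open>The order x, z, y is that of \<open>dual_prod_flat\<close>; as all three
    sections are arbitrary, this is the full cocycle condition.\<close>
  have cob_N: "coboundary A B\<^sub>N x z y p = 0"
    if x: "x \<in> sections A" and y: "y \<in> sections A" and z: "z \<in> sections A" for x y z p
  proof -
    have "h (dual_prod A H (b x) (b y)) = sprod A (n x) (n y)"
      using sharp_dual_prod[OF KV flat_section[OF B x] flat_section[OF B y]] by (simp add: n_eq x y)
    also have "\<dots> = n (sprod (deformed A N) x y)"
      using KVN x y by (simp add: KVN_structure_def Nijenhuis_operator_def sprod_deformed add.commute)
    also have "\<dots> = h (b (sprod (deformed A N) x y))"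
      by (simp add: n_eq sprod_deformed_section x y)
    finally have "sharp A H p (dual_prod A H (b x) (b y) p) = sharp A H p (b (sprod (deformed A N) x y) p)"
      by (simp add: fun_eq_iff act_def)
    moreover have "dual_prod A H (b x) (b y) p \<in> dual_fibre A p" "b (sprod (deformed A N) x y) p \<in> dual_fibre A p"
      by (intro dual_sections_fibre dual_prod_section[OF H] flat_section[OF B] sprod_deformed_section x y)+
    ultimately have "dual_prod A H (b x) (b y) p = b (sprod (deformed A N) x y) p"
      using nd by (auto simp: nondegenerate_def bij_betw_def inj_on_def)
    then have "pairing (dual_prod A H (b x) (b y)) z p = B p (sprod (deformed A N) x y p) (z p)"
      by (simp add: pairing_def act_def flat_eval sections_fibre[OF z])
    then show ?thesis
      using dual_prod_flat[OF x y z, of p] by (simp add: cob x y z endo_section[OF N])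
  qed
  have "B\<^sub>N \<in> Sym2_dual A"
  \<comment> \<open>\<open>two_cocycle\<close> also demands a smooth symmetric form; symmetry here
    is the self-adjointness of \<open>N\<close> with respect to \<open>B\<close>.\<close>
  proof (rule Sym2_dualI)
    show "B\<^sub>N p u v = B\<^sub>N p v u" if "u \<in> fibre A p" "v \<in> fibre A p" for p u v
      using B_N_commute[OF that] Sym2_dual_commute[OF B that(1) endo_fibre[OF N that(2)]]
      by (simp add: B_N_eq that)
    show "B\<^sub>N p (u + v) w = B\<^sub>N p u w + B\<^sub>N p v w"
      if "u \<in> fibre A p" "v \<in> fibre A p" "w \<in> fibre A p" for p u v w
      using that subspace_add[OF subspace_fibre that(1,2)]
      by (simp add: B_N_eq endo_add[OF N] endo_fibre[OF N] Sym2_dual_add[OF B])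
    show "B\<^sub>N p (c *\<^sub>R u) v = c * B\<^sub>N p u v" if "u \<in> fibre A p" "v \<in> fibre A p" for p c u v
      using that subspace_scale[OF subspace_fibre that(1)]
      by (simp add: B_N_eq endo_scale[OF N] endo_fibre[OF N] Sym2_dual_scale[OF B])
    show "(\<lambda>q. B\<^sub>N q (x q) (y q)) \<in> smooth_functions A" if "x \<in> sections A" "y \<in> sections A" for x y
      using Sym2_dual_smooth[OF B endo_section[OF N that(1)] that(2)] that
      by (simp add: B_N_eq sections_fibre act_def)
  qed
  then show ?thesis
    using KV B cob cob_N by (simp add: KV_Omega_structure_def two_cocycle_def)
qed

end

theorem proposition5p8:
  fixes A :: "('m::{t2_space,second_countable_topology}, 'e::finite_dim_inner,
               'a::real_vector, 'v::finite_dim_inner) algebroid"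
  assumes "left_symmetric_algebroid A"
  shows "(\<forall>H B. KV_Omega_structure A H B \<longrightarrow> KVN_structure A H (sharp_flat A H B)) \<and>
         (\<forall>H N B. KVN_structure A H N \<and> nondegenerate A H \<and>
            (\<forall>p. \<forall>u\<in>fibre A p. flat A B p u = sharp_inv A H p (N p u))
            \<longrightarrow> KV_Omega_structure A H B)"
proof -
  interpret pre_algebroid A
    by (rule left_symmetric_algebroid_imp_pre_algebroid[OF assms])
  show ?thesis
  proof (intro conjI allI impI)
    fix H B assume *: "KV_Omega_structure A H B"
    then have HB: "H \<in> Sym2 A" "B \<in> Sym2_dual A"
      by (auto simp: KV_Omega_structure_def Koszul_Vinberg_def two_cocycle_def)
    interpret form_pair A H B "sharp_flat A H B"
      by unfold_locales (simp_all add: HB sharp_flat_endomorphism)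
    show "KVN_structure A H (sharp_flat A H B)"
      using * by (intro KVN_of_KV_Omega) (auto simp: KV_Omega_structure_def two_cocycle_def)
  next
    fix H N B
    assume *: "KVN_structure A H N \<and> nondegenerate A H \<and>
      (\<forall>p. \<forall>u\<in>fibre A p. flat A B p u = sharp_inv A H p (N p u))"
    then have H: "H \<in> Sym2 A" and N: "bundle_endomorphism A N"
      and NH: "\<And>p \<alpha>. \<alpha> \<in> dual_fibre A p \<Longrightarrow> N p (sharp A H p \<alpha>) = sharp A H p (dual_map A N p \<alpha>)"
      by (auto simp: KVN_structure_def Koszul_Vinberg_def Nijenhuis_operator_def)
    \<comment> \<open>Symmetry and smoothness of \<open>B\<close> are derived: the hypothesis only
      says which functional \<open>B\<close> gives on each fibre.\<close>
    have B: "B \<in> Sym2_dual A"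
      using * by (intro sharp_inv_form[OF H _ N NH]) auto
    interpret form_pair A H B N
      \<comment> \<open>On a fibre H^sharp B^natural = H^sharp (H^sharp)^-1 N = N, as the locale
        requires.\<close>
      by unfold_locales (use * in \<open>auto simp: H B N sharp_flat_def sharp_sharp_inv[OF H] endo_fibre[OF N]\<close>)
    show "KV_Omega_structure A H B"
      using * by (intro KV_Omega_of_KVN) auto
  qed
qed

end
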